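(* Let $W$ be a finite Coxeter group, $M_1=M_1(W)$ its Borel submonoid of the biHecke monoid, and $\mathbb{K}$ a field. The radical of the monoid algebra $\mathbb{K}[M_1]$ is the ideal with basis $(f^\infty-f)_f$, for $f\in M_1$ non-idempotent. The quotient of $\mathbb{K}[M_1]$ by its radical is commutative. Therefore all simple $M_1$-modules are one-dimensional. In fact, the family $\{S_w\}_{w\in W}$ forms a complete system of representatives of the simple $M_1$-modules, where $S_w$ is the one-dimensional right module with basis $\{\epsilon_w\}$ and action of $f\in M_1$ given by $\epsilon_w.f=\epsilon_w$ if $w.f=w$ and $\epsilon_w.f=0$ otherwise.
   Context: $W$ is a finite Coxeter group with simple reflections $(s_i)_{i\in I}$, identity $1$, length $\ell$; $D_R(w)=\{i:\ell(ws_i)<\ell(w)\}$. The biHecke monoid $M(W)$ is the monoid of functions $W\to W$, acting on the right ($w.(fg)=(w.f).g$), generated by $\pi_i,\overline\pi_i$ ($i\in I$), where $w.\pi_i=w$ if $i\in D_R(w)$ and $ws_i$ otherwise; $w.\overline\pi_i=ws_i$ if $i\in D_R(w)$ and $w$ otherwise. $M_1(W)=\{f\in M(W):1.f=1\}$. For $f\in M(W)$ there is $k>0$ with $f^{k+1}=f^k$, and $f^\infty:=f^k$ (an idempotent). *)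

theory Defs
  imports "HOL-Algebra.QuotRing" "Jordan_Normal_Form.Missing_VectorSpace"
begin

section \<open>Group presentations and Coxeter systems\<close>

text \<open>A word is a list of signed letters; \<open>(i, True)\<close> stands for the generator \<open>i\<close> and
  \<open>(i, False)\<close> for its formal inverse.\<close>

definition word_eval :: "('w, 'e) monoid_scheme \<Rightarrow> ('i \<Rightarrow> 'w) \<Rightarrow> ('i \<times> bool) list \<Rightarrow> 'w" where
  "word_eval G s u =
     foldr (\<lambda>(i, b) x. (if b then s i else inv\<^bsub>G\<^esub> (s i)) \<otimes>\<^bsub>G\<^esub> x) u \<one>\<^bsub>G\<^esub>"

inductive word_equiv :: "'i set \<Rightarrow> ('i \<times> bool) list set \<Rightarrow>
    ('i \<times> bool) list \<Rightarrow> ('i \<times> bool) list \<Rightarrow> bool"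
  for I R where
  refl: "word_equiv I R u u"
| sym: "word_equiv I R u v \<Longrightarrow> word_equiv I R v u"
| trans: "word_equiv I R u v \<Longrightarrow> word_equiv I R v x \<Longrightarrow> word_equiv I R u x"
| cancel: "i \<in> I \<Longrightarrow> word_equiv I R (u @ [(i, b), (i, \<not> b)] @ v) (u @ v)"
| relator: "r \<in> R \<Longrightarrow> word_equiv I R (u @ r @ v) (u @ v)"

text \<open>\<open>G = \<langle>s i (i \<in> I) | R\<rangle>\<close>: the canonical map from the group presented by \<open>I\<close> and \<open>R\<close> to
  \<open>G\<close> is well defined and injective (last conjunct) and surjective.\<close>

definition presented_by ::
  "('w, 'e) monoid_scheme \<Rightarrow> 'i set \<Rightarrow> ('i \<Rightarrow> 'w) \<Rightarrow> ('i \<times> bool) list set \<Rightarrow> bool" where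
  "presented_by G I s R \<longleftrightarrow>
     group G \<and> s \<in> I \<rightarrow> carrier G \<and>
     word_eval G s ` lists (I \<times> UNIV) = carrier G \<and>
     (\<forall>u\<in>lists (I \<times> UNIV). \<forall>v\<in>lists (I \<times> UNIV).
        word_eval G s u = word_eval G s v \<longleftrightarrow> word_equiv I R u v)"

text \<open>Coxeter matrices encode \<open>m i j = \<infinity>\<close> as \<open>0\<close>; the corresponding relator is then the empty word.\<close>

definition coxeter_matrix :: "'i set \<Rightarrow> ('i \<Rightarrow> 'i \<Rightarrow> nat) \<Rightarrow> bool" where
  "coxeter_matrix I m \<longleftrightarrow>
     (\<forall>i\<in>I. \<forall>j\<in>I. m i j = m j i \<and> (m i j = 1 \<longleftrightarrow> i = j))"

definition coxeter_relators :: "'i set \<Rightarrow> ('i \<Rightarrow> 'i \<Rightarrow> nat) \<Rightarrow> ('i \<times> bool) list set" where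
  "coxeter_relators I m =
     {concat (replicate (m i j) [(i, True), (j, True)]) | i j. i \<in> I \<and> j \<in> I}"

definition coxeter_system ::
  "('w, 'e) monoid_scheme \<Rightarrow> 'i set \<Rightarrow> ('i \<Rightarrow> 'w) \<Rightarrow> ('i \<Rightarrow> 'i \<Rightarrow> nat) \<Rightarrow> bool" where
  "coxeter_system W I s m \<longleftrightarrow>
     coxeter_matrix I m \<and> presented_by W I s (coxeter_relators I m)"

definition coxeter_length :: "('w, 'e) monoid_scheme \<Rightarrow> 'i set \<Rightarrow> ('i \<Rightarrow> 'w) \<Rightarrow> 'w \<Rightarrow> nat" where
  "coxeter_length W I s w =
     (LEAST n. \<exists>u\<in>lists I. length u = n \<and> foldr (\<lambda>i x. s i \<otimes>\<^bsub>W\<^esub> x) u \<one>\<^bsub>W\<^esub> = w)"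

definition right_descents :: "('w, 'e) monoid_scheme \<Rightarrow> 'i set \<Rightarrow> ('i \<Rightarrow> 'w) \<Rightarrow> 'w \<Rightarrow> 'i set" where
  "right_descents W I s w =
     {i\<in>I. coxeter_length W I s (w \<otimes>\<^bsub>W\<^esub> s i) < coxeter_length W I s w}"


section \<open>The biHecke monoid and its Borel submonoid\<close>

text \<open>All transformations of \<open>X\<close>, acting on the right: \<open>w.f\<close> is rendered as \<open>f w\<close>, so the
  product \<open>fg\<close> is ``first \<open>f\<close>, then \<open>g\<close>''.\<close>

definition transformation_monoid :: "'w set \<Rightarrow> ('w \<Rightarrow> 'w) monoid" where
  "transformation_monoid X =
     \<lparr>carrier = X \<rightarrow>\<^sub>E X, mult = (\<lambda>f g. compose X g f), one = (\<lambda>x\<in>X. x)\<rparr>"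

inductive_set generated_submonoid :: "('m, 'e) monoid_scheme \<Rightarrow> 'm set \<Rightarrow> 'm set"
  for G A where
  one: "\<one>\<^bsub>G\<^esub> \<in> generated_submonoid G A"
| gen: "f \<in> A \<Longrightarrow> f \<in> generated_submonoid G A"
| mult: "f \<in> generated_submonoid G A \<Longrightarrow> g \<in> generated_submonoid G A \<Longrightarrow>
    f \<otimes>\<^bsub>G\<^esub> g \<in> generated_submonoid G A"

definition hecke_op :: "('w, 'e) monoid_scheme \<Rightarrow> 'i set \<Rightarrow> ('i \<Rightarrow> 'w) \<Rightarrow> 'i \<Rightarrow> 'w \<Rightarrow> 'w" where
  "hecke_op W I s i =
     (\<lambda>w\<in>carrier W. if i \<in> right_descents W I s w then w else w \<otimes>\<^bsub>W\<^esub> s i)"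

definition hecke_op_bar :: "('w, 'e) monoid_scheme \<Rightarrow> 'i set \<Rightarrow> ('i \<Rightarrow> 'w) \<Rightarrow> 'i \<Rightarrow> 'w \<Rightarrow> 'w" where
  "hecke_op_bar W I s i =
     (\<lambda>w\<in>carrier W. if i \<in> right_descents W I s w then w \<otimes>\<^bsub>W\<^esub> s i else w)"

definition bihecke_monoid ::
  "('w, 'e) monoid_scheme \<Rightarrow> 'i set \<Rightarrow> ('i \<Rightarrow> 'w) \<Rightarrow> ('w \<Rightarrow> 'w) monoid" where
  "bihecke_monoid W I s =
     (transformation_monoid (carrier W))
       \<lparr>carrier := generated_submonoid (transformation_monoid (carrier W))
          (hecke_op W I s ` I \<union> hecke_op_bar W I s ` I)\<rparr>"

definition borel_submonoid ::
  "('w, 'e) monoid_scheme \<Rightarrow> 'i set \<Rightarrow> ('i \<Rightarrow> 'w) \<Rightarrow> ('w \<Rightarrow> 'w) monoid" where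
  "borel_submonoid W I s =
     (bihecke_monoid W I s)
       \<lparr>carrier := {f \<in> carrier (bihecke_monoid W I s). f \<one>\<^bsub>W\<^esub> = \<one>\<^bsub>W\<^esub>}\<rparr>"

text \<open>\<open>f\<^sup>\<infinity>\<close> for \<open>f\<close> in an aperiodic monoid; all admissible exponents \<open>k\<close> give the same power.\<close>

definition eventual_power :: "('m, 'e) monoid_scheme \<Rightarrow> 'm \<Rightarrow> 'm" where
  "eventual_power M f =
     f [^]\<^bsub>M\<^esub> (LEAST k::nat. 0 < k \<and> f [^]\<^bsub>M\<^esub> (k + 1) = f [^]\<^bsub>M\<^esub> k)"

definition nonidempotents :: "('m, 'e) monoid_scheme \<Rightarrow> 'm set" where
  "nonidempotents M = {f \<in> carrier M. f \<otimes>\<^bsub>M\<^esub> f \<noteq> f}"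


section \<open>Monoid algebras and the radical\<close>

definition monoid_algebra ::
  "('k, 'c) ring_scheme \<Rightarrow> ('m, 'e) monoid_scheme \<Rightarrow> ('k, 'm \<Rightarrow> 'k) module" where
  "monoid_algebra K M =
     \<lparr>carrier = {a \<in> carrier M \<rightarrow>\<^sub>E carrier K. finite {x \<in> carrier M. a x \<noteq> \<zero>\<^bsub>K\<^esub>}},
      mult = (\<lambda>a b. \<lambda>z\<in>carrier M.
        (\<Oplus>\<^bsub>K\<^esub>p \<in> {(x, y). x \<in> carrier M \<and> y \<in> carrier M \<and> a x \<noteq> \<zero>\<^bsub>K\<^esub> \<and> b y \<noteq> \<zero>\<^bsub>K\<^esub> \<and> x \<otimes>\<^bsub>M\<^esub> y = z}.
           a (fst p) \<otimes>\<^bsub>K\<^esub> b (snd p))),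
      one = (\<lambda>x\<in>carrier M. if x = \<one>\<^bsub>M\<^esub> then \<one>\<^bsub>K\<^esub> else \<zero>\<^bsub>K\<^esub>),
      zero = (\<lambda>x\<in>carrier M. \<zero>\<^bsub>K\<^esub>),
      add = (\<lambda>a b. \<lambda>x\<in>carrier M. a x \<oplus>\<^bsub>K\<^esub> b x),
      smult = (\<lambda>c a. \<lambda>x\<in>carrier M. c \<otimes>\<^bsub>K\<^esub> a x)\<rparr>"

definition monoid_algebra_of ::
  "('k, 'c) ring_scheme \<Rightarrow> ('m, 'e) monoid_scheme \<Rightarrow> 'm \<Rightarrow> 'm \<Rightarrow> 'k" where
  "monoid_algebra_of K M f = (\<lambda>x\<in>carrier M. if x = f then \<one>\<^bsub>K\<^esub> else \<zero>\<^bsub>K\<^esub>)"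

definition right_ideal :: "'a set \<Rightarrow> ('a, 'c) ring_scheme \<Rightarrow> bool" where
  "right_ideal J A \<longleftrightarrow>
     additive_subgroup J A \<and> (\<forall>x\<in>J. \<forall>a\<in>carrier A. x \<otimes>\<^bsub>A\<^esub> a \<in> J)"

definition maximal_right_ideal :: "'a set \<Rightarrow> ('a, 'c) ring_scheme \<Rightarrow> bool" where
  "maximal_right_ideal J A \<longleftrightarrow>
     right_ideal J A \<and> J \<noteq> carrier A \<and>
     (\<forall>J'. right_ideal J' A \<and> J \<subseteq> J' \<longrightarrow> J' = J \<or> J' = carrier A)"

definition jacobson_radical :: "('a, 'c) ring_scheme \<Rightarrow> 'a set" where
  "jacobson_radical A = {x \<in> carrier A. \<forall>J. maximal_right_ideal J A \<longrightarrow> x \<in> J}"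


section \<open>Right modules over a monoid\<close>

text \<open>A right module over the monoid \<open>M\<close> (equivalently, over its algebra over \<open>K\<close>) is a
  \<open>K\<close>-vector space \<open>V\<close> with a linear right action; \<open>act v f\<close> is \<open>v.f\<close>.  The multiplicative
  fields of the record \<open>V\<close> play no role.\<close>

locale right_monoid_module = vectorspace K V
  for K :: "('k, 'c) ring_scheme" and M :: "('m, 'e) monoid_scheme"
    and V :: "('k, 'v) module" and act :: "'v \<Rightarrow> 'm \<Rightarrow> 'v" +
  assumes act_linear: "f \<in> carrier M \<Longrightarrow> (\<lambda>v. act v f) \<in> module_hom K V V"
    and act_one: "v \<in> carrier V \<Longrightarrow> act v \<one>\<^bsub>M\<^esub> = v"
    and act_mult: "f \<in> carrier M \<Longrightarrow> g \<in> carrier M \<Longrightarrow> v \<in> carrier V \<Longrightarrow>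
      act v (f \<otimes>\<^bsub>M\<^esub> g) = act (act v f) g"

definition simple_right_monoid_module ::
  "('k, 'c) ring_scheme \<Rightarrow> ('m, 'e) monoid_scheme \<Rightarrow> ('k, 'v) module \<Rightarrow> ('v \<Rightarrow> 'm \<Rightarrow> 'v) \<Rightarrow> bool" where
  "simple_right_monoid_module K M V act \<longleftrightarrow>
     right_monoid_module K M V act \<and> carrier V \<noteq> {\<zero>\<^bsub>V\<^esub>} \<and>
     (\<forall>U. subspace K U V \<and> (\<forall>v\<in>U. \<forall>f\<in>carrier M. act v f \<in> U) \<longrightarrow>
        U = {\<zero>\<^bsub>V\<^esub>} \<or> U = carrier V)"

definition isomorphic_right_monoid_modules ::
  "('k, 'c) ring_scheme \<Rightarrow> ('m, 'e) monoid_scheme \<Rightarrow>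
   ('k, 'v) module \<Rightarrow> ('v \<Rightarrow> 'm \<Rightarrow> 'v) \<Rightarrow> ('k, 'u) module \<Rightarrow> ('u \<Rightarrow> 'm \<Rightarrow> 'u) \<Rightarrow> bool" where
  "isomorphic_right_monoid_modules K M V act V' act' \<longleftrightarrow>
     (\<exists>\<phi>. \<phi> \<in> module_hom K V V' \<and> bij_betw \<phi> (carrier V) (carrier V') \<and>
        (\<forall>v\<in>carrier V. \<forall>f\<in>carrier M. \<phi> (act v f) = act' (\<phi> v) f))"

text \<open>The space \<open>K\<close> over itself, with basis \<open>{\<one>}\<close>; it carries each of the one-dimensional modules
  \<open>S\<^sub>w\<close>, with \<open>\<epsilon>\<^sub>w = \<one>\<close>.\<close>

definition line :: "('k, 'c) ring_scheme \<Rightarrow> ('k, 'k) module" where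
  "line K = \<lparr>carrier = carrier K, mult = mult K, one = \<one>\<^bsub>K\<^esub>, zero = \<zero>\<^bsub>K\<^esub>, add = add K,
     smult = mult K\<rparr>"

text \<open>\<open>\<epsilon>\<^sub>w.f = \<epsilon>\<^sub>w\<close> if \<open>w.f = w\<close> and \<open>\<epsilon>\<^sub>w.f = 0\<close> otherwise, extended linearly to
  all multiples \<open>c\<close> of \<open>\<epsilon>\<^sub>w\<close>.\<close>

definition S_act :: "('k, 'c) ring_scheme \<Rightarrow> 'w \<Rightarrow> 'k \<Rightarrow> ('w \<Rightarrow> 'w) \<Rightarrow> 'k" where
  "S_act K w c f = (if f w = w then c else \<zero>\<^bsub>K\<^esub>)"

end

theory Submission
  imports Defs
begin

text \<open>The proof separates a combinatorial part on \<open>W\<close> from a part on monoid algebras.  They meet in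
  one fact: the Borel submonoid is a finite J-trivial monoid, and its idempotents \<open>e\<^sub>w\<close> are
  indexed by \<open>w \<in> W\<close> so that \<open>e\<^sub>w g = e\<^sub>w\<close> holds exactly when \<open>g\<close> fixes \<open>w\<close>.

  On the Coxeter side everything follows from one cocycle: the parity with which a reflection \<open>t\<close>
  occurs among the reflections that a word passes through depends only on the element \<open>x\<close> that the
  word represents (\<open>word_inversion_word_equiv\<close>), and it is odd exactly when \<open>x t\<close> is shorter than
  \<open>x\<close> (\<open>inversion_iff\<close>).  Multiplying \<open>x\<close> by a generator changes the parity of a single reflection,
  up to conjugation.  Hence left and right multiplication carry an edge \<open>x \<rightarrow> x t\<close> of the Bruhat
  graph to another edge unless they reverse it (\<open>bruhat_edge_left\<close>, \<open>bruhat_edge_right\<close>), and the operators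
  \<open>\<pi>\<^sub>i\<close> and their duals preserve the Bruhat order.  They moreover send each edge \<open>x < s\<^sub>j x\<close> of the
  left weak order to a point or to an edge with the same label \<open>j\<close> (\<open>up_down_left_edge\<close>).  These
  two properties pass to all of the biHecke monoid.

  An element \<open>f\<close> with \<open>f 1 = 1\<close> therefore satisfies \<open>f x \<le> x\<close> (\<open>borel_regressive\<close>): climbing from
  \<open>1\<close> to \<open>x\<close> by left edges, the image climbs by part of their labels.  Order preserving regressive maps
  form a J-trivial monoid (\<open>borel_R_trivial\<close>, \<open>borel_L_trivial\<close>).  If \<open>f\<close> fixes \<open>w\<close>, it fixes
  everything below \<open>w\<close> in left order (\<open>borel_fix_down\<close>); since every element lies below the longest
  one, the fixed points of an idempotent \<open>e\<close> form the lower interval of \<open>w = e w\<^sub>0\<close>.  Each \<open>w\<close> arises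
  from a product of ascending operators from \<open>w\<close> to \<open>w\<^sub>0\<close> followed by their descending duals
  (\<open>exists_projection\<close>).

  For a finite J-trivial monoid \<open>M\<close> and an idempotent \<open>e\<close>, the rule sending \<open>g\<close> to \<open>1\<close> if
  \<open>e g = e\<close> and to \<open>0\<close> otherwise is multiplicative.  Its linear extension is a character of the
  algebra, with a maximal right ideal as kernel.  Conversely, in a simple right module choose \<open>f\<close>
  that acts nontrivially and has the smallest right ideal \<open>f M\<close>.  Then for every \<open>g\<close> either
  \<open>f g = f\<close> or \<open>f g\<close> acts as zero, so a nonzero vector of the form \<open>v f\<close> is an eigenvector of all of
  \<open>M\<close> and spans the module, and \<open>f\<close> is idempotent (\<open>simple_module_eigenvector\<close>).  The same argument
  modulo a maximal right ideal shows that the Jacobson radical is the common kernel of the characters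
  (\<open>jacobson_radical_eq\<close>).  This kernel contains all \<open>f\<^sup>\<infinity> - f\<close>; modulo these, an element is a
  combination of idempotents, and such a combination in the kernel vanishes because the matrix of
  the relation \<open>e e' = e\<close> is triangular (\<open>character_kernel_supported_on_idempotents\<close>).\<close>

section \<open>Coxeter systems: words and generators\<close>

locale coxeter_group = group W for W :: "('w, 'e) monoid_scheme" (structure) +
  fixes I :: "'i set" and s :: "'i \<Rightarrow> 'w" and m :: "'i \<Rightarrow> 'i \<Rightarrow> nat"
  assumes coxeter: "coxeter_system W I s m"
begin

abbreviation words :: "('i \<times> bool) list set" where "words \<equiv> lists (I \<times> UNIV)"
abbreviation ev :: "('i \<times> bool) list \<Rightarrow> 'w" where "ev \<equiv> word_eval W s"
abbreviation len :: "'w \<Rightarrow> nat" where "len \<equiv> coxeter_length W I s"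

lemma s_closed [simp]: "i \<in> I \<Longrightarrow> s i \<in> carrier W"
  using coxeter unfolding coxeter_system_def presented_by_def by auto

lemma ev_Nil [simp]: "ev [] = \<one>"
  by (simp add: word_eval_def)

lemma ev_eq_iff: "u \<in> words \<Longrightarrow> v \<in> words \<Longrightarrow> ev u = ev v \<longleftrightarrow> word_equiv I (coxeter_relators I m) u v"
  using coxeter unfolding coxeter_system_def presented_by_def by blast

lemma s_square [simp]: "s i \<otimes> s i = \<one>" if i: "i \<in> I"
proof -
  have "m i i = 1"
    using coxeter i unfolding coxeter_system_def coxeter_matrix_def by blast
  then have "[(i, True), (i, True)] = concat (replicate (m i i) [(i, True), (i, True)])"
    by simp
  with i have r: "[(i, True), (i, True)] \<in> coxeter_relators I m"
    unfolding coxeter_relators_def by blast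
  have "word_equiv I (coxeter_relators I m) [(i, True), (i, True)] []"
    using word_equiv.relator[OF r, of I "[]" "[]"] by simp
  then have "ev [(i, True), (i, True)] = ev []"
    using i by (subst ev_eq_iff) auto
  then show ?thesis using i by (simp add: word_eval_def)
qed

lemma inv_s [simp]: "i \<in> I \<Longrightarrow> inv (s i) = s i"
  by (rule inv_equality) auto

lemma s_cancel_left [simp]: "i \<in> I \<Longrightarrow> x \<in> carrier W \<Longrightarrow> s i \<otimes> (s i \<otimes> x) = x"
  by (simp add: m_assoc[symmetric])

lemma s_cancel_right [simp]: "i \<in> I \<Longrightarrow> x \<in> carrier W \<Longrightarrow> x \<otimes> s i \<otimes> s i = x"
  by (simp add: m_assoc)

lemma ev_Cons [simp]: "fst l \<in> I \<Longrightarrow> ev (l # u) = s (fst l) \<otimes> ev u"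
  by (cases l) (simp add: word_eval_def)

lemma ev_closed [simp]: "u \<in> words \<Longrightarrow> ev u \<in> carrier W"
  by (induction u) auto

lemma ev_append [simp]: "ev (u @ v) = ev u \<otimes> ev v" if u: "u \<in> words" and v: "v \<in> words"
  using u
proof (induction u)
  case Nil then show ?case using ev_closed[OF v] by simp
next
  case (Cons l u)
  then have l: "fst l \<in> I" and u: "ev u \<in> carrier W" using ev_closed[of u] by auto
  then show ?case using ev_closed[OF v] Cons.IH by (simp add: m_assoc)
qed

lemma ev_surj: "w \<in> carrier W \<Longrightarrow> \<exists>u\<in>words. ev u = w"
  using coxeter unfolding coxeter_system_def presented_by_def by (metis imageE)

section \<open>Parity of right inversions\<close>

text \<open>A letter \<open>l\<close> followed by the suffix \<open>v\<close> contributes the reflection \<open>v\<^sup>-\<^sup>1 s\<^sub>l v\<close>; the function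
  records, for each \<open>t\<close>, whether \<open>t\<close> is contributed an odd number of times.  Only the parity, not
  the number, is an invariant of the element that the word represents.\<close>

primrec word_inversion :: "('i \<times> bool) list \<Rightarrow> 'w \<Rightarrow> bool" where
  "word_inversion [] t = False"
| "word_inversion (l # u) t = ((s (fst l) \<otimes> ev u = ev u \<otimes> t) \<noteq> word_inversion u t)"

text \<open>The condition that a letter contributes \<open>t\<close> in front of the suffix \<open>y\<close> turns into a condition on
  the conjugate of \<open>t\<close> when \<open>y\<close> is cut off.\<close>

lemma conj_eq_iff:
  assumes "a \<in> carrier W" "b \<in> carrier W" "y \<in> carrier W" "t \<in> carrier W"
  shows "a \<otimes> y = b \<otimes> y \<otimes> t \<longleftrightarrow> a = b \<otimes> (y \<otimes> t \<otimes> inv y)"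
proof -
  have "b \<otimes> (y \<otimes> t \<otimes> inv y) \<otimes> y = b \<otimes> y \<otimes> t"
    using assms by (simp add: m_assoc)
  then show ?thesis using assms by (metis m_closed inv_closed right_cancel)
qed

text \<open>The cocycle identity: the letters of \<open>u\<close> contribute what they contribute in \<open>u\<close> alone, conjugated
  by the element that \<open>v\<close> represents.\<close>

lemma word_inversion_append:
  assumes "u \<in> words" "v \<in> words" "t \<in> carrier W"
  shows "word_inversion (u @ v) t \<longleftrightarrow> word_inversion u (ev v \<otimes> t \<otimes> inv (ev v)) \<noteq> word_inversion v t"
  using assms(1)
proof (induction u)
  case Nil then show ?case by simp
next
  case (Cons l u)
  then have l: "fst l \<in> I" and u: "u \<in> words" by auto
  have "s (fst l) \<otimes> ev (u @ v) = ev (u @ v) \<otimes> t \<longleftrightarrow>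
        (s (fst l) \<otimes> ev u) \<otimes> ev v = ev u \<otimes> ev v \<otimes> t"
    using l u assms by (simp add: m_assoc)
  also have "\<dots> \<longleftrightarrow> s (fst l) \<otimes> ev u = ev u \<otimes> (ev v \<otimes> t \<otimes> inv (ev v))"
    using l u assms by (intro conj_eq_iff) auto
  finally show ?case using Cons.IH by auto
qed

text \<open>The generator \<open>s j\<close> inverts \<open>s i \<otimes> s j\<close> by conjugation, hence also its powers.\<close>

lemma pow_conj: 
  assumes i: "i \<in> I" "j \<in> I"
  shows "(s i \<otimes> s j) [^] (n::nat) \<otimes> s j \<otimes> (s i \<otimes> s j) [^] n = s j"
proof (induction n)
  case 0 then show ?case using i by simp
next
  case (Suc n)
  let ?p = "s i \<otimes> s j"
  have p: "?p \<in> carrier W" using i by simp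
  have "?p [^] Suc n \<otimes> s j \<otimes> ?p [^] Suc n = ?p [^] n \<otimes> ?p \<otimes> s j \<otimes> (?p \<otimes> ?p [^] n)"
    unfolding nat_pow_Suc2[OF p, of n, symmetric] by simp
  also have "\<dots> = ?p [^] n \<otimes> (?p \<otimes> s j \<otimes> ?p) \<otimes> ?p [^] n"
    using i p nat_pow_closed[OF p, of n] by (simp only: m_assoc m_closed s_closed)
  also have "?p \<otimes> s j \<otimes> ?p = s j" using i by (simp add: m_assoc)
  finally show ?case using Suc by simp
qed

lemma ev_alternating:
  assumes i: "i \<in> I" "j \<in> I"
  shows "concat (replicate n [(i, True), (j, True)]) \<in> words"
    and "ev (concat (replicate n [(i, True), (j, True)])) = (s i \<otimes> s j) [^] n"
proof (induction n)
  case (Suc n)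
  { case 1 then show ?case using Suc i by auto }
  { case 2 show ?case using Suc i nat_pow_Suc2[of "s i \<otimes> s j" n] by (simp add: m_assoc del: nat_pow_Suc) }
qed auto

text \<open>Since \<open>s j\<close> inverts \<open>p = s i \<otimes> s j\<close>, the reflections contributed by the successive letters of an
  alternating word, read from the right, are \<open>s j\<close>, \<open>s j \<otimes> p\<close>, \<open>s j \<otimes> p\<^sup>2\<close> and so on.\<close>

lemma word_inversion_alternating:
  assumes i: "i \<in> I" "j \<in> I" and t: "t \<in> carrier W"
  shows "word_inversion (concat (replicate n [(i, True), (j, True)])) t \<longleftrightarrow>
    odd (\<Sum>r<2*n. if t = s j \<otimes> (s i \<otimes> s j) [^] r then 1 else (0::nat))"
proof (induction n)
  case 0 then show ?case by simp
next
  case (Suc n)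
  let ?p = "s i \<otimes> s j"
  let ?c = "concat (replicate n [(i, True), (j, True)])"
  have p: "?p \<in> carrier W" using i by simp
  have q: "?p [^] n \<in> carrier W" using p by simp
  have c: "?p [^] n \<otimes> (s j \<otimes> (?p [^] n \<otimes> x)) = s j \<otimes> x" if "x \<in> carrier W" for x
    using pow_conj[OF i, of n] that i q by (metis m_assoc m_closed s_closed)
  have "s j \<otimes> ?p [^] n = ?p [^] n \<otimes> t \<longleftrightarrow> ?p [^] n \<otimes> (s j \<otimes> (?p [^] n \<otimes> ?p [^] n)) = ?p [^] n \<otimes> t"
    using c q by simp
  also have "\<dots> \<longleftrightarrow> t = s j \<otimes> (?p [^] n \<otimes> ?p [^] n)"
    using q i t by auto
  also have "?p [^] n \<otimes> ?p [^] n = ?p [^] (2 * n)"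
    using p by (simp add: nat_pow_mult mult_2)
  finally have 1: "s j \<otimes> ?p [^] n = ?p [^] n \<otimes> t \<longleftrightarrow> t = s j \<otimes> ?p [^] (2 * n)" .
  have e: "s j \<otimes> ?p [^] n \<otimes> (s j \<otimes> (?p [^] n \<otimes> (?p [^] n \<otimes> ?p))) = s i \<otimes> (s j \<otimes> ?p [^] n)"
  proof -
    have "s j \<otimes> ?p [^] n \<otimes> (s j \<otimes> (?p [^] n \<otimes> (?p [^] n \<otimes> ?p))) = s j \<otimes> (s j \<otimes> (?p [^] n \<otimes> ?p))"
      using c[of "?p [^] n \<otimes> ?p"] i q p by (simp add: m_assoc)
    also have "\<dots> = ?p [^] n \<otimes> ?p" using i q p by simp
    also have "\<dots> = ?p \<otimes> ?p [^] n" using p by (metis nat_pow_Suc nat_pow_Suc2)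
    finally show ?thesis using i q by (simp add: m_assoc)
  qed
  have "s i \<otimes> (s j \<otimes> ?p [^] n) = s j \<otimes> ?p [^] n \<otimes> t \<longleftrightarrow> t = s j \<otimes> (?p [^] n \<otimes> (?p [^] n \<otimes> ?p))"
    unfolding e[symmetric] using q i t p by auto
  also have "?p [^] n \<otimes> (?p [^] n \<otimes> ?p) = ?p [^] Suc (2 * n)"
    using p q by (simp add: nat_pow_mult mult_2 m_assoc[symmetric])
  finally have 2: "s i \<otimes> (s j \<otimes> ?p [^] n) = s j \<otimes> ?p [^] n \<otimes> t \<longleftrightarrow> t = s j \<otimes> ?p [^] Suc (2 * n)" .
  have "word_inversion (concat (replicate (Suc n) [(i, True), (j, True)])) t \<longleftrightarrow>
      (s i \<otimes> (s j \<otimes> ?p [^] n) = s j \<otimes> ?p [^] n \<otimes> t) \<noteq>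
      ((s j \<otimes> ?p [^] n = ?p [^] n \<otimes> t) \<noteq> word_inversion ?c t)"
    using i ev_alternating[OF i] by simp
  then show ?case using 1 2 Suc by auto
qed

text \<open>In a Coxeter relator of length \<open>2 m\<close> the reflections \<open>s j \<otimes> p\<^sup>r\<close> repeat with period \<open>m\<close>, because
  \<open>p\<close> has trivial \<open>m\<close>-th power; each reflection is thus contributed an even number of times.\<close>

lemma word_inversion_relator:
  assumes r: "r \<in> coxeter_relators I m" and t: "t \<in> carrier W"
  shows "r \<in> words" "ev r = \<one>" "\<not> word_inversion r t"
proof -
  from r obtain i j where i: "i \<in> I" "j \<in> I" and
    req: "r = concat (replicate (m i j) [(i, True), (j, True)])"
    unfolding coxeter_relators_def by blast
  show w: "r \<in> words" using ev_alternating(1)[OF i] req by simp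
  have "word_equiv I (coxeter_relators I m) r []"
    using word_equiv.relator[OF r, of I "[]" "[]"] by simp
  then show e: "ev r = \<one>" using ev_eq_iff[OF w, of "[]"] by simp
  let ?p = "s i \<otimes> s j" and ?n = "m i j"
  let ?g = "\<lambda>r. if t = s j \<otimes> ?p [^] r then 1 else (0::nat)"
  have p1: "?p [^] ?n = \<one>" using e ev_alternating(2)[OF i] req by simp
  \<comment> \<open>the sum runs over two periods; for \<open>m i j = 0\<close> the relator is empty and so is the sum\<close>
  have per: "?g (r + ?n) = ?g r" for r
    using p1 i by (simp add: nat_pow_mult[symmetric])
  have split: "(\<Sum>r<a + b. g r) = (\<Sum>r<a. g r) + (\<Sum>r<b. g (r + a))" for a b and g :: "nat \<Rightarrow> nat"
    by (induction b) (auto simp: add.commute)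
  have "(\<Sum>r<2 * ?n. ?g r) = 2 * (\<Sum>r<?n. ?g r)"
    unfolding mult_2 split per ..
  then show "\<not> word_inversion r t"
    unfolding req word_inversion_alternating[OF i t] by (metis dvd_triv_left)
qed

text \<open>Inserting a trivial word whose own parities all vanish does not change parities, by the cocycle
  identity.  A cancelling pair of letters contributes the same reflection twice, and relators were
  treated above.\<close>

lemma word_inversion_word_equiv:
  assumes "word_equiv I (coxeter_relators I m) u v"
  shows "(u \<in> words \<longleftrightarrow> v \<in> words) \<and> (u \<in> words \<longrightarrow> (\<forall>t\<in>carrier W. word_inversion u t = word_inversion v t))"
  using assms
proof (induction rule: word_equiv.induct)
  case (cancel i u b v)
  let ?c = "[(i, b), (i, \<not> b)]"
  have c: "?c \<in> words" "ev ?c = \<one>" using cancel by auto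
  have "word_inversion (u @ ?c @ v) t = word_inversion (u @ v) t"
    if u: "u \<in> words" and v: "v \<in> words" and t: "t \<in> carrier W" for t
  proof -
    have "\<not> word_inversion ?c t'" if "t' \<in> carrier W" for t'
    proof -
      have "\<one> = s i \<otimes> t' \<longleftrightarrow> s i = t'"
        using Units_l_cancel[of "s i" "s i" t'] that cancel by (simp add: Units_eq)
      then show ?thesis using that cancel by auto
    qed
    moreover have "ev v \<otimes> t \<otimes> inv ev v \<in> carrier W" using v t by simp
    ultimately show ?thesis
      using u v t c by (simp add: word_inversion_append del: word_inversion.simps append_Cons append_Nil)
  qed
  then show ?case using cancel by (auto simp del: word_inversion.simps append_Cons append_Nil)
next
  case (relator r u v)
  have r: "r \<in> words" "ev r = \<one>" "\<And>t. t \<in> carrier W \<Longrightarrow> \<not> word_inversion r t"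
    using word_inversion_relator[OF relator] one_closed by blast+
  have "word_inversion (u @ r @ v) t = word_inversion (u @ v) t"
    if u: "u \<in> words" and v: "v \<in> words" and t: "t \<in> carrier W" for t
    using u v t r by (simp add: word_inversion_append)
  then show ?case using r by auto
qed auto

definition inversion :: "'w \<Rightarrow> 'w \<Rightarrow> bool" where
  "inversion w t = word_inversion (SOME u. u \<in> words \<and> ev u = w) t"

lemma inversion_ev: "inversion (ev u) t = word_inversion u t" if u: "u \<in> words" and t: "t \<in> carrier W"
proof -
  let ?v = "SOME v. v \<in> words \<and> ev v = ev u"
  have v: "?v \<in> words \<and> ev ?v = ev u"
    by (rule someI[of "\<lambda>v. v \<in> words \<and> ev v = ev u" u]) (use u in blast)
  then have "word_equiv I (coxeter_relators I m) ?v u"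
    using ev_eq_iff[of ?v u] u by blast
  from word_inversion_word_equiv[OF this] v t have "word_inversion ?v t = word_inversion u t" by blast
  then show ?thesis unfolding inversion_def .
qed

lemma inversion_mult:
  assumes "x \<in> carrier W" "y \<in> carrier W" "t \<in> carrier W"
  shows "inversion (x \<otimes> y) t \<longleftrightarrow> inversion x (y \<otimes> t \<otimes> inv y) \<noteq> inversion y t"
proof -
  obtain u v where u: "u \<in> words" "ev u = x" and v: "v \<in> words" "ev v = y"
    using assms(1,2) ev_surj by blast
  have "inversion (ev (u @ v)) t = word_inversion (u @ v) t" using u v assms by (intro inversion_ev) auto
  moreover have "inversion x (y \<otimes> t \<otimes> inv y) = word_inversion u (y \<otimes> t \<otimes> inv y)" "inversion y t = word_inversion v t"
    using inversion_ev[of u "y \<otimes> t \<otimes> inv y"] inversion_ev[of v t] u v assms by simp_all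
  moreover have "ev (u @ v) = x \<otimes> y" using u v by simp
  ultimately show ?thesis
    using word_inversion_append[OF u(1) v(1) assms(3)] v(2) by simp
qed

lemma inversion_one [simp]: "t \<in> carrier W \<Longrightarrow> \<not> inversion \<one> t"
  by (metis inversion_ev ev_Nil word_inversion.simps(1) lists.Nil)

lemma inversion_s [simp]: "i \<in> I \<Longrightarrow> t \<in> carrier W \<Longrightarrow> inversion (s i) t \<longleftrightarrow> t = s i"
proof -
  assume a: "i \<in> I" "t \<in> carrier W"
  have "inversion (ev [(i, True)]) t = word_inversion [(i, True)] t" by (rule inversion_ev) (use a in auto)
  moreover have "ev [(i, True)] = s i" using a by simp
  moreover have "word_inversion [(i, True)] t \<longleftrightarrow> s i = t" using a by simp
  ultimately show ?thesis by metis
qed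

text \<open>Left multiplication by a generator affects the single reflection \<open>x\<^sup>-\<^sup>1 s\<^sub>i x\<close>.\<close>

lemma inversion_s_mult:
  assumes "i \<in> I" "x \<in> carrier W" "t \<in> carrier W"
  shows "inversion (s i \<otimes> x) t \<longleftrightarrow> (s i \<otimes> x = x \<otimes> t) \<noteq> inversion x t"
proof -
  obtain u where u: "u \<in> words" "ev u = x" using assms(2) ev_surj by blast
  have "inversion (ev ((i, True) # u)) t = word_inversion ((i, True) # u) t" by (rule inversion_ev) (use u assms in auto)
  moreover have "inversion (ev u) t = word_inversion u t" by (rule inversion_ev) (use u assms in auto)
  moreover have "ev ((i, True) # u) = s i \<otimes> x" using u assms by simp
  ultimately show ?thesis using u by simp
qed

end

section \<open>Length and reflections\<close>

context coxeter_group begin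

abbreviation prod_word :: "'i list \<Rightarrow> 'w" where
  "prod_word u \<equiv> foldr (\<lambda>i x. s i \<otimes> x) u \<one>"

lemma prod_word_eq_ev: "u \<in> lists I \<Longrightarrow> prod_word u = ev (map (\<lambda>i. (i, True)) u)"
  by (induction u) auto

lemma ev_eq_prod_word: "u \<in> words \<Longrightarrow> ev u = prod_word (map fst u)"
  by (induction u) auto

lemma map_fst_words: "u \<in> words \<Longrightarrow> map fst u \<in> lists I"
  by (induction u) auto

lemma prod_word_closed: "u \<in> lists I \<Longrightarrow> prod_word u \<in> carrier W"
  by (induction u) auto

lemma prod_word_snoc: "i \<in> I \<Longrightarrow> u \<in> lists I \<Longrightarrow> prod_word (u @ [i]) = prod_word u \<otimes> s i"
proof (induction u)
  case (Cons j u)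
  then have "j \<in> I" "prod_word u \<in> carrier W" using prod_word_closed by auto
  then show ?case using Cons by (simp add: m_assoc)
qed simp

lemma len_prod_word_le: "u \<in> lists I \<Longrightarrow> len (prod_word u) \<le> length u"
  unfolding coxeter_length_def by (rule Least_le) blast

lemma reduced_word:
  assumes "w \<in> carrier W"
  obtains u where "u \<in> lists I" "length u = len w" "prod_word u = w"
proof -
  obtain v where v: "v \<in> words" "ev v = w" using ev_surj assms by blast
  then have "map fst v \<in> lists I" "prod_word (map fst v) = w"
    using ev_eq_prod_word map_fst_words by simp_all
  then have "\<exists>n. \<exists>u\<in>lists I. length u = n \<and> prod_word u = w" by blast
  then have "\<exists>u\<in>lists I. length u = len w \<and> prod_word u = w"
    unfolding coxeter_length_def by (rule LeastI_ex)
  then show ?thesis using that by blast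
qed

lemma len_one [simp]: "len \<one> = 0"
  using len_prod_word_le[of "[]"] by simp

lemma len_left_le: "i \<in> I \<Longrightarrow> x \<in> carrier W \<Longrightarrow> len (s i \<otimes> x) \<le> Suc (len x)"
proof -
  assume i: "i \<in> I" and x: "x \<in> carrier W"
  obtain u where u: "u \<in> lists I" "length u = len x" "prod_word u = x" using reduced_word[OF x] .
  then show ?thesis using len_prod_word_le[of "i # u"] i by simp
qed

lemma len_right_le: "i \<in> I \<Longrightarrow> x \<in> carrier W \<Longrightarrow> len (x \<otimes> s i) \<le> Suc (len x)"
proof -
  assume i: "i \<in> I" and x: "x \<in> carrier W"
  obtain u where u: "u \<in> lists I" "length u = len x" "prod_word u = x" using reduced_word[OF x] .
  then show ?thesis using len_prod_word_le[of "u @ [i]"] i prod_word_snoc[OF i u(1)] by simp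
qed

lemma left_split:
  assumes x: "x \<in> carrier W" "x \<noteq> \<one>"
  obtains j y where "j \<in> I" "y \<in> carrier W" "x = s j \<otimes> y" "len x = Suc (len y)"
proof -
  obtain u where u: "u \<in> lists I" "length u = len x" "prod_word u = x" using reduced_word[OF x(1)] .
  then obtain j v where uv: "u = j # v" using x(2) by (cases u) auto
  have j: "j \<in> I" "v \<in> lists I" using u uv by auto
  have "x = s j \<otimes> prod_word v" using u uv by simp
  moreover have "len x = Suc (len (prod_word v))"
    using len_prod_word_le[OF j(2)] len_left_le[OF j(1) prod_word_closed[OF j(2)]] u(2) calculation uv by simp
  ultimately show ?thesis using that[OF j(1) prod_word_closed[OF j(2)]] by blast
qed

lemma right_split:
  assumes x: "x \<in> carrier W" "x \<noteq> \<one>"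
  obtains j y where "j \<in> I" "y \<in> carrier W" "x = y \<otimes> s j" "len x = Suc (len y)"
proof -
  obtain u where u: "u \<in> lists I" "length u = len x" "prod_word u = x" using reduced_word[OF x(1)] .
  then obtain j v where uv: "u = v @ [j]" using x(2) by (cases u rule: rev_cases) auto
  have j: "j \<in> I" "v \<in> lists I" using u uv by auto
  have "x = prod_word v \<otimes> s j" using u(3) uv prod_word_snoc[OF j] by simp
  moreover have "len x = Suc (len (prod_word v))"
    using len_prod_word_le[OF j(2)] len_right_le[OF j(1) prod_word_closed[OF j(2)]] u(2) calculation uv by simp
  ultimately show ?thesis using that[OF j(1) prod_word_closed[OF j(2)]] by blast
qed

text \<open>Strong exchange: if a suffix \<open>v\<close> and the letter \<open>l\<close> before it satisfy \<open>s\<^sub>l v = v t\<close>, then deleting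
  this letter multiplies the word by \<open>t\<close> on the right.\<close>

lemma word_inversion_delete:
  assumes "u \<in> words" "t \<in> carrier W" "word_inversion u t"
  shows "\<exists>v\<in>words. length v < length u \<and> ev v = ev u \<otimes> t"
  using assms(1,3)
proof (induction u)
  case Nil then show ?case by simp
next
  case (Cons l u)
  then have l: "fst l \<in> I" and u: "u \<in> words" and eu: "ev u \<in> carrier W" using ev_closed[of u] by auto
  show ?case
  proof (cases "word_inversion u t")
    case True
    then obtain v where v: "v \<in> words" "length v < length u" "ev v = ev u \<otimes> t" using Cons.IH by blast
    have "l # v \<in> words" using Cons.hyps v(1) by simp
    moreover have "ev (l # v) = ev (l # u) \<otimes> t" using l eu v(3) assms(2) by (simp add: m_assoc)
    ultimately show ?thesis using v(2) by (metis length_Cons Suc_less_eq)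
  next
    case False
    then have e: "s (fst l) \<otimes> ev u = ev u \<otimes> t" using Cons.prems by simp
    have "ev (l # u) \<otimes> t = s (fst l) \<otimes> (ev u \<otimes> t)" using l eu assms(2) by (simp add: m_assoc)
    also have "\<dots> = ev u" unfolding e[symmetric] using l eu by simp
    finally show ?thesis using u by (metis length_Cons lessI)
  qed
qed

lemma inversion_len_less:
  assumes "x \<in> carrier W" "t \<in> carrier W" "inversion x t"
  shows "len (x \<otimes> t) < len x"
proof -
  obtain u where u: "u \<in> lists I" "length u = len x" "prod_word u = x" using reduced_word[OF assms(1)] .
  let ?u = "map (\<lambda>i. (i, True)) u"
  have w: "?u \<in> words" using u(1) by auto
  have e: "ev ?u = x" using prod_word_eq_ev u by simp
  have "word_inversion ?u t" using inversion_ev[OF w assms(2)] e assms(3) by simp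
  then obtain v where v: "v \<in> words" "length v < length ?u" "ev v = x \<otimes> t"
    using word_inversion_delete[OF w assms(2)] e by auto
  from len_prod_word_le[OF map_fst_words[OF v(1)]] show ?thesis
    using v u(2) ev_eq_prod_word[OF v(1)] by simp
qed

definition reflections :: "'w set" where
  "reflections = {x \<otimes> s i \<otimes> inv x | x i. x \<in> carrier W \<and> i \<in> I}"

lemma reflection_closed [simp]: "t \<in> reflections \<Longrightarrow> t \<in> carrier W"
  unfolding reflections_def by auto

lemma conj_reflection:
  assumes "t \<in> reflections" "y \<in> carrier W"
  shows "y \<otimes> t \<otimes> inv y \<in> reflections"
proof -
  obtain x i where x: "x \<in> carrier W" "i \<in> I" "t = x \<otimes> s i \<otimes> inv x"
    using assms(1) unfolding reflections_def by blast
  have "y \<otimes> t \<otimes> inv y = (y \<otimes> x) \<otimes> s i \<otimes> inv (y \<otimes> x)"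
    using x assms(2) by (simp add: m_assoc inv_mult_group)
  then show ?thesis using x assms(2) unfolding reflections_def by blast
qed

lemma s_reflection [simp]: "i \<in> I \<Longrightarrow> s i \<in> reflections"
proof -
  assume "i \<in> I"
  then have "s i = \<one> \<otimes> s i \<otimes> inv \<one>" by simp
  then show ?thesis unfolding reflections_def using \<open>i \<in> I\<close> by blast
qed

lemma reflection_square [simp]:
  assumes "t \<in> reflections" shows "t \<otimes> t = \<one>"
proof -
  obtain x i where x: "x \<in> carrier W" "i \<in> I" "t = x \<otimes> s i \<otimes> inv x"
    using assms(1) unfolding reflections_def by blast
  have "inv x \<otimes> (x \<otimes> y) = y" if "y \<in> carrier W" for y
    using x(1) that by (simp add: m_assoc[symmetric])
  then show ?thesis using x by (simp add: m_assoc)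
qed

lemma inv_reflection [simp]: "t \<in> reflections \<Longrightarrow> inv t = t"
  by (rule inv_equality) auto

text \<open>Write \<open>t = x s\<^sub>i x\<^sup>-\<^sup>1\<close>.  By the cocycle identity for \<open>x x\<^sup>-\<^sup>1 = 1\<close> the contributions of the two outer
  factors cancel, and the middle letter contributes \<open>t\<close> once.\<close>

lemma inversion_self:
  assumes "t \<in> reflections" shows "inversion t t"
proof -
  obtain x i where x: "x \<in> carrier W" "i \<in> I" "t = x \<otimes> s i \<otimes> inv x"
    using assms(1) unfolding reflections_def by blast
  have t: "t \<in> carrier W" using assms by simp
  have c: "inv x \<otimes> (x \<otimes> y) = y" if "y \<in> carrier W" for y
    using x(1) that by (simp add: m_assoc[symmetric])
  have 1: "inv x \<otimes> t \<otimes> inv (inv x) = s i" using x c by (simp add: m_assoc)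
  have 2: "(s i \<otimes> inv x) \<otimes> t \<otimes> inv (s i \<otimes> inv x) = s i"
    using x c by (simp add: m_assoc inv_mult_group)
  have "t = x \<otimes> (s i \<otimes> inv x)" using x by (simp add: m_assoc)
  then have "inversion t t \<longleftrightarrow> inversion (x \<otimes> (s i \<otimes> inv x)) t" by simp
  also have "\<dots> \<longleftrightarrow> inversion x (s i) \<noteq> inversion (s i \<otimes> inv x) t"
    using inversion_mult[of x "s i \<otimes> inv x" t] x(1,2) t 2 by simp
  also have "inversion (s i \<otimes> inv x) t \<longleftrightarrow> \<not> inversion (inv x) t"
    using inversion_mult[of "s i" "inv x" t] x(1,2) t 1 by simp
  also have "inversion x (s i) \<longleftrightarrow> inversion (inv x) t"
    using inversion_mult[of x "inv x" t] x(1,2) t 1 by simp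
  finally show ?thesis by simp
qed

text \<open>If \<open>t\<close> has even parity for \<open>x\<close>, it has odd parity for \<open>x \<otimes> t\<close>, and the deletion argument applies
  to \<open>x \<otimes> t\<close>.\<close>

lemma not_inversion_len_less:
  assumes "x \<in> carrier W" "t \<in> reflections" "\<not> inversion x t"
  shows "len x < len (x \<otimes> t)"
proof -
  have "inversion (x \<otimes> t) t"
    using inversion_mult[of x t t] assms inversion_self[OF assms(2)] by (simp add: m_assoc)
  then have "len (x \<otimes> t \<otimes> t) < len (x \<otimes> t)"
    using assms by (intro inversion_len_less) auto
  then show ?thesis using assms by (simp add: m_assoc)
qed

lemma inversion_iff: "x \<in> carrier W \<Longrightarrow> t \<in> reflections \<Longrightarrow> inversion x t \<longleftrightarrow> len (x \<otimes> t) < len x"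
  using inversion_len_less[of x t] not_inversion_len_less[of x t] reflection_closed[of t] by fastforce

lemma right_descents_iff: "x \<in> carrier W \<Longrightarrow> i \<in> right_descents W I s x \<longleftrightarrow> i \<in> I \<and> inversion x (s i)"
  unfolding right_descents_def using inversion_iff by auto

section \<open>The Bruhat order\<close>

definition bruhat_edge :: "'w \<Rightarrow> 'w \<Rightarrow> bool" where
  "bruhat_edge x y \<longleftrightarrow> x \<in> carrier W \<and> (\<exists>t\<in>reflections. y = x \<otimes> t \<and> \<not> inversion x t)"

abbreviation bruhat :: "'w \<Rightarrow> 'w \<Rightarrow> bool" where "bruhat \<equiv> bruhat_edge\<^sup>*\<^sup>*"

lemma bruhat_edge_closed: "bruhat_edge x y \<Longrightarrow> x \<in> carrier W" "bruhat_edge x y \<Longrightarrow> y \<in> carrier W"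
  unfolding bruhat_edge_def by auto

lemma bruhat_edge_len: "bruhat_edge x y \<Longrightarrow> len x < len y"
  unfolding bruhat_edge_def using not_inversion_len_less by blast

lemma bruhat_len: "bruhat x y \<Longrightarrow> x = y \<or> len x < len y"
  by (induction rule: rtranclp_induct) (auto dest: bruhat_edge_len)

lemma bruhat_antisym: "bruhat x y \<Longrightarrow> bruhat y x \<Longrightarrow> x = y"
  using bruhat_len[of x y] bruhat_len[of y x] by auto

lemma bruhat_edge_total: 
  assumes "x \<in> carrier W" "t \<in> reflections"
  shows "bruhat_edge x (x \<otimes> t) \<or> bruhat_edge (x \<otimes> t) x"
proof (cases "inversion x t")
  case True
  then have "\<not> inversion (x \<otimes> t) t"
    using inversion_mult[of x t t] assms inversion_self[OF assms(2)] by (simp add: m_assoc)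
  then show ?thesis using assms unfolding bruhat_edge_def by (auto simp: m_assoc intro!: bexI[of _ t])
next
  case False
  then show ?thesis using assms unfolding bruhat_edge_def by blast
qed

lemma bruhat_edge_right_total:
  "x \<in> carrier W \<Longrightarrow> i \<in> I \<Longrightarrow> bruhat_edge x (x \<otimes> s i) \<or> bruhat_edge (x \<otimes> s i) x"
  by (rule bruhat_edge_total) auto

lemma bruhat_edge_left_total:
  assumes "x \<in> carrier W" "i \<in> I"
  shows "bruhat_edge x (s i \<otimes> x) \<or> bruhat_edge (s i \<otimes> x) x"
proof -
  have "inv x \<otimes> s i \<otimes> x \<in> reflections"
    using conj_reflection[of "s i" "inv x"] assms by simp
  moreover have "x \<otimes> (inv x \<otimes> s i \<otimes> x) = s i \<otimes> x"
    using assms by (simp add: m_assoc[symmetric])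
  ultimately show ?thesis using bruhat_edge_total[OF assms(1)] by metis
qed

text \<open>The inversions of \<open>x \<otimes> s i\<close> are those of \<open>x\<close> conjugated by \<open>s i\<close>, except at \<open>s i\<close> itself.  So an edge
  labelled by \<open>t\<close> with \<open>t \<noteq> s i\<close> keeps its direction.\<close>

lemma bruhat_edge_right:
  assumes e: "bruhat_edge x y" and i: "i \<in> I"
  shows "y = x \<otimes> s i \<or> bruhat_edge (x \<otimes> s i) (y \<otimes> s i)"
proof -
  obtain t where t: "t \<in> reflections" "y = x \<otimes> t" "\<not> inversion x t" and x: "x \<in> carrier W"
    using e unfolding bruhat_edge_def by blast
  let ?t = "s i \<otimes> t \<otimes> inv (s i)"
  have c: "s i \<otimes> ?t \<otimes> inv (s i) = t" using t i by (simp add: m_assoc)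
  have t': "?t \<in> reflections" using conj_reflection[of t "s i"] t(1) i by simp
  have y: "y \<otimes> s i = x \<otimes> s i \<otimes> ?t" using t x i by (simp add: m_assoc)
  show ?thesis
  proof (cases "t = s i")
    case False
    have "?t = s i \<longleftrightarrow> t = s i" using c i by (metis inv_s m_assoc r_one s_closed s_square)
    then have "\<not> inversion (x \<otimes> s i) ?t"
      using inversion_mult[of x "s i" ?t] c x i t t' False by simp
    then show ?thesis using y t' x i unfolding bruhat_edge_def by auto
  qed (use t in simp)
qed

text \<open>Left multiplication by \<open>s i\<close> keeps the label \<open>t\<close> of the edge, and the parity of \<open>t\<close> changes only if
  \<open>s i \<otimes> x = x \<otimes> t\<close>.\<close>

lemma bruhat_edge_left:
  assumes e: "bruhat_edge x y" and i: "i \<in> I"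
  shows "y = s i \<otimes> x \<or> bruhat_edge (s i \<otimes> x) (s i \<otimes> y)"
proof -
  obtain t where t: "t \<in> reflections" "y = x \<otimes> t" "\<not> inversion x t" and x: "x \<in> carrier W"
    using e unfolding bruhat_edge_def by blast
  show ?thesis
  proof (cases "s i \<otimes> x = x \<otimes> t")
    case False
    then have "\<not> inversion (s i \<otimes> x) t" using inversion_s_mult[OF i x, of t] t by simp
    then show ?thesis using t x i unfolding bruhat_edge_def by (auto simp: m_assoc)
  qed (use t in simp)
qed

text \<open>Here \<open>\<phi>\<close> stands for left or right multiplication by a generator, so that \<open>x\<close> and \<open>\<phi> x\<close> are always
  joined by an edge; the upper and the lower end of this edge are selected.  Both sides are covered
  by the same argument.\<close>

definition raise_by :: "('w \<Rightarrow> 'w) \<Rightarrow> 'w \<Rightarrow> 'w" where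
  "raise_by \<phi> x = (if bruhat_edge x (\<phi> x) then \<phi> x else x)"
definition lower_by :: "('w \<Rightarrow> 'w) \<Rightarrow> 'w \<Rightarrow> 'w" where
  "lower_by \<phi> x = (if bruhat_edge x (\<phi> x) then x else \<phi> x)"

text \<open>An edge from \<open>x\<close> to \<open>y\<close> is the edge joining \<open>x\<close> and \<open>\<phi> x\<close>, which is contracted, or it is one side of
  a square with opposite side from \<open>\<phi> x\<close> to \<open>\<phi> y\<close>.  Whatever the directions of the other two sides,
  the required comparison is a path in this square.\<close>

lemma bruhat_raise_lower:
  assumes inv: "\<And>x. x \<in> carrier W \<Longrightarrow> \<phi> (\<phi> x) = x"
    and tot: "\<And>x. x \<in> carrier W \<Longrightarrow> bruhat_edge x (\<phi> x) \<or> bruhat_edge (\<phi> x) x"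
    and lift: "\<And>x y. bruhat_edge x y \<Longrightarrow> y = \<phi> x \<or> bruhat_edge (\<phi> x) (\<phi> y)"
    and xy: "bruhat x y"
  shows "bruhat (raise_by \<phi> x) (raise_by \<phi> y)" "bruhat (lower_by \<phi> x) (lower_by \<phi> y)"
proof -
  have asym: "\<not> bruhat_edge y x" if "bruhat_edge x y" for x y
    using bruhat_edge_len[OF that] bruhat_edge_len[of y x] by auto
  have *: "bruhat (raise_by \<phi> x) (raise_by \<phi> y) \<and> bruhat (lower_by \<phi> x) (lower_by \<phi> y)"
    if e: "bruhat_edge x y" for x y
  proof (cases "y = \<phi> x")
    case True
    then have "\<phi> y = x" using inv e bruhat_edge_closed by blast
    then show ?thesis using True e asym[OF e] unfolding raise_by_def lower_by_def by simp
  next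
    case False
    then have l: "bruhat_edge (\<phi> x) (\<phi> y)" using lift e by blast
    have tx: "bruhat_edge x (\<phi> x) \<or> bruhat_edge (\<phi> x) x" and
      ty: "bruhat_edge y (\<phi> y) \<or> bruhat_edge (\<phi> y) y"
      using tot e bruhat_edge_closed by blast+
    have "bruhat x y" "bruhat (\<phi> x) (\<phi> y)" using e l by auto
    moreover have "bruhat x (\<phi> y)" if "bruhat_edge x (\<phi> x) \<or> bruhat_edge y (\<phi> y)"
      using that e l by (meson converse_rtranclp_into_rtranclp r_into_rtranclp)
    moreover have "bruhat (\<phi> x) y" if "bruhat_edge (\<phi> x) x \<or> bruhat_edge (\<phi> y) y"
      using that e l by (meson converse_rtranclp_into_rtranclp r_into_rtranclp)
    ultimately show ?thesis using tx ty unfolding raise_by_def lower_by_def by auto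
  qed
  show "bruhat (raise_by \<phi> x) (raise_by \<phi> y)" "bruhat (lower_by \<phi> x) (lower_by \<phi> y)"
    using xy by (induction rule: rtranclp_induct) (auto dest: * intro: rtranclp_trans)
qed

end

section \<open>The biHecke monoid preserves Bruhat and left order\<close>

context coxeter_group begin

abbreviation up :: "'i \<Rightarrow> 'w \<Rightarrow> 'w" where "up i \<equiv> raise_by (\<lambda>x. x \<otimes> s i)"
abbreviation down :: "'i \<Rightarrow> 'w \<Rightarrow> 'w" where "down i \<equiv> lower_by (\<lambda>x. x \<otimes> s i)"
abbreviation left_up :: "'i \<Rightarrow> 'w \<Rightarrow> 'w" where "left_up i \<equiv> raise_by (\<lambda>x. s i \<otimes> x)"

lemma bruhat_edge_s_iff: "x \<in> carrier W \<Longrightarrow> i \<in> I \<Longrightarrow> bruhat_edge x (x \<otimes> s i) \<longleftrightarrow> \<not> inversion x (s i)"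
proof -
  assume x: "x \<in> carrier W" and i: "i \<in> I"
  show ?thesis
  proof
    assume "bruhat_edge x (x \<otimes> s i)"
    from bruhat_edge_len[OF this] show "\<not> inversion x (s i)" using inversion_iff[OF x s_reflection[OF i]] by simp
  qed (use x i in \<open>auto simp: bruhat_edge_def\<close>)
qed

lemma hecke_op_eq: "x \<in> carrier W \<Longrightarrow> i \<in> I \<Longrightarrow> hecke_op W I s i x = up i x"
  by (simp add: hecke_op_def raise_by_def bruhat_edge_s_iff right_descents_iff)

lemma hecke_op_bar_eq: "x \<in> carrier W \<Longrightarrow> i \<in> I \<Longrightarrow> hecke_op_bar W I s i x = down i x"
  by (simp add: hecke_op_bar_def lower_by_def bruhat_edge_s_iff right_descents_iff)

lemma bruhat_up: "i \<in> I \<Longrightarrow> bruhat x y \<Longrightarrow> bruhat (up i x) (up i y)"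
  by (rule bruhat_raise_lower) (use bruhat_edge_right_total bruhat_edge_right in auto)

lemma bruhat_down: "i \<in> I \<Longrightarrow> bruhat x y \<Longrightarrow> bruhat (down i x) (down i y)"
  by (rule bruhat_raise_lower) (use bruhat_edge_right_total bruhat_edge_right in auto)

lemma bruhat_left_up: "i \<in> I \<Longrightarrow> bruhat x y \<Longrightarrow> bruhat (left_up i x) (left_up i y)"
  by (rule bruhat_raise_lower) (use bruhat_edge_left_total bruhat_edge_left in auto)

lemma up_closed: "x \<in> carrier W \<Longrightarrow> i \<in> I \<Longrightarrow> up i x \<in> carrier W"
  by (simp add: raise_by_def)

text \<open>If \<open>i\<close> is a right descent of just one of \<open>x\<close> and \<open>s j \<otimes> x\<close>, the parity of \<open>s i\<close> changed under left
  multiplication by \<open>s j\<close>, so that \<open>s j \<otimes> x = x \<otimes> s i\<close> and both ends are sent to the same element.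
  Otherwise the operator multiplies both ends by \<open>s i\<close> or fixes both.\<close>

lemma up_down_left_edge:
  assumes e: "bruhat_edge x (s j \<otimes> x)" and i: "i \<in> I" and j: "j \<in> I"
  shows "up i (s j \<otimes> x) = up i x \<or>
      (up i (s j \<otimes> x) = s j \<otimes> up i x \<and> bruhat_edge (up i x) (up i (s j \<otimes> x)))"
    and "down i (s j \<otimes> x) = down i x \<or>
      (down i (s j \<otimes> x) = s j \<otimes> down i x \<and> bruhat_edge (down i x) (down i (s j \<otimes> x)))"
proof -
  have x: "x \<in> carrier W" using e bruhat_edge_closed by blast
  have "(up i (s j \<otimes> x) = up i x \<or>
      (up i (s j \<otimes> x) = s j \<otimes> up i x \<and> bruhat_edge (up i x) (up i (s j \<otimes> x)))) \<and>
    (down i (s j \<otimes> x) = down i x \<or>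
      (down i (s j \<otimes> x) = s j \<otimes> down i x \<and> bruhat_edge (down i x) (down i (s j \<otimes> x))))"
  proof (cases "s j \<otimes> x = x \<otimes> s i")
    case True
    have "\<not> bruhat_edge (x \<otimes> s i) x"
      using bruhat_edge_len[of "x \<otimes> s i" x] bruhat_edge_len[OF e] True by auto
    then show ?thesis using True e x i by (simp add: raise_by_def lower_by_def)
  next
    case False
    have "bruhat_edge (s j \<otimes> x) (s j \<otimes> x \<otimes> s i) \<longleftrightarrow> bruhat_edge x (x \<otimes> s i)"
      using inversion_s_mult[OF j x, of "s i"] False x i j by (simp add: bruhat_edge_s_iff)
    moreover have "bruhat_edge (x \<otimes> s i) (s j \<otimes> x \<otimes> s i)"
      using bruhat_edge_right[OF e i] False by blast
    moreover have "s j \<otimes> x \<otimes> s i = s j \<otimes> (x \<otimes> s i)" using x i j by (simp add: m_assoc)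
    ultimately show ?thesis using e by (simp add: raise_by_def lower_by_def)
  qed
  then show "up i (s j \<otimes> x) = up i x \<or>
      (up i (s j \<otimes> x) = s j \<otimes> up i x \<and> bruhat_edge (up i x) (up i (s j \<otimes> x)))"
    and "down i (s j \<otimes> x) = down i x \<or>
      (down i (s j \<otimes> x) = s j \<otimes> down i x \<and> bruhat_edge (down i x) (down i (s j \<otimes> x)))"
    by blast+
qed

abbreviation M where "M \<equiv> bihecke_monoid W I s"
abbreviation B where "B \<equiv> borel_submonoid W I s"

lemma bihecke_mult: "f \<otimes>\<^bsub>M\<^esub> g = compose (carrier W) g f"
  by (simp add: bihecke_monoid_def transformation_monoid_def)

lemma bihecke_one: "\<one>\<^bsub>M\<^esub> = (\<lambda>x\<in>carrier W. x)"
  by (simp add: bihecke_monoid_def transformation_monoid_def)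

lemma borel_mult: "f \<otimes>\<^bsub>B\<^esub> g = compose (carrier W) g f"
  by (simp add: borel_submonoid_def bihecke_mult)

lemma borel_one: "\<one>\<^bsub>B\<^esub> = (\<lambda>x\<in>carrier W. x)"
  by (simp add: borel_submonoid_def bihecke_one)

lemma borel_carrier: "carrier B = {f \<in> carrier M. f \<one> = \<one>}"
  by (simp add: borel_submonoid_def)

text \<open>The invariant that the generators of the biHecke monoid satisfy and that composition preserves.
  The last conjunct concerns the left weak order: an edge labelled by \<open>j\<close> is contracted or
  sent to an edge with the same label.\<close>

definition preserves_orders :: "('w \<Rightarrow> 'w) \<Rightarrow> bool" where
  "preserves_orders f \<longleftrightarrow> f \<in> carrier W \<rightarrow>\<^sub>E carrier W \<and>
    (\<forall>x y. x \<in> carrier W \<longrightarrow> bruhat x y \<longrightarrow> bruhat (f x) (f y)) \<and>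
    (\<forall>x. \<forall>j\<in>I. bruhat_edge x (s j \<otimes> x) \<longrightarrow>
       f (s j \<otimes> x) = f x \<or> (f (s j \<otimes> x) = s j \<otimes> f x \<and> bruhat_edge (f x) (f (s j \<otimes> x))))"

lemma bruhat_closed: "bruhat x y \<Longrightarrow> x \<in> carrier W \<Longrightarrow> y \<in> carrier W"
  by (induction rule: rtranclp_induct) (auto dest: bruhat_edge_closed)

lemma preserves_orders_hecke_op: "i \<in> I \<Longrightarrow> preserves_orders (hecke_op W I s i)"
  unfolding preserves_orders_def
proof (intro conjI allI ballI impI)
  assume i: "i \<in> I"
  show "hecke_op W I s i \<in> carrier W \<rightarrow>\<^sub>E carrier W"
    using i by (auto simp: hecke_op_def PiE_def)
next
  fix x y assume "i \<in> I" "x \<in> carrier W" "bruhat x y"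
  then show "bruhat (hecke_op W I s i x) (hecke_op W I s i y)"
    using bruhat_closed[of x y] by (simp add: hecke_op_eq bruhat_up)
next
  fix x j assume a: "i \<in> I" "j \<in> I" "bruhat_edge x (s j \<otimes> x)"
  then show "hecke_op W I s i (s j \<otimes> x) = hecke_op W I s i x \<or>
       hecke_op W I s i (s j \<otimes> x) = s j \<otimes> hecke_op W I s i x \<and>
       bruhat_edge (hecke_op W I s i x) (hecke_op W I s i (s j \<otimes> x))"
    using up_down_left_edge(1)[of x j i] bruhat_edge_closed[OF a(3)] by (simp add: hecke_op_eq)
qed

lemma preserves_orders_hecke_op_bar: "i \<in> I \<Longrightarrow> preserves_orders (hecke_op_bar W I s i)"
  unfolding preserves_orders_def
proof (intro conjI allI ballI impI)
  assume i: "i \<in> I"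
  show "hecke_op_bar W I s i \<in> carrier W \<rightarrow>\<^sub>E carrier W"
    using i by (auto simp: hecke_op_bar_def PiE_def)
next
  fix x y assume "i \<in> I" "x \<in> carrier W" "bruhat x y"
  then show "bruhat (hecke_op_bar W I s i x) (hecke_op_bar W I s i y)"
    using bruhat_closed[of x y] by (simp add: hecke_op_bar_eq bruhat_down)
next
  fix x j assume a: "i \<in> I" "j \<in> I" "bruhat_edge x (s j \<otimes> x)"
  then show "hecke_op_bar W I s i (s j \<otimes> x) = hecke_op_bar W I s i x \<or>
       hecke_op_bar W I s i (s j \<otimes> x) = s j \<otimes> hecke_op_bar W I s i x \<and>
       bruhat_edge (hecke_op_bar W I s i x) (hecke_op_bar W I s i (s j \<otimes> x))"
    using up_down_left_edge(2)[of x j i] bruhat_edge_closed[OF a(3)] by (simp add: hecke_op_bar_eq)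
qed

lemma preserves_orders_compose:
  assumes f: "preserves_orders f" and g: "preserves_orders g" shows "preserves_orders (compose (carrier W) g f)"
  unfolding preserves_orders_def
proof (intro conjI allI ballI impI)
  have fc: "f x \<in> carrier W" if "x \<in> carrier W" for x using f that unfolding preserves_orders_def by auto
  show "compose (carrier W) g f \<in> carrier W \<rightarrow>\<^sub>E carrier W"
    using f g unfolding preserves_orders_def compose_def by auto
  {
    fix x y assume a: "x \<in> carrier W" "bruhat x y"
    then have "bruhat (f x) (f y)" using f unfolding preserves_orders_def by blast
    then have "bruhat (g (f x)) (g (f y))" using g fc[OF a(1)] unfolding preserves_orders_def by blast
    then show "bruhat (compose (carrier W) g f x) (compose (carrier W) g f y)"
      using a bruhat_closed[of x y] by (simp add: compose_def)
  next
    fix x j assume a: "j \<in> I" "bruhat_edge x (s j \<otimes> x)"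
    have x: "x \<in> carrier W" "s j \<otimes> x \<in> carrier W" using bruhat_edge_closed[OF a(2)] by auto
    have "f (s j \<otimes> x) = f x \<or> (f (s j \<otimes> x) = s j \<otimes> f x \<and> bruhat_edge (f x) (s j \<otimes> f x))"
      using f a unfolding preserves_orders_def by metis
    moreover have "g (s j \<otimes> f x) = g (f x) \<or>
        (g (s j \<otimes> f x) = s j \<otimes> g (f x) \<and> bruhat_edge (g (f x)) (g (s j \<otimes> f x)))"
      if "bruhat_edge (f x) (s j \<otimes> f x)"
      using g a(1) that unfolding preserves_orders_def by blast
    ultimately show "compose (carrier W) g f (s j \<otimes> x) = compose (carrier W) g f x \<or>
         compose (carrier W) g f (s j \<otimes> x) = s j \<otimes> compose (carrier W) g f x \<and>
         bruhat_edge (compose (carrier W) g f x) (compose (carrier W) g f (s j \<otimes> x))"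
      using x by (auto simp: compose_def)
  }
qed

lemma bihecke_preserves_orders: "f \<in> carrier M \<Longrightarrow> preserves_orders f"
proof -
  assume "f \<in> carrier M"
  then have "f \<in> generated_submonoid (transformation_monoid (carrier W))
          (hecke_op W I s ` I \<union> hecke_op_bar W I s ` I)"
    by (simp add: bihecke_monoid_def)
  then show ?thesis
  proof (induction rule: generated_submonoid.induct)
    case one
    then show ?case by (auto simp: preserves_orders_def transformation_monoid_def dest: bruhat_closed bruhat_edge_closed)
  next
    case (gen f)
    then show ?case using preserves_orders_hecke_op preserves_orders_hecke_op_bar by auto
  next
    case (mult f g)
    then show ?case using preserves_orders_compose by (simp add: transformation_monoid_def)
  qed
qed

lemma bihecke_mult_closed: "f \<in> carrier M \<Longrightarrow> g \<in> carrier M \<Longrightarrow> compose (carrier W) g f \<in> carrier M"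
  using generated_submonoid.mult[of f "transformation_monoid (carrier W)" _ g]
  by (simp add: bihecke_monoid_def transformation_monoid_def)

lemma bihecke_one_closed: "(\<lambda>x\<in>carrier W. x) \<in> carrier M"
  using generated_submonoid.one[of "transformation_monoid (carrier W)"]
  by (simp add: bihecke_monoid_def transformation_monoid_def)

lemma hecke_op_closed: "i \<in> I \<Longrightarrow> hecke_op W I s i \<in> carrier M" 
  and hecke_op_bar_closed: "i \<in> I \<Longrightarrow> hecke_op_bar W I s i \<in> carrier M"
  by (auto simp: bihecke_monoid_def intro!: generated_submonoid.gen)

lemma bihecke_closed [simp]: "f \<in> carrier M \<Longrightarrow> x \<in> carrier W \<Longrightarrow> f x \<in> carrier W"
  using bihecke_preserves_orders unfolding preserves_orders_def by blast

lemma bihecke_PiE: "f \<in> carrier M \<Longrightarrow> f \<in> carrier W \<rightarrow>\<^sub>E carrier W"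
  using bihecke_preserves_orders unfolding preserves_orders_def by blast

lemma bihecke_bruhat: "f \<in> carrier M \<Longrightarrow> x \<in> carrier W \<Longrightarrow> bruhat x y \<Longrightarrow> bruhat (f x) (f y)"
  using bihecke_preserves_orders unfolding preserves_orders_def by blast

lemma bihecke_left_edge: 
  assumes "f \<in> carrier M" "j \<in> I" "bruhat_edge x (s j \<otimes> x)"
  obtains "f (s j \<otimes> x) = f x" | "f (s j \<otimes> x) = s j \<otimes> f x" "bruhat_edge (f x) (s j \<otimes> f x)"
proof -
  have "f (s j \<otimes> x) = f x \<or> (f (s j \<otimes> x) = s j \<otimes> f x \<and> bruhat_edge (f x) (f (s j \<otimes> x)))"
    using bihecke_preserves_orders[OF assms(1)] assms(2,3) unfolding preserves_orders_def by blast
  then show ?thesis using that by auto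
qed

lemma borel_bihecke: "f \<in> carrier B \<Longrightarrow> f \<in> carrier M" 
  by (simp add: borel_carrier)

lemma left_split_edge:
  assumes x: "x \<in> carrier W" "x \<noteq> \<one>"
  obtains j y where "j \<in> I" "y \<in> carrier W" "x = s j \<otimes> y" "len y < len x" "bruhat_edge y (s j \<otimes> y)"
proof -
  obtain j y where j: "j \<in> I" "y \<in> carrier W" "x = s j \<otimes> y" "len x = Suc (len y)"
    using left_split[OF x] .
  moreover have "bruhat_edge y (s j \<otimes> y)"
    using bruhat_edge_left_total[OF j(2,1)] bruhat_edge_len[of "s j \<otimes> y" y] j by auto
  ultimately show ?thesis using that by auto
qed

section \<open>The Borel submonoid is regressive\<close>

text \<open>Write \<open>x = s j \<otimes> y\<close> with \<open>y\<close> below \<open>x\<close>.  The image \<open>f x\<close> is \<open>f y\<close> or \<open>s j \<otimes> f y\<close>, and in the second case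
  raising both sides of \<open>f y \<le> y\<close> on the left gives the claim.\<close>

lemma borel_regressive: "f \<in> carrier B \<Longrightarrow> x \<in> carrier W \<Longrightarrow> bruhat (f x) x"
proof (induction "len x" arbitrary: x rule: less_induct)
  case less
  note f = borel_bihecke[OF less.prems(1)]
  show ?case
  proof (cases "x = \<one>")
    case True
    then show ?thesis using less.prems by (simp add: borel_carrier)
  next
    case False
    obtain j y where j: "j \<in> I" "y \<in> carrier W" and x: "x = s j \<otimes> y" and l: "len y < len x"
      and e: "bruhat_edge y (s j \<otimes> y)"
      using left_split_edge[OF less.prems(2) False] .
    have IH: "bruhat (f y) y" using less.hyps[OF l less.prems(1) j(2)] .
    from f j(1) e show ?thesis
    proof (cases rule: bihecke_left_edge)
      case 1
      then show ?thesis using IH e x by (simp add: rtranclp.rtrancl_into_rtrancl)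
    next
      case 2
      then have "left_up j (f y) = f x" "left_up j y = x" using e x by (auto simp: raise_by_def)
      then show ?thesis using bruhat_left_up[OF j(1) IH] by simp
    qed
  qed
qed

definition left_step :: "'w \<Rightarrow> 'w \<Rightarrow> bool" where
  "left_step x y \<longleftrightarrow> (\<exists>j\<in>I. y = s j \<otimes> x \<and> bruhat_edge x y)"

abbreviation left_le :: "'w \<Rightarrow> 'w \<Rightarrow> bool" where "left_le \<equiv> left_step\<^sup>*\<^sup>*"

lemma left_le_bruhat: "left_le x y \<Longrightarrow> bruhat x y"
  by (induction rule: rtranclp_induct) (auto simp: left_step_def intro: rtranclp.rtrancl_into_rtrancl)

lemma left_le_antisym: "left_le x y \<Longrightarrow> left_le y x \<Longrightarrow> x = y"
  using left_le_bruhat bruhat_antisym by blast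

lemma bihecke_left_le:
  assumes f: "f \<in> carrier M" shows "left_le x y \<Longrightarrow> left_le (f x) (f y)"
proof (induction rule: rtranclp_induct)
  case (step y z)
  from step(2) obtain j where j: "j \<in> I" "z = s j \<otimes> y" "bruhat_edge y (s j \<otimes> y)"
    unfolding left_step_def by blast
  from f j(1,3) have "left_le (f y) (f z)"
    by (cases rule: bihecke_left_edge) (use j in \<open>auto simp: left_step_def intro!: r_into_rtranclp\<close>)
  then show ?case using step by (meson rtranclp_trans)
qed simp

text \<open>An edge from \<open>x\<close> up to a fixed point \<open>z\<close> cannot be contracted, for then \<open>f x = z\<close> would lie above
  \<open>x\<close>.  As it keeps its label, its lower end is fixed too.\<close>

lemma borel_fix_down:
  assumes f: "f \<in> carrier B" shows "left_le x y \<Longrightarrow> f y = y \<Longrightarrow> f x = x"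
proof (induction rule: converse_rtranclp_induct)
  case (step x z)
  from step(1) obtain j where j: "j \<in> I" "z = s j \<otimes> x" "bruhat_edge x (s j \<otimes> x)"
    unfolding left_step_def by blast
  have x: "x \<in> carrier W" using j bruhat_edge_closed by blast
  have fz: "f z = z" using step by blast
  from borel_bihecke[OF f] j(1,3) show ?case
  proof (cases rule: bihecke_left_edge)
    case 1
    then have "bruhat z x" using borel_regressive[OF f x] fz j(2) by simp
    then show ?thesis using bruhat_len[of z x] bruhat_edge_len[OF j(3)] j(2) by auto
  next
    case 2
    then have "s j \<otimes> f x = s j \<otimes> x" using fz j(2) by simp
    then show ?thesis using x borel_bihecke[OF f] j(1) by (metis bihecke_closed s_cancel_left)
  qed
qed simp

lemma bruhat_one: "x \<in> carrier W \<Longrightarrow> bruhat \<one> x"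
proof (induction "len x" arbitrary: x rule: less_induct)
  case less
  show ?case
  proof (cases "x = \<one>")
    case False
    obtain j y where j: "j \<in> I" "y \<in> carrier W" and x: "x = s j \<otimes> y" and l: "len y < len x"
      and e: "bruhat_edge y (s j \<otimes> y)"
      using left_split_edge[OF less.prems(1) False] .
    then show ?thesis using less.hyps[OF l j(2)] by (simp add: rtranclp.rtrancl_into_rtrancl)
  qed simp
qed

text \<open>An element without ascents is fixed by all raising operators, while these operators lead from
  \<open>\<one>\<close> to every \<open>x\<close>; they preserve the order.\<close>

lemma bruhat_top_right:
  assumes z: "z \<in> carrier W" "\<And>i. i \<in> I \<Longrightarrow> \<not> bruhat_edge z (z \<otimes> s i)"
  shows "x \<in> carrier W \<Longrightarrow> bruhat x z"
proof (induction "len x" arbitrary: x rule: less_induct)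
  case less
  show ?case
  proof (cases "x = \<one>")
    case True
    then show ?thesis using bruhat_one z by simp
  next
    case False
    obtain j y where j: "j \<in> I" "y \<in> carrier W" and x: "x = y \<otimes> s j" and l: "len x = Suc (len y)"
      using right_split[OF less.prems(1) False] .
    have "bruhat_edge y (y \<otimes> s j)"
      using bruhat_edge_right_total[OF j(2,1)] bruhat_edge_len[of "y \<otimes> s j" y] x l by auto
    then have "up j y = x" "up j z = z" using z(2) j x by (auto simp: raise_by_def)
    then show ?thesis using bruhat_up[OF j(1) less.hyps[of y]] l j by simp
  qed
qed

lemma bruhat_top_left:
  assumes z: "z \<in> carrier W" "\<And>i. i \<in> I \<Longrightarrow> \<not> bruhat_edge z (s i \<otimes> z)"
  shows "x \<in> carrier W \<Longrightarrow> bruhat x z"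
proof (induction "len x" arbitrary: x rule: less_induct)
  case less
  show ?case
  proof (cases "x = \<one>")
    case True
    then show ?thesis using bruhat_one z by simp
  next
    case False
    obtain j y where j: "j \<in> I" "y \<in> carrier W" and x: "x = s j \<otimes> y" and l: "len y < len x"
      and e: "bruhat_edge y (s j \<otimes> y)"
      using left_split_edge[OF less.prems(1) False] .
    then have "left_up j y = x" "left_up j z = z" using z(2) j x by (auto simp: raise_by_def)
    then show ?thesis using bruhat_left_up[OF j(1) less.hyps[of y]] l j by simp
  qed
qed

end

section \<open>Idempotents of the Borel submonoid\<close>

locale finite_coxeter_group = coxeter_group +
  assumes fin: "finite (carrier W)"
begin

definition longest :: 'a where
  "longest = (SOME w. w \<in> carrier W \<and> (\<forall>x\<in>carrier W. len x \<le> len w))"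

lemma longest: "longest \<in> carrier W" and len_longest: "x \<in> carrier W \<Longrightarrow> len x \<le> len longest"
proof -
  have "\<exists>w. w \<in> carrier W \<and> (\<forall>x\<in>carrier W. len x \<le> len w)"
  proof -
    have "Max (len ` carrier W) \<in> len ` carrier W" using fin one_closed by (intro Max_in) auto
    then obtain w where "w \<in> carrier W" "len w = Max (len ` carrier W)" by auto
    then show ?thesis using fin by auto
  qed
  then have "longest \<in> carrier W \<and> (\<forall>x\<in>carrier W. len x \<le> len longest)"
    unfolding longest_def by (rule someI_ex)
  then show "longest \<in> carrier W" "x \<in> carrier W \<Longrightarrow> len x \<le> len longest" by auto
qed

lemma not_above_longest: "\<not> bruhat_edge longest x"
  using bruhat_edge_len[of longest x] len_longest[of x] bruhat_edge_closed(2)[of longest x] by auto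

lemma longest_unique: "z \<in> carrier W \<Longrightarrow> bruhat longest z \<Longrightarrow> z = longest"
  using bruhat_len[of longest z] len_longest[of z] by auto

text \<open>Ascend from \<open>x\<close> along left edges.  Where this stops, \<open>bruhat_top_left\<close> shows that the longest
  element has been reached.\<close>

lemma left_le_longest: "x \<in> carrier W \<Longrightarrow> left_le x longest"
proof (induction "len longest - len x" arbitrary: x rule: less_induct)
  case less
  show ?case
  proof (cases "\<exists>j\<in>I. bruhat_edge x (s j \<otimes> x)")
    case True
    then obtain j where j: "j \<in> I" "bruhat_edge x (s j \<otimes> x)" by blast
    have c: "s j \<otimes> x \<in> carrier W" using j bruhat_edge_closed by blast
    have "len longest - len (s j \<otimes> x) < len longest - len x"
      using bruhat_edge_len[OF j(2)] len_longest[OF c] by linarith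
    from less.hyps[OF this c] have "left_le (s j \<otimes> x) longest" .
    moreover have "left_step x (s j \<otimes> x)" using j unfolding left_step_def by blast
    ultimately show ?thesis by (meson converse_rtranclp_into_rtranclp)
  next
    case False
    then have "bruhat longest x" using bruhat_top_left[of x longest] less.prems longest by blast
    then have "x = longest" using longest_unique less.prems by blast
    then show ?thesis by simp
  qed
qed

text \<open>Choose generators with \<open>w s\<^sub>i\<^sub>1 \<dots> s\<^sub>i\<^sub>k\<close> longest and lengths increasing along the way.  The map is
  \<open>\<pi>\<close> applied for \<open>i\<^sub>1, \<dots>, i\<^sub>k\<close> followed by the dual operators for \<open>i\<^sub>k, \<dots>, i\<^sub>1\<close>; it carries \<open>w\<close> up to the
  longest element and back.  The induction peels off the outermost pair of operators.\<close>

lemma exists_projection: "w \<in> carrier W \<Longrightarrow> \<exists>f\<in>carrier B. f w = w \<and> f longest = w"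
proof (induction "len longest - len w" arbitrary: w rule: less_induct)
  case less
  show ?case
  proof (cases "\<exists>i\<in>I. bruhat_edge w (w \<otimes> s i)")
    case True
    then obtain i where i: "i \<in> I" "bruhat_edge w (w \<otimes> s i)" by blast
    have c: "w \<otimes> s i \<in> carrier W" using i less.prems by simp
    have "len longest - len (w \<otimes> s i) < len longest - len w"
      using bruhat_edge_len[OF i(2)] len_longest[OF c] by linarith
    from less.hyps[OF this c] obtain f where f: "f \<in> carrier B" "f (w \<otimes> s i) = w \<otimes> s i" 
      "f longest = w \<otimes> s i" by blast
    define g where "g = compose (carrier W) (hecke_op_bar W I s i) (compose (carrier W) f (hecke_op W I s i))"
    have gM: "g \<in> carrier M"
      unfolding g_def using i f borel_bihecke by (intro bihecke_mult_closed hecke_op_closed hecke_op_bar_closed)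
    have g: "g x = down i (f (up i x))" if "x \<in> carrier W" for x
      using that i(1) borel_bihecke[OF f(1)] by (simp add: g_def compose_def up_closed hecke_op_eq hecke_op_bar_eq)
    have nd: "\<not> bruhat_edge (w \<otimes> s i) w"
      using bruhat_edge_len[OF i(2)] bruhat_edge_len[of "w \<otimes> s i" w] by auto
    have d: "down i (w \<otimes> s i) = w" using nd i less.prems by (simp add: lower_by_def)
    have "up i w = w \<otimes> s i" "up i longest = longest"
      using i not_above_longest by (auto simp: raise_by_def)
    then have "g w = w" "g longest = w" using g f d longest less.prems by auto
    moreover have "g \<one> = \<one>"
    proof -
      \<comment> \<open>raising takes \<open>\<one>\<close> to \<open>s i\<close>, which \<open>f\<close> sends to one of the two ends of the edge joining
        \<open>\<one>\<close> and \<open>s i\<close>; lowering leads from both ends to \<open>\<one>\<close>\<close>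
      have e: "bruhat_edge \<one> (\<one> \<otimes> s i)"
        using i(1) by (subst bruhat_edge_s_iff) auto
      then have e': "bruhat_edge \<one> (s i \<otimes> \<one>)" using i by simp
      have f1: "f \<one> = \<one>" using f(1) by (simp add: borel_carrier)
      have "f (s i) = \<one> \<or> f (s i) = s i"
        using borel_bihecke[OF f(1)] i(1) e'
        by (cases rule: bihecke_left_edge) (use f1 i in auto)
      moreover have "down i \<one> = \<one>" using e by (simp add: lower_by_def)
      moreover have "down i (s i) = \<one>"
        using bruhat_edge_len[OF e] bruhat_edge_len[of "s i" "\<one>"] i by (auto simp: lower_by_def)
      moreover have "up i \<one> = s i" using e i by (simp add: raise_by_def)
      ultimately show ?thesis using g[of \<one>] by auto
    qed
    ultimately show ?thesis using gM by (auto simp: borel_carrier)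
  next
    case False
    then have "bruhat longest w" using bruhat_top_right[of w longest] less.prems longest by blast
    then have w: "w = longest" using longest_unique less.prems by blast
    have "(\<lambda>x\<in>carrier W. x) \<in> carrier B" using bihecke_one_closed by (simp add: borel_carrier)
    then show ?thesis unfolding w using longest by (intro bexI[of _ "\<lambda>x\<in>carrier W. x"]) auto
  qed
qed

lemma borel_monoid: "monoid B"
proof (rule monoidI)
  fix f g assume "f \<in> carrier B" "g \<in> carrier B"
  then show "f \<otimes>\<^bsub>B\<^esub> g \<in> carrier B"
    using bihecke_mult_closed by (auto simp: borel_carrier borel_mult compose_def)
next
  show "\<one>\<^bsub>B\<^esub> \<in> carrier B" using bihecke_one_closed by (simp add: borel_carrier borel_one)
next
  fix f g h assume "f \<in> carrier B" "g \<in> carrier B" "h \<in> carrier B"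
  then show "f \<otimes>\<^bsub>B\<^esub> g \<otimes>\<^bsub>B\<^esub> h = f \<otimes>\<^bsub>B\<^esub> (g \<otimes>\<^bsub>B\<^esub> h)"
    by (auto simp: borel_mult compose_def fun_eq_iff dest!: borel_bihecke)
next
  fix f assume f: "f \<in> carrier B"
  have "f x = undefined" if "x \<notin> carrier W" for x
    using bihecke_PiE[OF borel_bihecke[OF f]] that by (auto simp: PiE_def extensional_def)
  then show "\<one>\<^bsub>B\<^esub> \<otimes>\<^bsub>B\<^esub> f = f" "f \<otimes>\<^bsub>B\<^esub> \<one>\<^bsub>B\<^esub> = f"
    using borel_bihecke[OF f] by (auto simp: borel_mult borel_one compose_def fun_eq_iff)
qed

lemma borel_finite: "finite (carrier B)"
proof (rule finite_subset)
  show "carrier B \<subseteq> carrier W \<rightarrow>\<^sub>E carrier W" using bihecke_PiE borel_bihecke by blast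
qed (use fin in \<open>simp add: finite_PiE\<close>)

lemma borel_eqI: 
  assumes "f \<in> carrier B" "g \<in> carrier B" "\<And>x. x \<in> carrier W \<Longrightarrow> f x = g x" shows "f = g"
  using assms bihecke_PiE[OF borel_bihecke] by (intro PiE_ext) 

lemma borel_mult_apply: "x \<in> carrier W \<Longrightarrow> (f \<otimes>\<^bsub>B\<^esub> g) x = g (f x)"
  by (simp add: borel_mult compose_def)

text \<open>Regressivity alone: \<open>f x = h (g (f x)) \<le> g (f x) \<le> f x\<close>.\<close>

lemma borel_R_trivial:
  assumes f: "f \<in> carrier B" and g: "g \<in> carrier B" and h: "h \<in> carrier B"
    and e: "f \<otimes>\<^bsub>B\<^esub> g \<otimes>\<^bsub>B\<^esub> h = f"
  shows "f \<otimes>\<^bsub>B\<^esub> g = f"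
proof (rule borel_eqI)
  fix x assume x: "x \<in> carrier W"
  have fx: "f x \<in> carrier W" "g (f x) \<in> carrier W" using f g x borel_bihecke by auto
  have "h (g (f x)) = f x" using fun_cong[OF e, of x] x by (simp add: borel_mult_apply)
  then have "bruhat (f x) (g (f x))" using borel_regressive[OF h fx(2)] by simp
  then show "(f \<otimes>\<^bsub>B\<^esub> g) x = f x"
    using bruhat_antisym borel_regressive[OF g fx(1)] x by (simp add: borel_mult_apply)
qed (use f g monoid.m_closed[OF borel_monoid] in auto)

text \<open>Here monotonicity enters as well: from \<open>h x \<le> x\<close> follows \<open>f x = f (g (h x)) \<le> f (g x) \<le> f x\<close>.\<close>

lemma borel_L_trivial:
  assumes f: "f \<in> carrier B" and g: "g \<in> carrier B" and h: "h \<in> carrier B"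
    and e: "h \<otimes>\<^bsub>B\<^esub> g \<otimes>\<^bsub>B\<^esub> f = f"
  shows "g \<otimes>\<^bsub>B\<^esub> f = f"
proof (rule borel_eqI)
  fix x assume x: "x \<in> carrier W"
  have hx: "h x \<in> carrier W" "g x \<in> carrier W" "g (h x) \<in> carrier W" using h g x borel_bihecke by auto
  have "bruhat (g (h x)) (g x)"
    by (rule bihecke_bruhat[OF borel_bihecke[OF g] hx(1) borel_regressive[OF h x]])
  then have "bruhat (f (g (h x))) (f (g x))"
    by (rule bihecke_bruhat[OF borel_bihecke[OF f] hx(3)])
  moreover have "f (g (h x)) = f x" using fun_cong[OF e, of x] x by (simp add: borel_mult_apply)
  moreover have "bruhat (f (g x)) (f x)"
    by (rule bihecke_bruhat[OF borel_bihecke[OF f] hx(2) borel_regressive[OF g x]])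
  ultimately show "(g \<otimes>\<^bsub>B\<^esub> f) x = f x"
    using bruhat_antisym x by (simp add: borel_mult_apply)
qed (use f g monoid.m_closed[OF borel_monoid] in auto)

lemma projection_below:
  assumes f: "f \<in> carrier B" "f longest = w" and x: "x \<in> carrier W" shows "left_le (f x) w"
  using bihecke_left_le[OF borel_bihecke[OF f(1)] left_le_longest[OF x]] f(2) by simp

text \<open>The image of \<open>f\<close> lies in the interval below \<open>w\<close> in left order, and \<open>g\<close> is the identity on
  this interval as soon as it fixes \<open>w\<close>.\<close>

lemma absorb_iff_fix:
  assumes f: "f \<in> carrier B" "f longest = w" "f w = w" and g: "g \<in> carrier B"
  shows "f \<otimes>\<^bsub>B\<^esub> g = f \<longleftrightarrow> g w = w"
proof
  assume "f \<otimes>\<^bsub>B\<^esub> g = f"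
  from fun_cong[OF this, of longest] show "g w = w"
    using f longest by (simp add: borel_mult_apply)
next
  assume w: "g w = w"
  show "f \<otimes>\<^bsub>B\<^esub> g = f"
  proof (rule borel_eqI)
    fix x assume x: "x \<in> carrier W"
    show "(f \<otimes>\<^bsub>B\<^esub> g) x = f x"
      using borel_fix_down[OF g projection_below[OF f(1,2) x] w] x by (simp add: borel_mult_apply)
  qed (use f g monoid.m_closed[OF borel_monoid] in auto)
qed

lemma idempotent_fix:
  assumes e: "e \<in> carrier B" "e \<otimes>\<^bsub>B\<^esub> e = e"
  obtains w where "w \<in> carrier W" "\<And>g. g \<in> carrier B \<Longrightarrow> e \<otimes>\<^bsub>B\<^esub> g = e \<longleftrightarrow> g w = w"
proof
  show "e longest \<in> carrier W" using e longest borel_bihecke by simp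
  have "e (e longest) = e longest" using fun_cong[OF e(2), of longest] longest by (simp add: borel_mult_apply)
  then show "e \<otimes>\<^bsub>B\<^esub> g = e \<longleftrightarrow> g (e longest) = e longest" if "g \<in> carrier B" for g
    using absorb_iff_fix[OF e(1) _ _ that] by simp
qed

text \<open>The projection for \<open>w\<close> fixes only elements below \<open>w\<close> in left order, so that \<open>v\<close> lies below \<open>w\<close>, and
  symmetrically.\<close>

lemma fixing_determines:
  assumes w: "w \<in> carrier W" "v \<in> carrier W" and *: "\<And>g. g \<in> carrier B \<Longrightarrow> g w = w \<longleftrightarrow> g v = v"
  shows "w = v"
proof -
  have le: "left_le v w" if vw: "w \<in> carrier W" "v \<in> carrier W" "\<And>g. g \<in> carrier B \<Longrightarrow> g w = w \<longleftrightarrow> g v = v" for v w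
  proof -
    obtain f where f: "f \<in> carrier B" "f w = w" "f longest = w" using exists_projection vw(1) by blast
    then have "f v = v" using vw(3) by blast
    then show ?thesis using projection_below[OF f(1,3) vw(2)] by simp
  qed
  show ?thesis
    using left_le_antisym[OF le[OF w(2,1)] le[OF w]] * by blast
qed

end

section \<open>The algebra of a finite monoid\<close>

locale finite_monoid_algebra = M: monoid M + K: field K
  for M :: "('m, 'e) monoid_scheme" and K :: "('k, 'c) ring_scheme" +
  assumes finite_monoid: "finite (carrier M)"
begin

abbreviation A where "A \<equiv> monoid_algebra K M"
abbreviation \<Delta> where "\<Delta> \<equiv> monoid_algebra_of K M"
abbreviation ind :: "bool \<Rightarrow> 'k" where "ind P \<equiv> (if P then \<one>\<^bsub>K\<^esub> else \<zero>\<^bsub>K\<^esub>)"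

lemma carrier_iff: "a \<in> carrier A \<longleftrightarrow> a \<in> carrier M \<rightarrow>\<^sub>E carrier K"
  using finite_monoid by (simp add: monoid_algebra_def)

lemma coeff_closed [simp]: "a \<in> carrier A \<Longrightarrow> x \<in> carrier M \<Longrightarrow> a x \<in> carrier K"
  by (auto simp: carrier_iff)

lemma restrict_closed: "(\<And>x. x \<in> carrier M \<Longrightarrow> f x \<in> carrier K) \<Longrightarrow> (\<lambda>x\<in>carrier M. f x) \<in> carrier A"
  by (auto simp: carrier_iff)

lemma algebra_eqI:
  "a \<in> carrier A \<Longrightarrow> b \<in> carrier A \<Longrightarrow> (\<And>x. x \<in> carrier M \<Longrightarrow> a x = b x) \<Longrightarrow> a = b"
  by (auto simp: carrier_iff intro: PiE_ext)

lemma add_eq: "a \<oplus>\<^bsub>A\<^esub> b = (\<lambda>x\<in>carrier M. a x \<oplus>\<^bsub>K\<^esub> b x)"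
  and zero_eq: "\<zero>\<^bsub>A\<^esub> = (\<lambda>x\<in>carrier M. \<zero>\<^bsub>K\<^esub>)"
  and smult_eq: "c \<odot>\<^bsub>A\<^esub> a = (\<lambda>x\<in>carrier M. c \<otimes>\<^bsub>K\<^esub> a x)"
  and one_eq: "\<one>\<^bsub>A\<^esub> = \<Delta> \<one>\<^bsub>M\<^esub>"
  by (simp_all add: monoid_algebra_def monoid_algebra_of_def)

lemma delta_apply: "x \<in> carrier M \<Longrightarrow> \<Delta> f x = ind (x = f)"
  by (simp add: monoid_algebra_of_def)

lemma add_apply: "x \<in> carrier M \<Longrightarrow> (a \<oplus>\<^bsub>A\<^esub> b) x = a x \<oplus>\<^bsub>K\<^esub> b x"
  and zero_apply: "x \<in> carrier M \<Longrightarrow> \<zero>\<^bsub>A\<^esub> x = \<zero>\<^bsub>K\<^esub>"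
  and smult_apply: "x \<in> carrier M \<Longrightarrow> (c \<odot>\<^bsub>A\<^esub> a) x = c \<otimes>\<^bsub>K\<^esub> a x"
  by (simp_all add: add_eq zero_eq smult_eq)

lemma add_closed: "a \<in> carrier A \<Longrightarrow> b \<in> carrier A \<Longrightarrow> a \<oplus>\<^bsub>A\<^esub> b \<in> carrier A"
  and zero_closed: "\<zero>\<^bsub>A\<^esub> \<in> carrier A"
  and smult_closed: "c \<in> carrier K \<Longrightarrow> a \<in> carrier A \<Longrightarrow> c \<odot>\<^bsub>A\<^esub> a \<in> carrier A"
  and delta_closed [simp]: "\<Delta> f \<in> carrier A"
  unfolding add_eq zero_eq smult_eq monoid_algebra_of_def by (rule restrict_closed; simp)+

lemma algebra_abelian_group: "abelian_group A"
proof (rule abelian_groupI)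
  fix x assume x: "x \<in> carrier A"
  show "\<exists>y\<in>carrier A. y \<oplus>\<^bsub>A\<^esub> x = \<zero>\<^bsub>A\<^esub>"
  proof (rule bexI)
    let ?y = "\<lambda>z\<in>carrier M. \<ominus>\<^bsub>K\<^esub> x z"
    show y: "?y \<in> carrier A" by (rule restrict_closed) (use x in simp)
    show "?y \<oplus>\<^bsub>A\<^esub> x = \<zero>\<^bsub>A\<^esub>"
      by (rule algebra_eqI) (use x y in \<open>auto simp: add_apply zero_apply K.l_neg intro!: add_closed zero_closed\<close>)
  qed
next
  fix x y z assume "x \<in> carrier A" "y \<in> carrier A" "z \<in> carrier A"
  then show "x \<oplus>\<^bsub>A\<^esub> y \<oplus>\<^bsub>A\<^esub> z = x \<oplus>\<^bsub>A\<^esub> (y \<oplus>\<^bsub>A\<^esub> z)"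
    by (intro algebra_eqI) (simp_all add: add_closed add_apply K.a_assoc)
next
  fix x y assume "x \<in> carrier A" "y \<in> carrier A"
  then show "x \<oplus>\<^bsub>A\<^esub> y = y \<oplus>\<^bsub>A\<^esub> x"
    by (intro algebra_eqI) (simp_all add: add_closed add_apply K.a_comm)
next
  fix x assume "x \<in> carrier A"
  then show "\<zero>\<^bsub>A\<^esub> \<oplus>\<^bsub>A\<^esub> x = x"
    by (intro algebra_eqI) (simp_all add: add_closed zero_closed add_apply zero_apply)
qed (auto intro: add_closed zero_closed)

lemma algebra_module: "module K A"
  by (rule moduleI)
    (auto intro!: algebra_abelian_group smult_closed K.is_cring algebra_eqI
      simp: add_closed smult_closed smult_apply add_apply K.l_distr K.r_distr K.m_assoc)

text \<open>The value at \<open>a\<close> of the linear extension of \<open>\<phi>\<close>.  Coefficients of products are such values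
  (\<open>mult_apply\<close>), which reduces the ring laws to those of \<open>M\<close>.\<close>

definition pair :: "('m \<Rightarrow> 'k) \<Rightarrow> ('m \<Rightarrow> 'k) \<Rightarrow> 'k" where
  "pair a \<phi> = (\<Oplus>\<^bsub>K\<^esub>x\<in>carrier M. a x \<otimes>\<^bsub>K\<^esub> \<phi> x)"

abbreviation functional :: "('m \<Rightarrow> 'k) \<Rightarrow> bool" where
  "functional \<phi> \<equiv> \<phi> \<in> carrier M \<rightarrow> carrier K"

lemma pair_closed [simp]: "a \<in> carrier A \<Longrightarrow> functional \<phi> \<Longrightarrow> pair a \<phi> \<in> carrier K"
  unfolding pair_def by (rule K.finsum_closed) auto

lemma pair_cong: 
  "a \<in> carrier A \<Longrightarrow> functional \<psi> \<Longrightarrow> (\<And>x. x \<in> carrier M \<Longrightarrow> \<phi> x = \<psi> x) \<Longrightarrow> pair a \<phi> = pair a \<psi>"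
  unfolding pair_def by (rule K.finsum_cong') auto

lemma pair_add: 
  assumes "a \<in> carrier A" "b \<in> carrier A" "functional \<phi>"
  shows "pair (a \<oplus>\<^bsub>A\<^esub> b) \<phi> = pair a \<phi> \<oplus>\<^bsub>K\<^esub> pair b \<phi>"
proof -
  have "pair (a \<oplus>\<^bsub>A\<^esub> b) \<phi> = (\<Oplus>\<^bsub>K\<^esub>x\<in>carrier M. a x \<otimes>\<^bsub>K\<^esub> \<phi> x \<oplus>\<^bsub>K\<^esub> b x \<otimes>\<^bsub>K\<^esub> \<phi> x)"
    unfolding pair_def by (rule K.finsum_cong') (use assms in \<open>auto simp: add_apply K.l_distr Pi_iff\<close>)
  then show ?thesis using assms unfolding pair_def by (subst K.finsum_addf[symmetric]) (auto simp: Pi_iff)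
qed

lemma pair_smult: 
  assumes "c \<in> carrier K" "a \<in> carrier A" "functional \<phi>"
  shows "pair (c \<odot>\<^bsub>A\<^esub> a) \<phi> = c \<otimes>\<^bsub>K\<^esub> pair a \<phi>"
proof -
  have "pair (c \<odot>\<^bsub>A\<^esub> a) \<phi> = (\<Oplus>\<^bsub>K\<^esub>x\<in>carrier M. c \<otimes>\<^bsub>K\<^esub> (a x \<otimes>\<^bsub>K\<^esub> \<phi> x))"
    unfolding pair_def by (rule K.finsum_cong') (use assms in \<open>auto simp: smult_apply K.m_assoc Pi_iff\<close>)
  then show ?thesis using assms finite_monoid unfolding pair_def by (subst K.finsum_rdistr) (auto simp: Pi_iff)
qed

lemma pair_functional_add: 
  assumes "a \<in> carrier A" "functional \<phi>" "functional \<psi>"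
  shows "pair a (\<lambda>x. \<phi> x \<oplus>\<^bsub>K\<^esub> \<psi> x) = pair a \<phi> \<oplus>\<^bsub>K\<^esub> pair a \<psi>"
proof -
  have "pair a (\<lambda>x. \<phi> x \<oplus>\<^bsub>K\<^esub> \<psi> x) = (\<Oplus>\<^bsub>K\<^esub>x\<in>carrier M. a x \<otimes>\<^bsub>K\<^esub> \<phi> x \<oplus>\<^bsub>K\<^esub> a x \<otimes>\<^bsub>K\<^esub> \<psi> x)"
    unfolding pair_def by (rule K.finsum_cong') (use assms in \<open>auto simp: K.r_distr Pi_iff\<close>)
  then show ?thesis using assms unfolding pair_def by (subst K.finsum_addf[symmetric]) (auto simp: Pi_iff)
qed

lemma pair_functional_mult: 
  assumes "c \<in> carrier K" "a \<in> carrier A" "functional \<phi>"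
  shows "pair a (\<lambda>x. \<phi> x \<otimes>\<^bsub>K\<^esub> c) = pair a \<phi> \<otimes>\<^bsub>K\<^esub> c"
proof -
  have "pair a (\<lambda>x. \<phi> x \<otimes>\<^bsub>K\<^esub> c) = (\<Oplus>\<^bsub>K\<^esub>x\<in>carrier M. (a x \<otimes>\<^bsub>K\<^esub> \<phi> x) \<otimes>\<^bsub>K\<^esub> c)"
    unfolding pair_def by (rule K.finsum_cong') (use assms in \<open>auto simp: K.m_assoc Pi_iff\<close>)
  then show ?thesis using assms finite_monoid unfolding pair_def by (subst K.finsum_ldistr) (auto simp: Pi_iff)
qed

lemma pair_zero: "functional \<phi> \<Longrightarrow> pair \<zero>\<^bsub>A\<^esub> \<phi> = \<zero>\<^bsub>K\<^esub>"
  unfolding pair_def by (rule K.add.finprod_one_eqI) (auto simp: zero_apply Pi_iff)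

lemma pair_delta:
  assumes "f \<in> carrier M" "functional \<phi>" shows "pair (\<Delta> f) \<phi> = \<phi> f"
proof -
  have "pair (\<Delta> f) \<phi> = (\<Oplus>\<^bsub>K\<^esub>x\<in>carrier M. if f = x then \<phi> x else \<zero>\<^bsub>K\<^esub>)"
    unfolding pair_def by (rule K.finsum_cong') (use assms in \<open>auto simp: delta_apply Pi_iff\<close>)
  also have "\<dots> = \<phi> f"
    by (rule K.finsum_singleton) (use assms finite_monoid in auto)
  finally show ?thesis .
qed

lemma pair_ind:
  assumes "z \<in> carrier M" "a \<in> carrier A" shows "pair a (\<lambda>x. ind (x = z)) = a z"
proof -
  have "pair a (\<lambda>x. ind (x = z)) = (\<Oplus>\<^bsub>K\<^esub>x\<in>carrier M. if z = x then a x else \<zero>\<^bsub>K\<^esub>)"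
    unfolding pair_def by (rule K.finsum_cong') (use assms in \<open>auto simp: Pi_iff\<close>)
  also have "\<dots> = a z"
    by (rule K.finsum_singleton) (use assms finite_monoid in auto)
  finally show ?thesis .
qed

lemma mult_apply_pairs:
  assumes a: "a \<in> carrier A" and b: "b \<in> carrier A" and z: "z \<in> carrier M"
  shows "(a \<otimes>\<^bsub>A\<^esub> b) z = (\<Oplus>\<^bsub>K\<^esub>p\<in>carrier M \<times> carrier M.
     a (fst p) \<otimes>\<^bsub>K\<^esub> b (snd p) \<otimes>\<^bsub>K\<^esub> ind (fst p \<otimes>\<^bsub>M\<^esub> snd p = z))"
proof -
  have "(a \<otimes>\<^bsub>A\<^esub> b) z = (\<Oplus>\<^bsub>K\<^esub>p \<in> {(x, y). x \<in> carrier M \<and> y \<in> carrier M \<and> a x \<noteq> \<zero>\<^bsub>K\<^esub> \<and>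
      b y \<noteq> \<zero>\<^bsub>K\<^esub> \<and> x \<otimes>\<^bsub>M\<^esub> y = z}. a (fst p) \<otimes>\<^bsub>K\<^esub> b (snd p))"
    using z by (simp add: monoid_algebra_def)
  also have "\<dots> = (\<Oplus>\<^bsub>K\<^esub>p\<in>carrier M \<times> carrier M.
     a (fst p) \<otimes>\<^bsub>K\<^esub> b (snd p) \<otimes>\<^bsub>K\<^esub> ind (fst p \<otimes>\<^bsub>M\<^esub> snd p = z))"
  proof (rule K.add.finprod_mono_neutral_cong_left)
    show "finite (carrier M \<times> carrier M)" using finite_monoid by simp
  next
    fix p assume "p \<in> carrier M \<times> carrier M - {(x, y). x \<in> carrier M \<and> y \<in> carrier M \<and> a x \<noteq> \<zero>\<^bsub>K\<^esub> \<and>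
      b y \<noteq> \<zero>\<^bsub>K\<^esub> \<and> x \<otimes>\<^bsub>M\<^esub> y = z}"
    then show "a (fst p) \<otimes>\<^bsub>K\<^esub> b (snd p) \<otimes>\<^bsub>K\<^esub> ind (fst p \<otimes>\<^bsub>M\<^esub> snd p = z) = \<zero>\<^bsub>K\<^esub>"
      using a b by (cases p) auto
  qed (use a b in auto)
  finally show ?thesis .
qed

lemma mult_closed: 
  assumes "a \<in> carrier A" "b \<in> carrier A" shows "a \<otimes>\<^bsub>A\<^esub> b \<in> carrier A"
proof -
  have "(a \<otimes>\<^bsub>A\<^esub> b) z \<in> carrier K" if "z \<in> carrier M" for z
    unfolding mult_apply_pairs[OF assms that] by (rule K.finsum_closed) (use assms in auto)
  moreover have "a \<otimes>\<^bsub>A\<^esub> b \<in> extensional (carrier M)" by (simp add: monoid_algebra_def)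
  ultimately show ?thesis by (auto simp: carrier_iff PiE_def)
qed

text \<open>Both sides are the sum of \<open>a x \<otimes> b y \<otimes> \<phi> (x y)\<close> over all pairs; on the left the pairs are grouped
  according to the product \<open>x y\<close>.\<close>

lemma pair_mult:
  assumes a: "a \<in> carrier A" and b: "b \<in> carrier A" and \<phi>: "functional \<phi>"
  shows "pair (a \<otimes>\<^bsub>A\<^esub> b) \<phi> = pair a (\<lambda>x. pair b (\<lambda>y. \<phi> (x \<otimes>\<^bsub>M\<^esub> y)))"
proof -
  let ?P = "carrier M \<times> carrier M"
  let ?F = "\<lambda>p. a (fst p) \<otimes>\<^bsub>K\<^esub> b (snd p)" and ?m = "\<lambda>p. fst p \<otimes>\<^bsub>M\<^esub> snd p"
  have F: "?F \<in> ?P \<rightarrow> carrier K" using a b by auto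
  have \<phi>': "\<phi> x \<in> carrier K" if "x \<in> carrier M" for x using \<phi> that by auto
  have finP: "finite ?P" using finite_monoid by simp
  have "pair (a \<otimes>\<^bsub>A\<^esub> b) \<phi> = (\<Oplus>\<^bsub>K\<^esub>z\<in>carrier M. \<Oplus>\<^bsub>K\<^esub>p\<in>?P. ?F p \<otimes>\<^bsub>K\<^esub> ind (?m p = z) \<otimes>\<^bsub>K\<^esub> \<phi> z)"
    unfolding pair_def
  proof (rule K.finsum_cong')
    fix z assume z: "z \<in> carrier M"
    show "(a \<otimes>\<^bsub>A\<^esub> b) z \<otimes>\<^bsub>K\<^esub> \<phi> z = (\<Oplus>\<^bsub>K\<^esub>p\<in>?P. ?F p \<otimes>\<^bsub>K\<^esub> ind (?m p = z) \<otimes>\<^bsub>K\<^esub> \<phi> z)"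
      unfolding mult_apply_pairs[OF a b z]
      by (rule K.finsum_ldistr) (use a b \<phi>' z finP in auto)
  qed (use a b \<phi>' in \<open>auto intro!: K.finsum_closed\<close>)
  also have "\<dots> = (\<Oplus>\<^bsub>K\<^esub>p\<in>?P. \<Oplus>\<^bsub>K\<^esub>z\<in>carrier M. ?F p \<otimes>\<^bsub>K\<^esub> ind (?m p = z) \<otimes>\<^bsub>K\<^esub> \<phi> z)"
    by (rule K.finsum_finsum_swap) (use a b \<phi>' finP finite_monoid in auto)
  also have "\<dots> = (\<Oplus>\<^bsub>K\<^esub>p\<in>?P. ?F p \<otimes>\<^bsub>K\<^esub> \<phi> (?m p))"
  proof (rule K.finsum_cong')
    fix p assume p: "p \<in> ?P"
    have "(\<Oplus>\<^bsub>K\<^esub>z\<in>carrier M. ?F p \<otimes>\<^bsub>K\<^esub> ind (?m p = z) \<otimes>\<^bsub>K\<^esub> \<phi> z) =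
        (\<Oplus>\<^bsub>K\<^esub>z\<in>carrier M. if ?m p = z then ?F p \<otimes>\<^bsub>K\<^esub> \<phi> z else \<zero>\<^bsub>K\<^esub>)"
      by (rule K.finsum_cong') (use p a b \<phi>' in auto)
    also have "\<dots> = ?F p \<otimes>\<^bsub>K\<^esub> \<phi> (?m p)"
      by (rule K.finsum_singleton) (use p a b \<phi>' finite_monoid in auto)
    finally show "(\<Oplus>\<^bsub>K\<^esub>z\<in>carrier M. ?F p \<otimes>\<^bsub>K\<^esub> ind (?m p = z) \<otimes>\<^bsub>K\<^esub> \<phi> z) = ?F p \<otimes>\<^bsub>K\<^esub> \<phi> (?m p)" .
  qed (use a b \<phi>' in auto)
  also have "\<dots> = (\<Oplus>\<^bsub>K\<^esub>p\<in>?P. case p of (x, y) \<Rightarrow> a x \<otimes>\<^bsub>K\<^esub> (b y \<otimes>\<^bsub>K\<^esub> \<phi> (x \<otimes>\<^bsub>M\<^esub> y)))"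
    by (rule K.finsum_cong') (use a b \<phi>' in \<open>auto simp: K.m_assoc\<close>)
  also have "\<dots> = (\<Oplus>\<^bsub>K\<^esub>x\<in>carrier M. \<Oplus>\<^bsub>K\<^esub>y\<in>carrier M. a x \<otimes>\<^bsub>K\<^esub> (b y \<otimes>\<^bsub>K\<^esub> \<phi> (x \<otimes>\<^bsub>M\<^esub> y)))"
    by (rule K.add.finprod_finprod[symmetric]) (use a b \<phi>' finite_monoid in auto)
  also have "\<dots> = pair a (\<lambda>x. pair b (\<lambda>y. \<phi> (x \<otimes>\<^bsub>M\<^esub> y)))"
    unfolding pair_def
  proof (rule K.finsum_cong')
    fix x assume x: "x \<in> carrier M"
    show "(\<Oplus>\<^bsub>K\<^esub>y\<in>carrier M. a x \<otimes>\<^bsub>K\<^esub> (b y \<otimes>\<^bsub>K\<^esub> \<phi> (x \<otimes>\<^bsub>M\<^esub> y))) =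
        a x \<otimes>\<^bsub>K\<^esub> (\<Oplus>\<^bsub>K\<^esub>y\<in>carrier M. b y \<otimes>\<^bsub>K\<^esub> \<phi> (x \<otimes>\<^bsub>M\<^esub> y))"
      by (rule K.finsum_rdistr[symmetric]) (use x a b \<phi>' finite_monoid in auto)
  qed (use a b \<phi>' in \<open>auto intro!: K.finsum_closed\<close>)
  finally show ?thesis .
qed

lemma mult_apply:
  assumes "a \<in> carrier A" "b \<in> carrier A" "z \<in> carrier M"
  shows "(a \<otimes>\<^bsub>A\<^esub> b) z = pair a (\<lambda>x. pair b (\<lambda>y. ind (x \<otimes>\<^bsub>M\<^esub> y = z)))"
  using pair_ind[OF assms(3) mult_closed[OF assms(1,2)]] pair_mult[OF assms(1,2), of "\<lambda>x. ind (x = z)"]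
  by simp

lemma algebra_ring: "ring A"
proof (rule ringI)
  show "Group.monoid A"
  proof (rule monoidI)
    fix a b c assume a: "a \<in> carrier A" and b: "b \<in> carrier A" and c: "c \<in> carrier A"
    show "a \<otimes>\<^bsub>A\<^esub> b \<otimes>\<^bsub>A\<^esub> c = a \<otimes>\<^bsub>A\<^esub> (b \<otimes>\<^bsub>A\<^esub> c)"
    proof (rule algebra_eqI)
      fix z assume z: "z \<in> carrier M"
      have "(a \<otimes>\<^bsub>A\<^esub> b \<otimes>\<^bsub>A\<^esub> c) z =
          pair a (\<lambda>x. pair b (\<lambda>u. pair c (\<lambda>y. ind (x \<otimes>\<^bsub>M\<^esub> u \<otimes>\<^bsub>M\<^esub> y = z))))"
        using mult_apply[OF mult_closed[OF a b] c z] pair_mult[OF a b] c by simp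
      also have "\<dots> = pair a (\<lambda>x. pair b (\<lambda>u. pair c (\<lambda>y. ind (x \<otimes>\<^bsub>M\<^esub> (u \<otimes>\<^bsub>M\<^esub> y) = z))))"
        by (intro pair_cong) (use a b c in \<open>auto simp: M.m_assoc\<close>)
      also have "\<dots> = pair a (\<lambda>x. pair (b \<otimes>\<^bsub>A\<^esub> c) (\<lambda>y. ind (x \<otimes>\<^bsub>M\<^esub> y = z)))"
        by (intro pair_cong) (use a b c in \<open>auto simp: pair_mult mult_closed\<close>)
      also have "\<dots> = (a \<otimes>\<^bsub>A\<^esub> (b \<otimes>\<^bsub>A\<^esub> c)) z"
        using mult_apply[OF a mult_closed[OF b c] z] by simp
      finally show "(a \<otimes>\<^bsub>A\<^esub> b \<otimes>\<^bsub>A\<^esub> c) z = (a \<otimes>\<^bsub>A\<^esub> (b \<otimes>\<^bsub>A\<^esub> c)) z" .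
    qed (use a b c in \<open>auto intro!: mult_closed\<close>)
  next
    fix a assume a: "a \<in> carrier A"
    show "\<one>\<^bsub>A\<^esub> \<otimes>\<^bsub>A\<^esub> a = a"
    proof (rule algebra_eqI)
      fix z assume z: "z \<in> carrier M"
      have "(\<one>\<^bsub>A\<^esub> \<otimes>\<^bsub>A\<^esub> a) z = pair a (\<lambda>y. ind (\<one>\<^bsub>M\<^esub> \<otimes>\<^bsub>M\<^esub> y = z))"
        using a z by (simp add: one_eq mult_apply pair_delta)
      also have "\<dots> = pair a (\<lambda>y. ind (y = z))" by (rule pair_cong) (use a in auto)
      finally show "(\<one>\<^bsub>A\<^esub> \<otimes>\<^bsub>A\<^esub> a) z = a z" using a z by (simp add: pair_ind)
    qed (use a in \<open>auto simp: one_eq intro!: mult_closed\<close>)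
    show "a \<otimes>\<^bsub>A\<^esub> \<one>\<^bsub>A\<^esub> = a"
    proof (rule algebra_eqI)
      fix z assume z: "z \<in> carrier M"
      have "(a \<otimes>\<^bsub>A\<^esub> \<one>\<^bsub>A\<^esub>) z = pair a (\<lambda>x. pair \<one>\<^bsub>A\<^esub> (\<lambda>y. ind (x \<otimes>\<^bsub>M\<^esub> y = z)))"
        using a z by (simp add: one_eq mult_apply)
      also have "\<dots> = pair a (\<lambda>y. ind (y = z))" 
        by (rule pair_cong) (use a in \<open>auto simp: one_eq pair_delta\<close>)
      finally show "(a \<otimes>\<^bsub>A\<^esub> \<one>\<^bsub>A\<^esub>) z = a z" using a z by (simp add: pair_ind)
    qed (use a in \<open>auto simp: one_eq intro!: mult_closed\<close>)
  qed (auto simp: one_eq intro: mult_closed)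
next
  fix a b c assume a: "a \<in> carrier A" and b: "b \<in> carrier A" and c: "c \<in> carrier A"
  show "(a \<oplus>\<^bsub>A\<^esub> b) \<otimes>\<^bsub>A\<^esub> c = a \<otimes>\<^bsub>A\<^esub> c \<oplus>\<^bsub>A\<^esub> b \<otimes>\<^bsub>A\<^esub> c"
    by (rule algebra_eqI) (use a b c in \<open>auto simp: mult_apply add_apply add_closed mult_closed pair_add\<close>)
  show "c \<otimes>\<^bsub>A\<^esub> (a \<oplus>\<^bsub>A\<^esub> b) = c \<otimes>\<^bsub>A\<^esub> a \<oplus>\<^bsub>A\<^esub> c \<otimes>\<^bsub>A\<^esub> b"
    by (rule algebra_eqI)
      (use a b c in \<open>auto simp: mult_apply add_apply add_closed mult_closed pair_add pair_functional_add\<close>)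
qed (rule algebra_abelian_group)

end

sublocale finite_monoid_algebra \<subseteq> A: ring A
  by (rule algebra_ring)

sublocale finite_monoid_algebra \<subseteq> V: vectorspace K A
  using algebra_module K.field_axioms by (simp add: vectorspace_def)

context finite_monoid_algebra begin

lemma smult_mult_left:
  assumes "c \<in> carrier K" "a \<in> carrier A" "b \<in> carrier A"
  shows "c \<odot>\<^bsub>A\<^esub> a \<otimes>\<^bsub>A\<^esub> b = c \<odot>\<^bsub>A\<^esub> (a \<otimes>\<^bsub>A\<^esub> b)"
  by (rule algebra_eqI) (use assms in \<open>auto simp: mult_apply smult_apply pair_smult\<close>)

lemma smult_mult_right:
  assumes "c \<in> carrier K" "a \<in> carrier A" "b \<in> carrier A"
  shows "a \<otimes>\<^bsub>A\<^esub> (c \<odot>\<^bsub>A\<^esub> b) = c \<odot>\<^bsub>A\<^esub> (a \<otimes>\<^bsub>A\<^esub> b)"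
proof (rule algebra_eqI)
  fix z assume z: "z \<in> carrier M"
  have "(a \<otimes>\<^bsub>A\<^esub> (c \<odot>\<^bsub>A\<^esub> b)) z = pair a (\<lambda>x. pair b (\<lambda>y. ind (x \<otimes>\<^bsub>M\<^esub> y = z)) \<otimes>\<^bsub>K\<^esub> c)"
    using assms z by (subst mult_apply) (auto intro!: pair_cong simp: pair_smult K.m_comm)
  also have "\<dots> = (c \<odot>\<^bsub>A\<^esub> (a \<otimes>\<^bsub>A\<^esub> b)) z"
    using assms z by (subst pair_functional_mult) (auto simp: mult_apply smult_apply K.m_comm)
  finally show "(a \<otimes>\<^bsub>A\<^esub> (c \<odot>\<^bsub>A\<^esub> b)) z = (c \<odot>\<^bsub>A\<^esub> (a \<otimes>\<^bsub>A\<^esub> b)) z" .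
qed (use assms in auto)

lemma delta_mult: 
  assumes "f \<in> carrier M" "g \<in> carrier M" shows "\<Delta> f \<otimes>\<^bsub>A\<^esub> \<Delta> g = \<Delta> (f \<otimes>\<^bsub>M\<^esub> g)"
  by (rule algebra_eqI) (use assms in \<open>auto simp: mult_apply pair_delta delta_apply\<close>)

lemma algebra_induct [consumes 1, case_names zero add delta]:
  assumes a: "a \<in> carrier A"
    and zero: "P \<zero>\<^bsub>A\<^esub>"
    and add: "\<And>a b. a \<in> carrier A \<Longrightarrow> b \<in> carrier A \<Longrightarrow> P a \<Longrightarrow> P b \<Longrightarrow> P (a \<oplus>\<^bsub>A\<^esub> b)"
    and delta: "\<And>c f. c \<in> carrier K \<Longrightarrow> f \<in> carrier M \<Longrightarrow> P (c \<odot>\<^bsub>A\<^esub> \<Delta> f)"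
  shows "P a"
proof -
  define r where "r S = (\<lambda>x\<in>carrier M. if x \<in> S then a x else \<zero>\<^bsub>K\<^esub>)" for S
  have r: "r S \<in> carrier A" for S unfolding r_def by (rule restrict_closed) (use a in auto)
  have r_apply: "r S x = (if x \<in> S then a x else \<zero>\<^bsub>K\<^esub>)" if "x \<in> carrier M" for S x
    using that by (simp add: r_def)
  have "P (r S)" if "finite S" "S \<subseteq> carrier M" for S
    using that
  proof (induction S rule: finite_induct)
    case empty
    have "r {} = \<zero>\<^bsub>A\<^esub>" by (rule algebra_eqI) (auto simp: r r_apply zero_apply zero_closed)
    then show ?case using zero by simp
  next
    case (insert f S)
    have f: "f \<in> carrier M" "a f \<in> carrier K" using insert a by auto
    have "r (insert f S) = a f \<odot>\<^bsub>A\<^esub> \<Delta> f \<oplus>\<^bsub>A\<^esub> r S"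
      by (rule algebra_eqI)
        (use insert.hyps f a r in \<open>auto simp: r_apply add_apply smult_apply delta_apply intro!: add_closed smult_closed\<close>)
    moreover have "P (a f \<odot>\<^bsub>A\<^esub> \<Delta> f \<oplus>\<^bsub>A\<^esub> r S)"
      by (rule add[OF _ r delta]) (use insert f in \<open>auto intro: smult_closed\<close>)
    ultimately show ?case by simp
  qed
  from this[OF finite_monoid] have "P (r (carrier M))" by simp
  moreover have "r (carrier M) = a" by (rule algebra_eqI) (use a r in \<open>auto simp: r_apply\<close>)
  ultimately show ?thesis by simp
qed

lemma minus_apply: "a \<in> carrier A \<Longrightarrow> b \<in> carrier A \<Longrightarrow> x \<in> carrier M \<Longrightarrow> (a \<ominus>\<^bsub>A\<^esub> b) x = a x \<ominus>\<^bsub>K\<^esub> b x"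
proof -
  assume a: "a \<in> carrier A" "b \<in> carrier A" "x \<in> carrier M"
  have "(\<ominus>\<^bsub>A\<^esub> b) x \<oplus>\<^bsub>K\<^esub> b x = \<zero>\<^bsub>K\<^esub>"
    using add_apply[OF a(3), of "\<ominus>\<^bsub>A\<^esub> b" b] A.l_neg[OF a(2)] zero_apply[OF a(3)] by simp
  then have "(\<ominus>\<^bsub>A\<^esub> b) x = \<ominus>\<^bsub>K\<^esub> b x"
    using K.minus_equality[of "(\<ominus>\<^bsub>A\<^esub> b) x" "b x"] a by simp
  then show ?thesis using a by (simp add: a_minus_def add_apply)
qed

lemma pair_minus:
  assumes "a \<in> carrier A" "b \<in> carrier A" "functional \<phi>"
  shows "pair (a \<ominus>\<^bsub>A\<^esub> b) \<phi> = pair a \<phi> \<ominus>\<^bsub>K\<^esub> pair b \<phi>"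
proof -
  have "pair (a \<ominus>\<^bsub>A\<^esub> b) \<phi> \<oplus>\<^bsub>K\<^esub> pair b \<phi> = pair a \<phi>"
    using assms pair_add[of "a \<ominus>\<^bsub>A\<^esub> b" b \<phi>] by (simp add: a_minus_def A.a_assoc A.l_neg)
  then show ?thesis using assms
    by (metis A.minus_closed K.add.inv_solve_right a_minus_def pair_closed)
qed

end

section \<open>Finite J-trivial monoids\<close>

locale finite_J_trivial_monoid = monoid M for M (structure) +
  assumes finite_carrier: "finite (carrier M)"
    and R_trivial: "\<lbrakk>f \<in> carrier M; g \<in> carrier M; h \<in> carrier M; f \<otimes> g \<otimes> h = f\<rbrakk> \<Longrightarrow> f \<otimes> g = f"
    and L_trivial: "\<lbrakk>f \<in> carrier M; g \<in> carrier M; h \<in> carrier M; h \<otimes> g \<otimes> f = f\<rbrakk> \<Longrightarrow> g \<otimes> f = f"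
begin

definition idempotents where "idempotents = {e \<in> carrier M. e \<otimes> e = e}"

definition right_ideal_size where "right_ideal_size f = card ((\<lambda>g. f \<otimes> g) ` carrier M)"

text \<open>The right ideal generated by \<open>f \<otimes> g\<close> is contained in the one generated by \<open>f\<close>, and by
  R-triviality it has lost \<open>f\<close>.\<close>

lemma right_ideal_size_less:
  assumes f: "f \<in> carrier M" and g: "g \<in> carrier M" and ne: "f \<otimes> g \<noteq> f"
  shows "right_ideal_size (f \<otimes> g) < right_ideal_size f"
  unfolding right_ideal_size_def
proof (rule psubset_card_mono)
  show "finite ((\<lambda>g. f \<otimes> g) ` carrier M)" using finite_carrier by simp
  have "(\<lambda>h. f \<otimes> g \<otimes> h) ` carrier M \<subseteq> (\<lambda>g. f \<otimes> g) ` carrier M"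
    using f g by (auto simp: m_assoc)
  moreover have "f \<in> (\<lambda>g. f \<otimes> g) ` carrier M"
    using f by (intro image_eqI[of _ _ \<one>]) auto
  moreover have "f \<notin> (\<lambda>h. f \<otimes> g \<otimes> h) ` carrier M"
  proof
    assume "f \<in> (\<lambda>h. f \<otimes> g \<otimes> h) ` carrier M"
    then obtain h where "h \<in> carrier M" "f \<otimes> g \<otimes> h = f" by force
    then show False using R_trivial[OF f g] ne by blast
  qed
  ultimately show "(\<lambda>h. f \<otimes> g \<otimes> h) ` carrier M \<subset> (\<lambda>g. f \<otimes> g) ` carrier M" by blast
qed

text \<open>By R-triviality, a product that absorbs into \<open>e\<close> does so factor by factor.  This makes
  \<open>e \<otimes> g = e\<close> a multiplicative condition on \<open>g\<close>.\<close>

lemma absorb_mult_iff: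
  assumes "e \<in> carrier M" "f \<in> carrier M" "g \<in> carrier M"
  shows "e \<otimes> (f \<otimes> g) = e \<longleftrightarrow> e \<otimes> f = e \<and> e \<otimes> g = e"
proof
  assume efg: "e \<otimes> (f \<otimes> g) = e"
  have ef: "e \<otimes> f = e"
    by (rule R_trivial[OF assms]) (use efg assms in \<open>simp add: m_assoc\<close>)
  moreover have "e \<otimes> f \<otimes> g = e" using efg assms by (simp add: m_assoc)
  ultimately show "e \<otimes> f = e \<and> e \<otimes> g = e" by simp
next
  assume "e \<otimes> f = e \<and> e \<otimes> g = e"
  then show "e \<otimes> (f \<otimes> g) = e" using assms by (simp flip: m_assoc)
qed

text \<open>Otherwise the right ideals generated by the powers of \<open>f\<close> would decrease strictly forever.\<close>

lemma exists_stable_power: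
  assumes f: "f \<in> carrier M"
  shows "\<exists>k::nat. 0 < k \<and> f [^] (k + 1) = f [^] k"
proof (rule ccontr)
  assume a: "\<not> ?thesis"
  have "right_ideal_size (f [^] Suc n) + n \<le> right_ideal_size (f [^] Suc 0)" for n
  proof (induction n)
    case (Suc n)
    have "f [^] (Suc n + 1) \<noteq> f [^] Suc n" using a by blast
    then have "f [^] Suc n \<otimes> f \<noteq> f [^] Suc n" by simp
    from right_ideal_size_less[OF nat_pow_closed[OF f] f this] Suc show ?case by simp
  qed simp
  from this[of "Suc (right_ideal_size (f [^] Suc 0))"] show False by simp
qed

lemma eventual_power:
  assumes f: "f \<in> carrier M"
  shows "eventual_power M f \<in> idempotents"
    and "e \<in> carrier M \<Longrightarrow> e \<otimes> eventual_power M f = e \<longleftrightarrow> e \<otimes> f = e"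
proof -
  let ?P = "\<lambda>k::nat. 0 < k \<and> f [^] (k + 1) = f [^] k"
  define k where "k = (LEAST k. ?P k)"
  have k: "0 < k" "f [^] (k + 1) = f [^] k"
    using LeastI_ex[of ?P] exists_stable_power[OF f] unfolding k_def by blast+
  have e: "eventual_power M f = f [^] k" by (simp add: eventual_power_def k_def)
  have "f [^] (k + n) = f [^] k" for n
  proof (induction n)
    case (Suc n)
    have "f [^] (k + Suc n) = f [^] (k + n) \<otimes> f" by simp
    also have "\<dots> = f [^] (k + 1)" using Suc by simp
    finally show ?case using k by simp
  qed simp
  then show "eventual_power M f \<in> idempotents"
    using f unfolding e idempotents_def by (simp add: nat_pow_mult)
  assume ec: "e \<in> carrier M"
  have "e \<otimes> f [^] Suc n = e \<longleftrightarrow> e \<otimes> f = e" for n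
    by (induction n) (use f ec in \<open>auto simp: absorb_mult_iff\<close>)
  then show "e \<otimes> eventual_power M f = e \<longleftrightarrow> e \<otimes> f = e"
    unfolding e using k(1) by (cases k) auto
qed

text \<open>The relation \<open>e \<otimes> f = e\<close> is a preorder on idempotents; L-triviality makes it a partial order.\<close>

lemma idempotent_antisym:
  assumes "e \<in> idempotents" "f \<in> carrier M" "e \<otimes> f = e" "f \<otimes> e = f"
  shows "e = f"
proof -
  have e: "e \<in> carrier M" "e \<otimes> e = e" using assms(1) by (simp_all add: idempotents_def)
  have "e \<otimes> f \<otimes> e = e" using assms(3) e(2) by simp
  from L_trivial[OF e(1) assms(2) e(1) this] assms(4) show ?thesis by simp
qed

end

section \<open>The radical of the algebra of a J-trivial monoid\<close>

context ring begin

lemma right_idealI: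
  assumes "J \<subseteq> carrier R" "\<zero> \<in> J" "\<And>x y. x \<in> J \<Longrightarrow> y \<in> J \<Longrightarrow> x \<oplus> y \<in> J"
    and mult: "\<And>x a. x \<in> J \<Longrightarrow> a \<in> carrier R \<Longrightarrow> x \<otimes> a \<in> J"
  shows "right_ideal J R"
proof -
  have "\<ominus> x \<in> J" if "x \<in> J" for x
    using mult[OF that, of "\<ominus> \<one>"] that assms(1) by (auto simp: r_minus)
  then have "additive_subgroup J R"
    using assms by (intro additive_subgroup.intro add.subgroupI) (auto simp: a_inv_def)
  then show ?thesis using mult by (simp add: right_ideal_def)
qed

lemma right_idealD:
  assumes "right_ideal J R"
  shows "J \<subseteq> carrier R" "\<zero> \<in> J" "\<And>x y. x \<in> J \<Longrightarrow> y \<in> J \<Longrightarrow> x \<oplus> y \<in> J"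
    "\<And>x a. x \<in> J \<Longrightarrow> a \<in> carrier R \<Longrightarrow> x \<otimes> a \<in> J"
proof -
  interpret additive_subgroup J R using assms by (simp add: right_ideal_def)
  show "J \<subseteq> carrier R" by (rule a_subset)
  show "\<zero> \<in> J" by (rule zero_closed)
  show "x \<oplus> y \<in> J" if "x \<in> J" "y \<in> J" for x y using that by (rule a_closed)
  show "x \<otimes> a \<in> J" if "x \<in> J" "a \<in> carrier R" for x a using assms that by (simp add: right_ideal_def)
qed

end

locale J_trivial_algebra = M: finite_J_trivial_monoid M + K: field K
  for M :: "('m, 'e) monoid_scheme" and K :: "('k, 'c) ring_scheme"

sublocale J_trivial_algebra \<subseteq> finite_monoid_algebra M K
  by unfold_locales (rule M.finite_carrier)

context J_trivial_algebra begin

text \<open>The indicator function of \<open>e \<otimes> g = e\<close>; for each \<open>e\<close> it is a character of \<open>M\<close> with values \<open>0\<close>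
  and \<open>1\<close>.\<close>

definition absorbs :: "'m \<Rightarrow> 'm \<Rightarrow> 'k" where
  "absorbs e g = ind (e \<otimes>\<^bsub>M\<^esub> g = e)"

lemma absorbs_in [simp]: "absorbs e g \<in> carrier K"
  by (simp add: absorbs_def)

lemma absorbs_closed [simp]: "functional (absorbs e)"
  by simp

lemma pair_absorbs_mult:
  assumes e: "e \<in> carrier M" and a: "a \<in> carrier A" and b: "b \<in> carrier A"
  shows "pair (a \<otimes>\<^bsub>A\<^esub> b) (absorbs e) = pair a (absorbs e) \<otimes>\<^bsub>K\<^esub> pair b (absorbs e)"
proof -
  have "pair (a \<otimes>\<^bsub>A\<^esub> b) (absorbs e) = pair a (\<lambda>x. pair b (\<lambda>y. absorbs e y \<otimes>\<^bsub>K\<^esub> absorbs e x))"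
    unfolding pair_mult[OF a b absorbs_closed]
    by (intro pair_cong) (use a b e in \<open>auto simp: absorbs_def M.absorb_mult_iff\<close>)
  also have "\<dots> = pair a (\<lambda>x. absorbs e x \<otimes>\<^bsub>K\<^esub> pair b (absorbs e))"
    by (intro pair_cong) (use a b e in \<open>auto simp: pair_functional_mult intro!: K.m_comm\<close>)
  also have "\<dots> = pair a (absorbs e) \<otimes>\<^bsub>K\<^esub> pair b (absorbs e)"
    by (rule pair_functional_mult) (use a b in auto)
  finally show ?thesis .
qed

lemma pair_absorbs_one: "e \<in> carrier M \<Longrightarrow> pair \<one>\<^bsub>A\<^esub> (absorbs e) = \<one>\<^bsub>K\<^esub>"
  by (simp add: one_eq pair_delta absorbs_def)

definition character_kernel where
  "character_kernel = {a \<in> carrier A. \<forall>e\<in>M.idempotents. pair a (absorbs e) = \<zero>\<^bsub>K\<^esub>}"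

lemma right_ideal_smult:
  assumes J: "right_ideal J A" and c: "c \<in> carrier K" and x: "x \<in> J" shows "c \<odot>\<^bsub>A\<^esub> x \<in> J"
proof -
  have xA: "x \<in> carrier A" using A.right_idealD(1)[OF J] x by blast
  have "c \<odot>\<^bsub>A\<^esub> x = x \<otimes>\<^bsub>A\<^esub> (c \<odot>\<^bsub>A\<^esub> \<one>\<^bsub>A\<^esub>)" using c xA by (simp add: smult_mult_right)
  then show ?thesis using A.right_idealD(4)[OF J x] c by simp
qed

text \<open>The kernel of a nonzero character has codimension one: an element \<open>x\<close> with nonzero value can be
  scaled to the value of any given \<open>a\<close>, and then \<open>a - c x\<close> lies in the kernel.\<close>

lemma absorbs_kernel_maximal:
  assumes e: "e \<in> carrier M"
  shows "maximal_right_ideal {a \<in> carrier A. pair a (absorbs e) = \<zero>\<^bsub>K\<^esub>} A" (is "maximal_right_ideal ?N A")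
  unfolding maximal_right_ideal_def
proof (intro conjI allI impI)
  show "right_ideal ?N A"
  proof (rule A.right_idealI)
    show "\<zero>\<^bsub>A\<^esub> \<in> ?N" by (simp add: pair_zero)
    show "x \<oplus>\<^bsub>A\<^esub> y \<in> ?N" if "x \<in> ?N" "y \<in> ?N" for x y using that by (simp add: pair_add)
    show "x \<otimes>\<^bsub>A\<^esub> a \<in> ?N" if "x \<in> ?N" "a \<in> carrier A" for x a
      using that by (simp add: pair_absorbs_mult[OF e])
  qed blast
  show "?N \<noteq> carrier A"
  proof
    assume "?N = carrier A"
    then have "pair \<one>\<^bsub>A\<^esub> (absorbs e) = \<zero>\<^bsub>K\<^esub>" using A.one_closed by blast
    then show False using pair_absorbs_one[OF e] by simp
  qed
  fix J assume J: "right_ideal J A \<and> ?N \<subseteq> J"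
  then have JA: "J \<subseteq> carrier A" using A.right_idealD(1) by blast
  show "J = ?N \<or> J = carrier A"
  proof (cases "J \<subseteq> ?N")
    case False
    then obtain x where x: "x \<in> J" "x \<in> carrier A" and nz: "pair x (absorbs e) \<noteq> \<zero>\<^bsub>K\<^esub>" using JA by blast
    let ?p = "\<lambda>a. pair a (absorbs e)"
    have pu: "?p x \<in> Units K" using nz x by (simp add: K.field_Units)
    have "a \<in> J" if a: "a \<in> carrier A" for a
    proof -
      define c where "c = ?p a \<otimes>\<^bsub>K\<^esub> inv\<^bsub>K\<^esub> ?p x"
      have c: "c \<in> carrier K" using a pu by (simp add: c_def)
      have "c \<otimes>\<^bsub>K\<^esub> ?p x = ?p a" using a x pu by (simp add: c_def K.m_assoc)
      then have "a \<ominus>\<^bsub>A\<^esub> c \<odot>\<^bsub>A\<^esub> x \<in> ?N"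
        using a x c by (simp add: pair_minus pair_smult K.r_neg K.minus_eq)
      then have "a \<ominus>\<^bsub>A\<^esub> c \<odot>\<^bsub>A\<^esub> x \<in> J" using J by blast
      moreover have "c \<odot>\<^bsub>A\<^esub> x \<in> J" using J c x right_ideal_smult by blast
      ultimately have "(a \<ominus>\<^bsub>A\<^esub> c \<odot>\<^bsub>A\<^esub> x) \<oplus>\<^bsub>A\<^esub> c \<odot>\<^bsub>A\<^esub> x \<in> J" using J A.right_idealD(3) by blast
      moreover have "(a \<ominus>\<^bsub>A\<^esub> c \<odot>\<^bsub>A\<^esub> x) \<oplus>\<^bsub>A\<^esub> c \<odot>\<^bsub>A\<^esub> x = a"
        using a c x by (simp add: A.minus_eq A.a_assoc A.l_neg)
      ultimately show ?thesis by simp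
    qed
    then show ?thesis using JA by blast
  qed (use J in blast)
qed

text \<open>If the monoid acts on \<open>v\<close> by the scalars \<open>\<chi>\<close> modulo the right ideal \<open>J\<close>, the algebra acts by the
  linear extension of \<open>\<chi>\<close>.\<close>

lemma scalar_action_mod:
  assumes J: "right_ideal J A" and v: "v \<in> carrier A" and \<chi>: "functional \<chi>"
    and act: "\<And>g. g \<in> carrier M \<Longrightarrow> \<exists>j\<in>J. v \<otimes>\<^bsub>A\<^esub> \<Delta> g = j \<oplus>\<^bsub>A\<^esub> \<chi> g \<odot>\<^bsub>A\<^esub> v"
    and b: "b \<in> carrier A"
  shows "\<exists>j\<in>J. v \<otimes>\<^bsub>A\<^esub> b = j \<oplus>\<^bsub>A\<^esub> pair b \<chi> \<odot>\<^bsub>A\<^esub> v"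
  using b
proof (induction b rule: algebra_induct)
  case zero
  have "v \<otimes>\<^bsub>A\<^esub> \<zero>\<^bsub>A\<^esub> = \<zero>\<^bsub>A\<^esub> \<oplus>\<^bsub>A\<^esub> pair \<zero>\<^bsub>A\<^esub> \<chi> \<odot>\<^bsub>A\<^esub> v"
    using v by (simp add: pair_zero[OF \<chi>])
  then show ?case using A.right_idealD(2)[OF J] by blast
next
  case (add a b)
  then obtain i j where i: "i \<in> J" "v \<otimes>\<^bsub>A\<^esub> a = i \<oplus>\<^bsub>A\<^esub> pair a \<chi> \<odot>\<^bsub>A\<^esub> v"
    and j: "j \<in> J" "v \<otimes>\<^bsub>A\<^esub> b = j \<oplus>\<^bsub>A\<^esub> pair b \<chi> \<odot>\<^bsub>A\<^esub> v" by blast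
  have c: "i \<in> carrier A" "j \<in> carrier A" using A.right_idealD(1)[OF J] i(1) j(1) by blast+
  have "v \<otimes>\<^bsub>A\<^esub> (a \<oplus>\<^bsub>A\<^esub> b) = (i \<oplus>\<^bsub>A\<^esub> j) \<oplus>\<^bsub>A\<^esub> pair (a \<oplus>\<^bsub>A\<^esub> b) \<chi> \<odot>\<^bsub>A\<^esub> v"
    using add i j c v \<chi> by (simp add: A.r_distr pair_add V.smult_l_distr A.a_ac)
  then show ?case using A.right_idealD(3)[OF J i(1) j(1)] by blast
next
  case (delta c f)
  obtain j where j: "j \<in> J" "v \<otimes>\<^bsub>A\<^esub> \<Delta> f = j \<oplus>\<^bsub>A\<^esub> \<chi> f \<odot>\<^bsub>A\<^esub> v" using act delta by blast
  have jc: "j \<in> carrier A" and \<chi>f: "\<chi> f \<in> carrier K" using A.right_idealD(1)[OF J] j(1) \<chi> delta by blast+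
  have "v \<otimes>\<^bsub>A\<^esub> (c \<odot>\<^bsub>A\<^esub> \<Delta> f) = c \<odot>\<^bsub>A\<^esub> j \<oplus>\<^bsub>A\<^esub> pair (c \<odot>\<^bsub>A\<^esub> \<Delta> f) \<chi> \<odot>\<^bsub>A\<^esub> v"
    using delta j jc \<chi>f v \<chi> by (simp add: smult_mult_right pair_smult pair_delta V.smult_r_distr V.smult_assoc1)
  then show ?case using right_ideal_smult[OF J delta(1) j(1)] by blast
qed

text \<open>Among the \<open>f\<close> with \<open>A f\<close> not contained in \<open>J\<close>, take one with the smallest right ideal \<open>f M\<close>, and
  \<open>v = a f\<close> outside \<open>J\<close>.  If \<open>f g = f\<close> then \<open>v g = v\<close>, and otherwise \<open>A f g\<close> lies in \<open>J\<close> by minimality.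
  So \<open>v\<close> is an eigenvector modulo \<open>J\<close> with character \<open>absorbs f\<close>, and \<open>J + K v\<close> is a right ideal,
  which equals \<open>A\<close> by maximality.  An element \<open>x\<close> of the common kernel sends \<open>v\<close> into \<open>J\<close>; writing
  \<open>1 = j + c v\<close> gives \<open>x = j x + c v x \<in> J\<close>.\<close>

lemma character_kernel_subset_maximal:
  assumes max: "maximal_right_ideal J A" and x: "x \<in> character_kernel"
  shows "x \<in> J"
proof -
  have J: "right_ideal J A" and JA: "J \<noteq> carrier A" and
    maxJ: "\<And>J'. right_ideal J' A \<Longrightarrow> J \<subseteq> J' \<Longrightarrow> J' = J \<or> J' = carrier A"
    using max unfolding maximal_right_ideal_def by blast+
  note Jsub = A.right_idealD(1)[OF J] and J0 = A.right_idealD(2)[OF J]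
    and Jadd = A.right_idealD(3)[OF J] and Jmult = A.right_idealD(4)[OF J]
  have xA: "x \<in> carrier A" using x by (simp add: character_kernel_def)
  let ?S = "\<lambda>f. f \<in> carrier M \<and> (\<exists>a\<in>carrier A. a \<otimes>\<^bsub>A\<^esub> \<Delta> f \<notin> J)"
  obtain a0 where a0: "a0 \<in> carrier A" "a0 \<notin> J" using JA Jsub by blast
  have "a0 \<otimes>\<^bsub>A\<^esub> \<Delta> \<one>\<^bsub>M\<^esub> = a0" using a0(1) by (simp add: one_eq[symmetric])
  then have "?S \<one>\<^bsub>M\<^esub>" using a0 by (intro conjI bexI[of _ a0]) simp_all
  then obtain f where f: "?S f" and least: "\<And>g. ?S g \<Longrightarrow> M.right_ideal_size f \<le> M.right_ideal_size g"
    using ex_has_least_nat[of ?S "\<one>\<^bsub>M\<^esub>" M.right_ideal_size] by blast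
  from f have fM: "f \<in> carrier M" by blast
  from f obtain a where a: "a \<in> carrier A" and vJ: "a \<otimes>\<^bsub>A\<^esub> \<Delta> f \<notin> J" by blast
  define v where "v = a \<otimes>\<^bsub>A\<^esub> \<Delta> f"
  have v: "v \<in> carrier A" "v \<notin> J" using a vJ by (auto simp: v_def)
  have kill: "b \<otimes>\<^bsub>A\<^esub> \<Delta> (f \<otimes>\<^bsub>M\<^esub> g) \<in> J" if "b \<in> carrier A" "g \<in> carrier M" "f \<otimes>\<^bsub>M\<^esub> g \<noteq> f" for b g
    using least[of "f \<otimes>\<^bsub>M\<^esub> g"] M.right_ideal_size_less[OF fM that(2,3)] that fM by fastforce
  have vg: "v \<otimes>\<^bsub>A\<^esub> \<Delta> g = a \<otimes>\<^bsub>A\<^esub> \<Delta> (f \<otimes>\<^bsub>M\<^esub> g)" if "g \<in> carrier M" for g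
    using a that fM by (simp add: v_def A.m_assoc delta_mult)
  have act: "\<exists>j\<in>J. v \<otimes>\<^bsub>A\<^esub> b = j \<oplus>\<^bsub>A\<^esub> pair b (absorbs f) \<odot>\<^bsub>A\<^esub> v" if "b \<in> carrier A" for b
  proof (rule scalar_action_mod[OF J v(1) absorbs_closed _ that])
    fix g assume g: "g \<in> carrier M"
    show "\<exists>j\<in>J. v \<otimes>\<^bsub>A\<^esub> \<Delta> g = j \<oplus>\<^bsub>A\<^esub> absorbs f g \<odot>\<^bsub>A\<^esub> v"
    proof (cases "f \<otimes>\<^bsub>M\<^esub> g = f")
      case True
      then show ?thesis using vg[OF g] J0 v by (intro bexI[of _ "\<zero>\<^bsub>A\<^esub>"]) (auto simp: absorbs_def simp flip: v_def)
    next
      case False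
      have "v \<otimes>\<^bsub>A\<^esub> \<Delta> g \<in> J" using kill[OF a g False] vg[OF g] by simp
      then show ?thesis using False v by (intro bexI[of _ "v \<otimes>\<^bsub>A\<^esub> \<Delta> g"]) (auto simp: absorbs_def)
    qed
  qed
  \<comment> \<open>the right ideal \<open>J + K v\<close>\<close>
  define J' where "J' = {j \<oplus>\<^bsub>A\<^esub> c \<odot>\<^bsub>A\<^esub> v | j c. j \<in> J \<and> c \<in> carrier K}"
  have J': "right_ideal J' A"
  proof (rule A.right_idealI)
    show "J' \<subseteq> carrier A" using Jsub v by (auto simp: J'_def)
    have "\<zero>\<^bsub>A\<^esub> = \<zero>\<^bsub>A\<^esub> \<oplus>\<^bsub>A\<^esub> \<zero>\<^bsub>K\<^esub> \<odot>\<^bsub>A\<^esub> v" using v by simp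
    then show "\<zero>\<^bsub>A\<^esub> \<in> J'" unfolding J'_def using J0 by blast
  next
    fix y z assume "y \<in> J'" "z \<in> J'"
    then obtain i c j d where y: "i \<in> J" "c \<in> carrier K" "y = i \<oplus>\<^bsub>A\<^esub> c \<odot>\<^bsub>A\<^esub> v"
      and z: "j \<in> J" "d \<in> carrier K" "z = j \<oplus>\<^bsub>A\<^esub> d \<odot>\<^bsub>A\<^esub> v" unfolding J'_def by blast
    have c: "i \<in> carrier A" "j \<in> carrier A" using Jsub y z by auto
    have "y \<oplus>\<^bsub>A\<^esub> z = (i \<oplus>\<^bsub>A\<^esub> j) \<oplus>\<^bsub>A\<^esub> (c \<oplus>\<^bsub>K\<^esub> d) \<odot>\<^bsub>A\<^esub> v"
      using y z c v by (simp add: V.smult_l_distr A.a_ac)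
    then show "y \<oplus>\<^bsub>A\<^esub> z \<in> J'" unfolding J'_def using Jadd y z by blast
  next
    fix y b assume "y \<in> J'" and b: "b \<in> carrier A"
    then obtain i c where y: "i \<in> J" "c \<in> carrier K" "y = i \<oplus>\<^bsub>A\<^esub> c \<odot>\<^bsub>A\<^esub> v" unfolding J'_def by blast
    obtain j where j: "j \<in> J" "v \<otimes>\<^bsub>A\<^esub> b = j \<oplus>\<^bsub>A\<^esub> pair b (absorbs f) \<odot>\<^bsub>A\<^esub> v" using act[OF b] by blast
    have c: "i \<in> carrier A" "j \<in> carrier A" using Jsub y j by auto
    have "y \<otimes>\<^bsub>A\<^esub> b = (i \<otimes>\<^bsub>A\<^esub> b \<oplus>\<^bsub>A\<^esub> c \<odot>\<^bsub>A\<^esub> j) \<oplus>\<^bsub>A\<^esub> (c \<otimes>\<^bsub>K\<^esub> pair b (absorbs f)) \<odot>\<^bsub>A\<^esub> v"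
      using y j c v b
      by (simp add: A.l_distr smult_mult_left V.smult_r_distr V.smult_assoc1 A.a_assoc)
    moreover have "i \<otimes>\<^bsub>A\<^esub> b \<oplus>\<^bsub>A\<^esub> c \<odot>\<^bsub>A\<^esub> j \<in> J"
      using Jadd Jmult right_ideal_smult[OF J] y j b by blast
    moreover have "c \<otimes>\<^bsub>K\<^esub> pair b (absorbs f) \<in> carrier K" using y b by simp
    ultimately show "y \<otimes>\<^bsub>A\<^esub> b \<in> J'" unfolding J'_def by blast
  qed
  have "J \<subseteq> J'"
  proof
    fix y assume y: "y \<in> J"
    then have "y = y \<oplus>\<^bsub>A\<^esub> \<zero>\<^bsub>K\<^esub> \<odot>\<^bsub>A\<^esub> v" using v Jsub by auto
    then show "y \<in> J'" unfolding J'_def using y by blast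
  qed
  moreover have "v \<in> J'"
  proof -
    have "v = \<zero>\<^bsub>A\<^esub> \<oplus>\<^bsub>A\<^esub> \<one>\<^bsub>K\<^esub> \<odot>\<^bsub>A\<^esub> v" using v by simp
    then show ?thesis unfolding J'_def using J0 by blast
  qed
  ultimately have J'A: "J' = carrier A" using maxJ[OF J'] v by blast
  \<comment> \<open>otherwise \<open>v f\<close> would lie in \<open>J\<close>, and so would \<open>A f = (J + K v) f\<close>, which contains \<open>v\<close>\<close>
  have "f \<otimes>\<^bsub>M\<^esub> f = f"
  proof (rule ccontr)
    assume ff: "f \<otimes>\<^bsub>M\<^esub> f \<noteq> f"
    obtain j d where j: "j \<in> J" "d \<in> carrier K" "a = j \<oplus>\<^bsub>A\<^esub> d \<odot>\<^bsub>A\<^esub> v"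
      using J'A a unfolding J'_def by blast
    have "v \<otimes>\<^bsub>A\<^esub> \<Delta> f \<in> J" using vg[OF fM] kill[OF a fM ff] by simp
    then have "j \<otimes>\<^bsub>A\<^esub> \<Delta> f \<oplus>\<^bsub>A\<^esub> d \<odot>\<^bsub>A\<^esub> (v \<otimes>\<^bsub>A\<^esub> \<Delta> f) \<in> J"
      using Jadd Jmult right_ideal_smult[OF J] j by simp
    moreover have "j \<otimes>\<^bsub>A\<^esub> \<Delta> f \<oplus>\<^bsub>A\<^esub> d \<odot>\<^bsub>A\<^esub> (v \<otimes>\<^bsub>A\<^esub> \<Delta> f) = a \<otimes>\<^bsub>A\<^esub> \<Delta> f"
      unfolding j(3) using j(1,2) Jsub v by (subst A.l_distr) (auto simp: smult_mult_left)
    ultimately show False using v(2) by (simp add: v_def)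
  qed
  then have "pair x (absorbs f) = \<zero>\<^bsub>K\<^esub>" using x fM unfolding character_kernel_def M.idempotents_def by blast
  then obtain i where i: "i \<in> J" "v \<otimes>\<^bsub>A\<^esub> x = i \<oplus>\<^bsub>A\<^esub> \<zero>\<^bsub>K\<^esub> \<odot>\<^bsub>A\<^esub> v" using act[OF xA] by auto
  have vx: "v \<otimes>\<^bsub>A\<^esub> x \<in> J" using i v Jsub by auto
  obtain j c where j: "j \<in> J" "c \<in> carrier K" "\<one>\<^bsub>A\<^esub> = j \<oplus>\<^bsub>A\<^esub> c \<odot>\<^bsub>A\<^esub> v"
    using J'A A.one_closed unfolding J'_def by blast
  have "x = (j \<oplus>\<^bsub>A\<^esub> c \<odot>\<^bsub>A\<^esub> v) \<otimes>\<^bsub>A\<^esub> x" unfolding j(3)[symmetric] using xA by simp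
  also have "\<dots> = j \<otimes>\<^bsub>A\<^esub> x \<oplus>\<^bsub>A\<^esub> c \<odot>\<^bsub>A\<^esub> (v \<otimes>\<^bsub>A\<^esub> x)"
    using j(1,2) Jsub v xA by (subst A.l_distr) (auto simp: smult_mult_left)
  finally have "x = j \<otimes>\<^bsub>A\<^esub> x \<oplus>\<^bsub>A\<^esub> c \<odot>\<^bsub>A\<^esub> (v \<otimes>\<^bsub>A\<^esub> x)" .
  moreover have "j \<otimes>\<^bsub>A\<^esub> x \<oplus>\<^bsub>A\<^esub> c \<odot>\<^bsub>A\<^esub> (v \<otimes>\<^bsub>A\<^esub> x) \<in> J"
    by (rule Jadd[OF Jmult[OF j(1) xA] right_ideal_smult[OF J j(2) vx]])
  ultimately show ?thesis by simp
qed

theorem jacobson_radical_eq: "jacobson_radical A = character_kernel"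
proof
  show "jacobson_radical A \<subseteq> character_kernel"
  proof
    fix x assume x: "x \<in> jacobson_radical A"
    have "pair x (absorbs e) = \<zero>\<^bsub>K\<^esub>" if "e \<in> carrier M" for e
      using x absorbs_kernel_maximal[OF that] unfolding jacobson_radical_def by blast
    then show "x \<in> character_kernel" using x unfolding character_kernel_def M.idempotents_def jacobson_radical_def by blast
  qed
  show "character_kernel \<subseteq> jacobson_radical A"
    using character_kernel_subset_maximal unfolding jacobson_radical_def character_kernel_def by blast
qed

lemma character_kernel_ideal: "ideal character_kernel A"
proof (rule idealI)
  have "right_ideal character_kernel A"
  proof (rule A.right_idealI)
    show "\<zero>\<^bsub>A\<^esub> \<in> character_kernel" by (simp add: character_kernel_def pair_zero)
    show "x \<oplus>\<^bsub>A\<^esub> y \<in> character_kernel" if "x \<in> character_kernel" "y \<in> character_kernel" for x y using that by (simp add: character_kernel_def pair_add)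
    show "x \<otimes>\<^bsub>A\<^esub> a \<in> character_kernel" if "x \<in> character_kernel" "a \<in> carrier A" for x a
      using that by (simp add: character_kernel_def M.idempotents_def pair_absorbs_mult)
  qed (auto simp: character_kernel_def)
  then show "subgroup character_kernel (add_monoid A)"
    unfolding right_ideal_def additive_subgroup_def by blast
  fix a x assume "a \<in> character_kernel" "x \<in> carrier A"
  then show "x \<otimes>\<^bsub>A\<^esub> a \<in> character_kernel" "a \<otimes>\<^bsub>A\<^esub> x \<in> character_kernel"
    by (simp_all add: character_kernel_def M.idempotents_def pair_absorbs_mult)
qed (rule A.ring_axioms)

lemma quotient_character_kernel_cring: "cring (A Quot character_kernel)"
proof -
  interpret I: ideal character_kernel A by (rule character_kernel_ideal)
  show ?thesis
  proof (intro cring.intro comm_monoid.intro comm_monoid_axioms.intro I.quotient_is_ring)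
    show "Group.monoid (A Quot character_kernel)" using I.quotient_is_ring by (rule ring.is_monoid)
    fix X Y assume "X \<in> carrier (A Quot character_kernel)" "Y \<in> carrier (A Quot character_kernel)"
    then have "X \<in> a_rcosets\<^bsub>A\<^esub> character_kernel" "Y \<in> a_rcosets\<^bsub>A\<^esub> character_kernel" unfolding FactRing_def by simp_all
    then obtain x y where x: "x \<in> carrier A" "X = character_kernel +>\<^bsub>A\<^esub> x" and y: "y \<in> carrier A" "Y = character_kernel +>\<^bsub>A\<^esub> y"
      unfolding A_RCOSETS_def' a_r_coset_def' by blast
    have "x \<otimes>\<^bsub>A\<^esub> y \<ominus>\<^bsub>A\<^esub> y \<otimes>\<^bsub>A\<^esub> x \<in> character_kernel"
    proof -
      have "pair (x \<otimes>\<^bsub>A\<^esub> y \<ominus>\<^bsub>A\<^esub> y \<otimes>\<^bsub>A\<^esub> x) (absorbs e) = \<zero>\<^bsub>K\<^esub>" if "e \<in> carrier M" for e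
        using x(1) y(1) that K.m_comm[of "pair x (absorbs e)" "pair y (absorbs e)"]
        by (simp add: pair_minus pair_absorbs_mult K.r_neg K.minus_eq)
      moreover have "x \<otimes>\<^bsub>A\<^esub> y \<ominus>\<^bsub>A\<^esub> y \<otimes>\<^bsub>A\<^esub> x \<in> carrier A"
        by (rule A.minus_closed) (use x(1) y(1) in \<open>blast intro: A.m_closed\<close>)+
      ultimately show ?thesis unfolding character_kernel_def M.idempotents_def by blast
    qed
    then have "character_kernel +>\<^bsub>A\<^esub> (x \<otimes>\<^bsub>A\<^esub> y) = character_kernel +>\<^bsub>A\<^esub> (y \<otimes>\<^bsub>A\<^esub> x)"
      using A.quotient_eq_iff_same_a_r_cos[OF character_kernel_ideal A.m_closed[OF x(1) y(1)] A.m_closed[OF y(1) x(1)]]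
      by blast
    then show "X \<otimes>\<^bsub>A Quot character_kernel\<^esub> Y = Y \<otimes>\<^bsub>A Quot character_kernel\<^esub> X"
      unfolding x(2) y(2) FactRing_def
      using I.rcoset_mult_add[OF x(1) y(1)] I.rcoset_mult_add[OF y(1) x(1)] by simp
  qed
qed

end

section \<open>A basis of the radical\<close>

context J_trivial_algebra begin

abbreviation radical_vector :: "'m \<Rightarrow> 'm \<Rightarrow> 'k" where
  "radical_vector f \<equiv> \<Delta> (eventual_power M f) \<ominus>\<^bsub>A\<^esub> \<Delta> f"

lemma nonidempotents_closed: "f \<in> nonidempotents M \<Longrightarrow> f \<in> carrier M"
  by (simp add: nonidempotents_def)

lemma eventual_power_closed: "f \<in> carrier M \<Longrightarrow> eventual_power M f \<in> carrier M"
  using M.eventual_power(1) by (simp add: M.idempotents_def)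

text \<open>The power \<open>f\<^sup>\<infinity>\<close> is idempotent, so on nonidempotents the difference \<open>f\<^sup>\<infinity> - f\<close> is \<open>-f\<close>.\<close>

lemma radical_vector_apply:
  assumes f: "f \<in> nonidempotents M" and g: "g \<in> nonidempotents M"
  shows "radical_vector f g = (if f = g then \<ominus>\<^bsub>K\<^esub> \<one>\<^bsub>K\<^esub> else \<zero>\<^bsub>K\<^esub>)"
proof -
  have fg: "f \<in> carrier M" "g \<in> carrier M" using f g nonidempotents_closed by blast+
  have ne: "g \<noteq> eventual_power M f"
    using g M.eventual_power(1)[OF fg(1)] by (auto simp: nonidempotents_def M.idempotents_def)
  have "radical_vector f g = \<Delta> (eventual_power M f) g \<ominus>\<^bsub>K\<^esub> \<Delta> f g"
    by (rule minus_apply) (use fg in simp_all)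
  then show ?thesis using fg(2) ne by (simp add: delta_apply K.minus_eq)
qed

lemma radical_vector_in_kernel:
  assumes f: "f \<in> carrier M" shows "radical_vector f \<in> character_kernel"
proof -
  have "pair (radical_vector f) (absorbs e) = \<zero>\<^bsub>K\<^esub>" if e: "e \<in> carrier M" for e
  proof -
    have "pair (radical_vector f) (absorbs e) = absorbs e (eventual_power M f) \<ominus>\<^bsub>K\<^esub> absorbs e f"
      using f eventual_power_closed[OF f] by (simp add: pair_minus pair_delta)
    also have "absorbs e (eventual_power M f) = absorbs e f"
      using M.eventual_power(2)[OF f e] by (simp add: absorbs_def)
    finally show ?thesis by (simp add: K.r_neg K.minus_eq)
  qed
  then show ?thesis unfolding character_kernel_def M.idempotents_def using A.minus_closed[OF delta_closed delta_closed] by blast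
qed

lemma radical_vector_inj: "inj_on radical_vector (nonidempotents M)"
proof (rule inj_onI, rule ccontr)
  fix f g assume fg: "f \<in> nonidempotents M" "g \<in> nonidempotents M" "radical_vector f = radical_vector g" "f \<noteq> g"
  then have "\<ominus>\<^bsub>K\<^esub> \<one>\<^bsub>K\<^esub> = \<zero>\<^bsub>K\<^esub>"
    using radical_vector_apply[of f f] radical_vector_apply[of g f] by simp
  then have "\<one>\<^bsub>K\<^esub> = \<zero>\<^bsub>K\<^esub>" using K.minus_minus[OF K.one_closed] K.minus_zero by simp
  then show False by simp
qed

lemma finsum_apply:
  assumes "F \<in> S \<rightarrow> carrier A" "x \<in> carrier M"
  shows "(\<Oplus>\<^bsub>A\<^esub>i\<in>S. F i) x = (\<Oplus>\<^bsub>K\<^esub>i\<in>S. F i x)"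
  using assms(1)
proof (induction S rule: infinite_finite_induct)
  case (infinite S)
  then show ?case using assms(2) by (simp add: A.finsum_infinite K.finsum_infinite zero_apply)
next
  case empty
  then show ?case using assms(2) by (simp add: A.finsum_empty K.finsum_empty zero_apply)
next
  case (insert i S)
  have F: "F i \<in> carrier A" "F \<in> S \<rightarrow> carrier A" using insert.prems by auto
  have "(\<Oplus>\<^bsub>A\<^esub>i\<in>insert i S. F i) = F i \<oplus>\<^bsub>A\<^esub> (\<Oplus>\<^bsub>A\<^esub>i\<in>S. F i)"
    using insert.hyps F by (intro A.finsum_insert)
  moreover have "(\<Oplus>\<^bsub>K\<^esub>i\<in>insert i S. F i x) = F i x \<oplus>\<^bsub>K\<^esub> (\<Oplus>\<^bsub>K\<^esub>i\<in>S. F i x)"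
    using insert.hyps F assms(2) by (intro K.finsum_insert) (auto simp: Pi_iff)
  ultimately show ?case using insert.IH[OF F(2)] assms(2) by (simp add: add_apply)
qed

lemma lincomb_radical_vector_apply:
  assumes a: "a \<in> radical_vector ` nonidempotents M \<rightarrow> carrier K" and f: "f \<in> nonidempotents M"
  shows "V.lincomb a (radical_vector ` nonidempotents M) f = \<ominus>\<^bsub>K\<^esub> a (radical_vector f)"
proof -
  let ?B = "radical_vector ` nonidempotents M"
  have fM: "f \<in> carrier M" using f by (rule nonidempotents_closed)
  have B: "?B \<subseteq> carrier A" by (auto intro: A.minus_closed)
  have finB: "finite ?B" using finite_monoid by (simp add: nonidempotents_def)
  have aK: "a v \<in> carrier K" if "v \<in> ?B" for v using a that by blast
  have "V.lincomb a ?B f = (\<Oplus>\<^bsub>K\<^esub>v\<in>?B. (a v \<odot>\<^bsub>A\<^esub> v) f)"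
    unfolding V.lincomb_def by (rule finsum_apply) (use a B fM in auto)
  also have "\<dots> = (\<Oplus>\<^bsub>K\<^esub>v\<in>?B. if radical_vector f = v then \<ominus>\<^bsub>K\<^esub> a v else \<zero>\<^bsub>K\<^esub>)"
  proof (rule K.finsum_cong')
    fix v assume v: "v \<in> ?B"
    then obtain g where g: "g \<in> nonidempotents M" "v = radical_vector g" by blast
    have av: "a v \<in> carrier K" using aK v by blast
    have "radical_vector f = v \<longleftrightarrow> f = g" using radical_vector_inj f g by (auto dest: inj_onD)
    moreover have "v f = (if g = f then \<ominus>\<^bsub>K\<^esub> \<one>\<^bsub>K\<^esub> else \<zero>\<^bsub>K\<^esub>)"
      unfolding g(2) by (rule radical_vector_apply[OF g(1) f])
    ultimately show "(a v \<odot>\<^bsub>A\<^esub> v) f = (if radical_vector f = v then \<ominus>\<^bsub>K\<^esub> a v else \<zero>\<^bsub>K\<^esub>)"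
      using fM av by (simp add: smult_apply K.r_minus)
  qed (use aK in \<open>auto simp del: image_iff\<close>)
  also have "\<dots> = \<ominus>\<^bsub>K\<^esub> a (radical_vector f)"
    by (rule K.finsum_singleton) (use a f finB in auto)
  finally show ?thesis .
qed

text \<open>Order the idempotents by \<open>e \<le> f\<close> if \<open>e f = e\<close>, and let \<open>e\<close> be a maximal idempotent in the support
  of \<open>y\<close>; the size of the set of idempotents above it serves to find one.  In the value of
  \<open>absorbs e\<close> at \<open>y\<close> the terms with \<open>x > e\<close> vanish by maximality, which leaves \<open>y e\<close>.\<close>

lemma character_kernel_supported_on_idempotents:
  assumes y: "y \<in> character_kernel" and supp: "\<And>f. f \<in> nonidempotents M \<Longrightarrow> y f = \<zero>\<^bsub>K\<^esub>"
  shows "y = \<zero>\<^bsub>A\<^esub>"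
proof (rule ccontr)
  assume ne: "y \<noteq> \<zero>\<^bsub>A\<^esub>"
  have yA: "y \<in> carrier A" using y by (simp add: character_kernel_def)
  let ?U = "\<lambda>e. e \<in> M.idempotents \<and> y e \<noteq> \<zero>\<^bsub>K\<^esub>"
  have "\<exists>x\<in>carrier M. y x \<noteq> \<zero>\<^bsub>K\<^esub>"
    using algebra_eqI[OF yA zero_closed] ne by (auto simp: zero_apply)
  then have "\<exists>e. ?U e"
    using supp unfolding nonidempotents_def M.idempotents_def by blast
  define up where "up e = {f \<in> M.idempotents. e \<otimes>\<^bsub>M\<^esub> f = e}" for e
  have fin: "finite (up e)" for e using finite_monoid by (simp add: up_def M.idempotents_def)
  obtain e where e: "?U e" and least: "\<And>f. ?U f \<Longrightarrow> card (up e) \<le> card (up f)"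
    using ex_has_least_nat[of ?U _ "\<lambda>e. card (up e)"] \<open>\<exists>e. ?U e\<close> by blast
  have ec: "e \<in> carrier M" "e \<otimes>\<^bsub>M\<^esub> e = e" using e by (auto simp: M.idempotents_def)
  have zero: "y x = \<zero>\<^bsub>K\<^esub>" if x: "x \<in> carrier M" "e \<otimes>\<^bsub>M\<^esub> x = e" "x \<noteq> e" for x
  proof (cases "x \<in> M.idempotents")
    case True
    have "up x \<subseteq> up e"
    proof
      fix u assume u: "u \<in> up x"
      then have uM: "u \<in> carrier M" and xu: "x \<otimes>\<^bsub>M\<^esub> u = x" by (auto simp: up_def M.idempotents_def)
      have "e \<otimes>\<^bsub>M\<^esub> u = e \<otimes>\<^bsub>M\<^esub> x \<otimes>\<^bsub>M\<^esub> u" using x(2) by simp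
      also have "\<dots> = e" using M.m_assoc[OF ec(1) x(1) uM] xu x(2) by simp
      finally show "u \<in> up e" using u by (simp add: up_def)
    qed
    moreover have "e \<in> up e" using e ec by (simp add: up_def)
    moreover have "e \<notin> up x"
      using M.idempotent_antisym[of e x] e x by (auto simp: up_def)
    ultimately have "card (up x) < card (up e)" by (intro psubset_card_mono fin) blast
    then show ?thesis using least[of x] True by auto
  next
    case False
    then show ?thesis using supp[of x] x(1) by (auto simp: nonidempotents_def M.idempotents_def)
  qed
  have "pair y (absorbs e) = (\<Oplus>\<^bsub>K\<^esub>x\<in>carrier M. if e = x then y x else \<zero>\<^bsub>K\<^esub>)"
    unfolding pair_def
    by (rule K.finsum_cong') (use yA zero ec in \<open>auto simp: absorbs_def\<close>)
  also have "\<dots> = y e" by (rule K.finsum_singleton) (use yA ec finite_monoid in auto)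
  finally show False using e y by (simp add: character_kernel_def)
qed

lemma character_kernel_submodule: "submodule K character_kernel A"
proof (rule submodule.intro)
  show "module K A" by (rule algebra_module)
  show "character_kernel \<subseteq> carrier A" by (auto simp: character_kernel_def)
  show "\<zero>\<^bsub>A\<^esub> \<in> character_kernel" using zero_closed by (simp add: character_kernel_def pair_zero)
  show "v \<oplus>\<^bsub>A\<^esub> w \<in> character_kernel" if "v \<in> character_kernel" "w \<in> character_kernel" for v w using that by (simp add: character_kernel_def pair_add)
  show "c \<odot>\<^bsub>A\<^esub> v \<in> character_kernel" if "c \<in> carrier K" "v \<in> character_kernel" for c v using that by (simp add: character_kernel_def pair_smult)
qed

text \<open>On a nonidempotent \<open>f\<close>, a combination of the vectors \<open>f\<^sup>\<infinity> - f\<close> takes minus the coefficient of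
  \<open>f\<^sup>\<infinity> - f\<close>.  This gives independence.  For generation, subtract from \<open>x\<close> the combination with the
  coefficients \<open>- x f\<close>; what remains is supported on idempotents.\<close>

theorem character_kernel_basis: "vectorspace.basis K (A\<lparr>carrier := character_kernel\<rparr>) (radical_vector ` nonidempotents M)"
proof -
  let ?B = "radical_vector ` nonidempotents M"
  have vs: "vectorspace K (A\<lparr>carrier := character_kernel\<rparr>)"
    by (rule V.subspace_is_vs) (intro subspace.intro character_kernel_submodule V.vectorspace_axioms)
  have Brad: "?B \<subseteq> character_kernel" using radical_vector_in_kernel nonidempotents_closed by blast
  have BA: "?B \<subseteq> carrier A" using Brad by (auto simp: character_kernel_def)
  have finB: "finite ?B" using finite_monoid by (simp add: nonidempotents_def)
  have "V.lin_indpt ?B"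
  proof (rule V.finite_lin_indpt2[OF finB BA])
    fix a assume a: "a \<in> ?B \<rightarrow> carrier K" and z: "V.lincomb a ?B = \<zero>\<^bsub>A\<^esub>"
    have "a (radical_vector f) = \<zero>\<^bsub>K\<^esub>" if f: "f \<in> nonidempotents M" for f
    proof -
      have af: "a (radical_vector f) \<in> carrier K" using a f by blast
      have "\<ominus>\<^bsub>K\<^esub> a (radical_vector f) = \<zero>\<^bsub>K\<^esub>"
        using lincomb_radical_vector_apply[OF a f] z nonidempotents_closed[OF f] by (simp add: zero_apply)
      then show ?thesis using K.minus_minus[OF af] K.minus_zero by simp
    qed
    then show "\<forall>v\<in>?B. a v = \<zero>\<^bsub>K\<^esub>" by blast
  qed
  moreover have "character_kernel \<subseteq> V.span ?B"
  proof
    fix x assume x: "x \<in> character_kernel"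
    then have xA: "x \<in> carrier A" by (simp add: character_kernel_def)
    define a where "a v = \<ominus>\<^bsub>K\<^esub> x (inv_into (nonidempotents M) radical_vector v)" for v
    have af: "a (radical_vector f) = \<ominus>\<^bsub>K\<^esub> x f" if "f \<in> nonidempotents M" for f
      using inv_into_f_f[OF radical_vector_inj that] by (simp add: a_def)
    have a: "a \<in> ?B \<rightarrow> carrier K"
    proof
      fix v assume "v \<in> ?B"
      then obtain f where f: "f \<in> nonidempotents M" "v = radical_vector f" by blast
      show "a v \<in> carrier K" unfolding f(2) af[OF f(1)] using xA nonidempotents_closed[OF f(1)] by simp
    qed
    let ?l = "V.lincomb a ?B"
    have lspan: "?l \<in> V.span ?B" unfolding V.span_def using finB a by blast
    have lrad: "?l \<in> character_kernel"
      using V.span_is_subset[OF Brad character_kernel_submodule] lspan by blast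
    have lA: "?l \<in> carrier A" using lrad by (simp add: character_kernel_def)
    have "x \<ominus>\<^bsub>A\<^esub> ?l = \<zero>\<^bsub>A\<^esub>"
    proof (rule character_kernel_supported_on_idempotents)
      have "pair (x \<ominus>\<^bsub>A\<^esub> ?l) (absorbs e) = \<zero>\<^bsub>K\<^esub>" if "e \<in> M.idempotents" for e
      proof -
        have "pair x (absorbs e) = \<zero>\<^bsub>K\<^esub>" "pair ?l (absorbs e) = \<zero>\<^bsub>K\<^esub>"
          using x lrad that by (simp_all add: character_kernel_def)
        then show ?thesis using pair_minus[OF xA lA absorbs_closed] by (simp add: K.minus_eq)
      qed
      then show "x \<ominus>\<^bsub>A\<^esub> ?l \<in> character_kernel" unfolding character_kernel_def using A.minus_closed[OF xA lA] by blast
      fix f assume f: "f \<in> nonidempotents M"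
      then have fM: "f \<in> carrier M" by (rule nonidempotents_closed)
      have xf: "x f \<in> carrier K" using xA fM by simp
      have "?l f = x f"
        unfolding lincomb_radical_vector_apply[OF a f] af[OF f] using xf by simp
      then show "(x \<ominus>\<^bsub>A\<^esub> ?l) f = \<zero>\<^bsub>K\<^esub>"
        using minus_apply[OF xA lA fM] xf by (simp add: K.r_neg K.minus_eq)
    qed
    then have "x = ?l" using xA lA by simp
    then show "x \<in> V.span ?B" using lspan by simp
  qed
  ultimately show ?thesis
    using V.span_li_not_depend[OF Brad character_kernel_submodule] V.span_is_subset[OF Brad character_kernel_submodule] Brad
    unfolding vectorspace.basis_def[OF vs] by auto
qed

end

section \<open>Simple modules\<close>

lemma line_simps [simp]:
  "carrier (line K) = carrier K" "\<zero>\<^bsub>line K\<^esub> = \<zero>\<^bsub>K\<^esub>" "x \<oplus>\<^bsub>line K\<^esub> y = x \<oplus>\<^bsub>K\<^esub> y" "x \<odot>\<^bsub>line K\<^esub> y = x \<otimes>\<^bsub>K\<^esub> y"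
  by (simp_all add: line_def)

text \<open>With \<open>\<chi>\<close> the property of fixing \<open>w\<close>, these are the modules \<open>S\<^sub>w\<close>; with \<open>\<chi> g\<close> given by \<open>e g = e\<close>, they
  are the simple modules of a J-trivial monoid.  Both families are treated as one-dimensional modules
  with a multiplicative \<open>\<chi>\<close>.\<close>

definition character_act :: "('k, 'c) ring_scheme \<Rightarrow> ('m \<Rightarrow> bool) \<Rightarrow> 'k \<Rightarrow> 'm \<Rightarrow> 'k" where
  "character_act K \<chi> c f = (if \<chi> f then c else \<zero>\<^bsub>K\<^esub>)"

lemma S_act_eq: "S_act K w = character_act K (\<lambda>f. f w = w)"
  by (simp add: S_act_def character_act_def fun_eq_iff)

lemma (in vectorspace) smult_zero_imp_zero:
  assumes c: "c \<in> carrier K" and u: "u \<in> carrier V" "u \<noteq> \<zero>\<^bsub>V\<^esub>" and z: "c \<odot>\<^bsub>V\<^esub> u = \<zero>\<^bsub>V\<^esub>"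
  shows "c = \<zero>\<^bsub>K\<^esub>"
proof (rule ccontr)
  assume "c \<noteq> \<zero>\<^bsub>K\<^esub>"
  then have un: "c \<in> Units K" using c by (simp add: field_Units)
  then have ic: "inv\<^bsub>K\<^esub> c \<in> carrier K" by simp
  have "\<one>\<^bsub>K\<^esub> \<odot>\<^bsub>V\<^esub> u = inv\<^bsub>K\<^esub> c \<odot>\<^bsub>V\<^esub> (c \<odot>\<^bsub>V\<^esub> u)"
    using smult_assoc1[OF ic c u(1)] un by simp
  also have "\<dots> = \<zero>\<^bsub>V\<^esub>" unfolding z using ic by simp
  finally show False using u by simp
qed

context field begin

lemma line_vectorspace: "vectorspace R (line R)"
proof -
  have "abelian_group (line R)"
    by (rule abelian_groupI) (auto simp: a_ac intro: l_neg)
  then have "module R (line R)"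
    by (intro moduleI is_cring) (auto simp: l_distr r_distr m_assoc)
  then show ?thesis by (simp add: vectorspace_def field_axioms)
qed

lemma character_module_simple:
  assumes one: "\<chi> \<one>\<^bsub>M\<^esub>"
    and mult: "\<And>f g. f \<in> carrier M \<Longrightarrow> g \<in> carrier M \<Longrightarrow> \<chi> (f \<otimes>\<^bsub>M\<^esub> g) \<longleftrightarrow> \<chi> f \<and> \<chi> g"
  shows "simple_right_monoid_module R M (line R) (character_act R \<chi>)"
  unfolding simple_right_monoid_module_def
proof (intro conjI allI impI)
  show "right_monoid_module R M (line R) (character_act R \<chi>)"
  proof (rule right_monoid_module.intro[OF line_vectorspace right_monoid_module_axioms.intro])
    fix f assume "f \<in> carrier M"
    show "(\<lambda>v. character_act R \<chi> v f) \<in> module_hom R (line R) (line R)"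
      unfolding module_hom_def by (cases "\<chi> f") (simp_all add: character_act_def)
  next
    fix f g v assume "f \<in> carrier M" "g \<in> carrier M" "v \<in> carrier (line R)"
    then show "character_act R \<chi> v (f \<otimes>\<^bsub>M\<^esub> g) = character_act R \<chi> (character_act R \<chi> v f) g"
      by (simp add: character_act_def mult)
  qed (simp add: character_act_def one)
  show "carrier (line R) \<noteq> {\<zero>\<^bsub>line R\<^esub>}"
  proof
    assume "carrier (line R) = {\<zero>\<^bsub>line R\<^esub>}"
    then have "\<one> \<in> {\<zero>}" using one_closed by simp
    then show False by simp
  qed
  fix U assume U: "subspace R U (line R) \<and> (\<forall>v\<in>U. \<forall>f\<in>carrier M. character_act R \<chi> v f \<in> U)"
  then interpret U: submodule R U "line R" by (simp add: subspace_def)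
  show "U = {\<zero>\<^bsub>line R\<^esub>} \<or> U = carrier (line R)"
  proof (cases "U \<subseteq> {\<zero>}")
    case True
    then show ?thesis using U.zero_closed by auto
  next
    case False
    then obtain u where u: "u \<in> U" "u \<noteq> \<zero>" by blast
    then have uR: "u \<in> Units R" using U.subset by (auto simp: field_Units)
    have "c \<in> U" if "c \<in> carrier R" for c
    proof -
      have "(c \<otimes> inv u) \<odot>\<^bsub>line R\<^esub> u \<in> U" by (rule U.smult_closed) (use u uR that in auto)
      moreover have "c \<otimes> inv u \<otimes> u = c" using m_assoc[of c "inv u" u] uR that Units_closed[OF uR] by simp
      ultimately show ?thesis by simp
    qed
    then show ?thesis using U.subset by auto
  qed
qed

text \<open>An element acts as the identity or as zero on either module, and an isomorphism respects
  this alternative.\<close>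

lemma isomorphic_character_modules:
  assumes iso: "isomorphic_right_monoid_modules R M (line R) (character_act R \<chi>) (line R) (character_act R \<psi>)"
    and f: "f \<in> carrier M"
  shows "\<chi> f \<longleftrightarrow> \<psi> f"
proof -
  obtain \<phi> where hom: "\<phi> \<in> module_hom R (line R) (line R)" and bij: "bij_betw \<phi> (carrier R) (carrier R)"
    and act: "\<And>v f. v \<in> carrier R \<Longrightarrow> f \<in> carrier M \<Longrightarrow> \<phi> (character_act R \<chi> v f) = character_act R \<psi> (\<phi> v) f"
    using iso unfolding isomorphic_right_monoid_modules_def by auto
  have "\<phi> \<zero> = \<zero> \<otimes> \<phi> \<zero>" using module_hom_smult[OF hom, of \<zero> \<zero>] by simp
  moreover have "\<phi> \<zero> \<in> carrier R" using bij by (auto simp: bij_betw_def)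
  ultimately have z: "\<phi> \<zero> = \<zero>" by simp
  have o: "\<phi> \<one> \<noteq> \<zero>"
  proof
    assume "\<phi> \<one> = \<zero>"
    then have "\<phi> \<one> = \<phi> \<zero>" using z by simp
    from inj_onD[OF bij_betw_imp_inj_on[OF bij] this one_closed zero_closed] have "\<one> = \<zero>" .
    then show False by simp
  qed
  have "\<phi> (if \<chi> f then \<one> else \<zero>) = (if \<psi> f then \<phi> \<one> else \<zero>)"
    using act[OF one_closed f] by (simp add: character_act_def)
  then show ?thesis using z o by (cases "\<chi> f"; cases "\<psi> f") simp_all
qed

end

context finite_J_trivial_monoid begin

text \<open>Choose \<open>f\<close> acting nontrivially with the smallest right ideal \<open>f M\<close>.  For \<open>f g \<noteq> f\<close> minimality
  forces \<open>f g\<close> to act as zero, so every \<open>v f\<close> is fixed or annihilated by each \<open>g\<close>; a nonzero one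
  spans a submodule, hence everything.  If \<open>f\<close> were not idempotent, it would annihilate this
  spanning vector.\<close>

lemma simple_module_eigenvector:
  assumes simple: "simple_right_monoid_module K M V act"
  obtains e u where "e \<in> idempotents" "u \<in> carrier V" "u \<noteq> \<zero>\<^bsub>V\<^esub>"
    "\<forall>g\<in>carrier M. act u g = (if e \<otimes> g = e then u else \<zero>\<^bsub>V\<^esub>)"
    "carrier V = {c \<odot>\<^bsub>V\<^esub> u | c. c \<in> carrier K}"
proof -
  interpret right_monoid_module K M V act using simple by (simp add: simple_right_monoid_module_def)
  have nz: "carrier V \<noteq> {\<zero>\<^bsub>V\<^esub>}" and
    irr: "\<And>U. subspace K U V \<Longrightarrow> (\<And>v f. v \<in> U \<Longrightarrow> f \<in> carrier M \<Longrightarrow> act v f \<in> U) \<Longrightarrow> U = {\<zero>\<^bsub>V\<^esub>} \<or> U = carrier V"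
    using simple unfolding simple_right_monoid_module_def by blast+
  have act_closed: "act v f \<in> carrier V" if "v \<in> carrier V" "f \<in> carrier M" for v f
    using act_linear[OF that(2)] that(1) unfolding module_hom_def by auto
  have act_smult: "act (c \<odot>\<^bsub>V\<^esub> v) f = c \<odot>\<^bsub>V\<^esub> act v f"
    if "c \<in> carrier K" "v \<in> carrier V" "f \<in> carrier M" for c v f
    using act_linear[OF that(3)] that(1,2) unfolding module_hom_def by auto
  let ?S = "\<lambda>f. f \<in> carrier M \<and> (\<exists>v\<in>carrier V. act v f \<noteq> \<zero>\<^bsub>V\<^esub>)"
  obtain v0 where "v0 \<in> carrier V" "v0 \<noteq> \<zero>\<^bsub>V\<^esub>" using nz M.zero_closed by blast
  then have "?S \<one>" using act_one by (intro conjI bexI[of _ v0]) simp_all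
  then obtain f where f: "?S f" and least: "\<And>g. ?S g \<Longrightarrow> right_ideal_size f \<le> right_ideal_size g"
    using ex_has_least_nat[of ?S \<one> right_ideal_size] by blast
  from f have fM: "f \<in> carrier M" by blast
  from f obtain v where v: "v \<in> carrier V" "act v f \<noteq> \<zero>\<^bsub>V\<^esub>" by blast
  have kill: "act x (f \<otimes> g) = \<zero>\<^bsub>V\<^esub>" if "x \<in> carrier V" "g \<in> carrier M" "f \<otimes> g \<noteq> f" for x g
  proof (rule ccontr)
    assume "act x (f \<otimes> g) \<noteq> \<zero>\<^bsub>V\<^esub>"
    then have "?S (f \<otimes> g)" using that fM by blast
    then show False using least[of "f \<otimes> g"] right_ideal_size_less[OF fM that(2,3)] by simp
  qed
  define u where "u = act v f"
  have u: "u \<in> carrier V" "u \<noteq> \<zero>\<^bsub>V\<^esub>" using v act_closed fM by (simp_all add: u_def)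
  have ug: "act u g = (if f \<otimes> g = f then u else \<zero>\<^bsub>V\<^esub>)" if "g \<in> carrier M" for g
    using act_mult[OF fM that v(1)] kill[OF v(1) that] by (auto simp: u_def)
  let ?U = "{c \<odot>\<^bsub>V\<^esub> u | c. c \<in> carrier K}"
  have mod: "module K V" by (rule module_axioms)
  have "submodule K ?U V"
  proof (rule submodule.intro[OF mod])
    show "?U \<subseteq> carrier V" using u by auto
    have "\<zero>\<^bsub>V\<^esub> = \<zero>\<^bsub>K\<^esub> \<odot>\<^bsub>V\<^esub> u" using u by simp
    then show "\<zero>\<^bsub>V\<^esub> \<in> ?U" using R.zero_closed by blast
  next
    fix x y assume "x \<in> ?U" "y \<in> ?U"
    then obtain c d where "c \<in> carrier K" "d \<in> carrier K" "x = c \<odot>\<^bsub>V\<^esub> u" "y = d \<odot>\<^bsub>V\<^esub> u" by blast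
    moreover from this have "x \<oplus>\<^bsub>V\<^esub> y = (c \<oplus>\<^bsub>K\<^esub> d) \<odot>\<^bsub>V\<^esub> u" using u by (simp add: smult_l_distr)
    ultimately show "x \<oplus>\<^bsub>V\<^esub> y \<in> ?U" using R.a_closed by blast
  next
    fix c x assume c: "c \<in> carrier K" and "x \<in> ?U"
    then obtain d where d: "d \<in> carrier K" "x = d \<odot>\<^bsub>V\<^esub> u" by blast
    then have "c \<odot>\<^bsub>V\<^esub> x = (c \<otimes>\<^bsub>K\<^esub> d) \<odot>\<^bsub>V\<^esub> u" using c u by (simp add: smult_assoc1)
    then show "c \<odot>\<^bsub>V\<^esub> x \<in> ?U" using R.m_closed[OF c d(1)] by blast
  qed
  then have sub: "subspace K ?U V" by (intro subspace.intro vectorspace_axioms)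
  have stable: "act x g \<in> ?U" if x: "x \<in> ?U" and g: "g \<in> carrier M" for x g
  proof -
    obtain c where c: "c \<in> carrier K" "x = c \<odot>\<^bsub>V\<^esub> u" using x by blast
    have "act x g = (if f \<otimes> g = f then c else \<zero>\<^bsub>K\<^esub>) \<odot>\<^bsub>V\<^esub> u"
      unfolding c(2) using act_smult[OF c(1) u(1) g] ug[OF g] c(1) u(1) by simp
    then show ?thesis using c(1) R.zero_closed by auto
  qed
  have "u = \<one>\<^bsub>K\<^esub> \<odot>\<^bsub>V\<^esub> u" using u by simp
  then have "u \<in> ?U" using R.one_closed by blast
  then have V: "carrier V = ?U" using irr[OF sub stable] u(2) by blast
  have "f \<otimes> f = f"
  proof (rule ccontr)
    assume ff: "f \<otimes> f \<noteq> f"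
    obtain c where c: "c \<in> carrier K" "v = c \<odot>\<^bsub>V\<^esub> u" using v(1) V by blast
    have "act v f = \<zero>\<^bsub>V\<^esub>" unfolding c(2) using act_smult[OF c(1) u(1) fM] ug[OF fM] ff c(1) by simp
    then show False using v(2) by simp
  qed
  then have f_idem: "f \<in> idempotents" using fM by (simp add: idempotents_def)
  have "\<forall>g\<in>carrier M. act u g = (if f \<otimes> g = f then u else \<zero>\<^bsub>V\<^esub>)" using ug by blast
  from that[OF f_idem u this V] show ?thesis .
qed

lemma simple_module_one_dimensional:
  assumes simple: "simple_right_monoid_module K M V act"
  shows "vectorspace.fin_dim K V \<and> vectorspace.dim K V = 1"
proof -
  interpret right_monoid_module K M V act using simple by (simp add: simple_right_monoid_module_def)
  obtain e u where "e \<in> idempotents" and u: "u \<in> carrier V" "u \<noteq> \<zero>\<^bsub>V\<^esub>" 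
    and "\<forall>g\<in>carrier M. act u g = (if e \<otimes> g = e then u else \<zero>\<^bsub>V\<^esub>)"
    and V: "carrier V = {c \<odot>\<^bsub>V\<^esub> u | c. c \<in> carrier K}"
    using simple_module_eigenvector[OF simple] .
  have lc: "lincomb a {u} = a u \<odot>\<^bsub>V\<^esub> u" if "a u \<in> carrier K" for a
    using that u unfolding lincomb_def by (simp add: M.finsum_insert M.finsum_empty)
  have "lin_indpt {u}"
  proof (rule finite_lin_indpt2)
    fix a assume a: "a \<in> {u} \<rightarrow> carrier K" and z: "lincomb a {u} = \<zero>\<^bsub>V\<^esub>"
    have au: "a u \<in> carrier K" using a by blast
    have eq: "a u \<odot>\<^bsub>V\<^esub> u = \<zero>\<^bsub>V\<^esub>" using lc[of a, OF au] z by simp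
    have "a u = \<zero>\<^bsub>K\<^esub>" by (rule smult_zero_imp_zero[OF au u eq])
    then show "\<forall>v\<in>{u}. a v = \<zero>\<^bsub>K\<^esub>" by simp
  qed (use u in auto)
  moreover have "span {u} = carrier V"
  proof
    show "span {u} \<subseteq> carrier V" using u by (intro span_is_subset2) simp
    show "carrier V \<subseteq> span {u}"
    proof
      fix x assume "x \<in> carrier V"
      then obtain c where c: "c \<in> carrier K" "x = c \<odot>\<^bsub>V\<^esub> u" using V by blast
      then have "x = lincomb (\<lambda>_. c) {u}" using lc[of "\<lambda>_. c"] by simp
      then show "x \<in> span {u}" unfolding span_def using c(1) by blast
    qed
  qed
  ultimately have basis: "basis {u}" using u by (simp add: basis_def)
  have "fin_dim" using basis u unfolding fin_dim_def basis_def by (intro exI[of _ "{u}"]) auto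
  moreover have "dim = card {u}" by (rule dim_basis) (use basis in auto)
  ultimately show ?thesis by simp
qed

lemma simple_module_isomorphic_line:
  assumes simple: "simple_right_monoid_module K M V act"
  obtains e where "e \<in> idempotents"
    "isomorphic_right_monoid_modules K M V act (line K) (character_act K (\<lambda>g. e \<otimes> g = e))"
proof -
  interpret right_monoid_module K M V act using simple by (simp add: simple_right_monoid_module_def)
  obtain e u where e: "e \<in> idempotents" and u: "u \<in> carrier V" "u \<noteq> \<zero>\<^bsub>V\<^esub>" 
    and ug: "\<forall>g\<in>carrier M. act u g = (if e \<otimes> g = e then u else \<zero>\<^bsub>V\<^esub>)"
    and V: "carrier V = {c \<odot>\<^bsub>V\<^esub> u | c. c \<in> carrier K}"
    using simple_module_eigenvector[OF simple] .
  have inj: "c = d" if "c \<in> carrier K" "d \<in> carrier K" "c \<odot>\<^bsub>V\<^esub> u = d \<odot>\<^bsub>V\<^esub> u" for c d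
  proof (rule ccontr)
    assume ne: "c \<noteq> d"
    define b where "b = c \<ominus>\<^bsub>K\<^esub> d"
    have bK: "b \<in> carrier K" using that by (simp add: b_def)
    have "b \<odot>\<^bsub>V\<^esub> u = c \<odot>\<^bsub>V\<^esub> u \<oplus>\<^bsub>V\<^esub> (\<ominus>\<^bsub>K\<^esub> d) \<odot>\<^bsub>V\<^esub> u"
      unfolding b_def R.minus_eq using that(1,2) u by (simp add: smult_l_distr)
    also have "\<dots> = (d \<oplus>\<^bsub>K\<^esub> \<ominus>\<^bsub>K\<^esub> d) \<odot>\<^bsub>V\<^esub> u"
      unfolding that(3) using that(2) u by (subst smult_l_distr) simp_all
    finally have bz: "b \<odot>\<^bsub>V\<^esub> u = \<zero>\<^bsub>V\<^esub>" using that(2) u by (simp add: R.r_neg)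
    have "b = \<zero>\<^bsub>K\<^esub>" by (rule smult_zero_imp_zero[OF bK u bz])
    then show False using that(1,2) ne by (simp add: b_def)
  qed
  define \<phi> where "\<phi> x = (THE c. c \<in> carrier K \<and> x = c \<odot>\<^bsub>V\<^esub> u)" for x
  have \<phi>: "\<phi> (c \<odot>\<^bsub>V\<^esub> u) = c" if "c \<in> carrier K" for c
    unfolding \<phi>_def by (rule the_equality) (use that inj in blast)+
  have V': "\<exists>c\<in>carrier K. x = c \<odot>\<^bsub>V\<^esub> u" if "x \<in> carrier V" for x using V that by blast
  have \<phi>_line: "\<phi> \<in> carrier V \<rightarrow> carrier (line K)"
  proof
    fix x assume "x \<in> carrier V"
    then obtain c where "c \<in> carrier K" "x = c \<odot>\<^bsub>V\<^esub> u" using V' by blast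
    then show "\<phi> x \<in> carrier (line K)" using \<phi> by simp
  qed
  have hom: "\<phi> \<in> module_hom K V (line K)"
    unfolding module_hom_def
  proof (intro CollectI conjI allI impI)
    show "\<phi> \<in> carrier V \<rightarrow> carrier (line K)" by (rule \<phi>_line)
  next
    fix x y assume "x \<in> carrier V \<and> y \<in> carrier V"
    then have xV: "x \<in> carrier V" and yV: "y \<in> carrier V" by blast+
    obtain c where c: "c \<in> carrier K" "x = c \<odot>\<^bsub>V\<^esub> u" using V'[OF xV] by blast
    obtain d where d: "d \<in> carrier K" "y = d \<odot>\<^bsub>V\<^esub> u" using V'[OF yV] by blast
    note cd = c(1) d(1) c(2) d(2)
    have "x \<oplus>\<^bsub>V\<^esub> y = (c \<oplus>\<^bsub>K\<^esub> d) \<odot>\<^bsub>V\<^esub> u" using cd u by (simp add: smult_l_distr)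
    then show "\<phi> (x \<oplus>\<^bsub>V\<^esub> y) = \<phi> x \<oplus>\<^bsub>line K\<^esub> \<phi> y" using \<phi> cd by simp
  next
    fix r x assume r: "r \<in> carrier K \<and> x \<in> carrier V"
    then obtain c where c: "c \<in> carrier K" "x = c \<odot>\<^bsub>V\<^esub> u" using V'[of x] by blast
    have "r \<odot>\<^bsub>V\<^esub> x = (r \<otimes>\<^bsub>K\<^esub> c) \<odot>\<^bsub>V\<^esub> u" using c r u by (simp add: smult_assoc1)
    then show "\<phi> (r \<odot>\<^bsub>V\<^esub> x) = r \<odot>\<^bsub>line K\<^esub> \<phi> x" using \<phi> c r by simp
  qed
  have bij: "bij_betw \<phi> (carrier V) (carrier (line K))"
    unfolding bij_betw_def
  proof
    show "inj_on \<phi> (carrier V)"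
    proof (rule inj_onI)
      fix x y assume xy: "x \<in> carrier V" "y \<in> carrier V" "\<phi> x = \<phi> y"
      obtain c where c: "c \<in> carrier K" "x = c \<odot>\<^bsub>V\<^esub> u" using V'[OF xy(1)] by blast
      obtain d where d: "d \<in> carrier K" "y = d \<odot>\<^bsub>V\<^esub> u" using V'[OF xy(2)] by blast
      show "x = y" using \<phi>[OF c(1)] \<phi>[OF d(1)] c(2) d(2) xy(3) by simp
    qed
    show "\<phi> ` carrier V = carrier (line K)"
    proof
      show "\<phi> ` carrier V \<subseteq> carrier (line K)" using \<phi>_line by blast
      show "carrier (line K) \<subseteq> \<phi> ` carrier V"
      proof
        fix c assume "c \<in> carrier (line K)"
        then have "c \<in> carrier K" "c \<odot>\<^bsub>V\<^esub> u \<in> carrier V" using u by simp_all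
        then show "c \<in> \<phi> ` carrier V" using \<phi> by (intro image_eqI[of _ _ "c \<odot>\<^bsub>V\<^esub> u"]) simp_all
      qed
    qed
  qed
  have "\<phi> (act x g) = character_act K (\<lambda>g. e \<otimes> g = e) (\<phi> x) g" if x: "x \<in> carrier V" and g: "g \<in> carrier M" for x g
  proof -
    obtain c where c: "c \<in> carrier K" "x = c \<odot>\<^bsub>V\<^esub> u" using V' x by blast
    have "act x g = c \<odot>\<^bsub>V\<^esub> act u g"
      using act_linear[OF g] c u unfolding module_hom_def by simp
    also have "\<dots> = (if e \<otimes> g = e then c else \<zero>\<^bsub>K\<^esub>) \<odot>\<^bsub>V\<^esub> u"
      using ug g c u by simp
    finally show ?thesis using \<phi> c by (simp add: character_act_def)
  qed
  then have "isomorphic_right_monoid_modules K M V act (line K) (character_act K (\<lambda>g. e \<otimes> g = e))"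
    unfolding isomorphic_right_monoid_modules_def using hom bij by blast
  from that[OF e this] show ?thesis .
qed

end

section \<open>The Borel submonoid of the biHecke monoid\<close>

lemma (in finite_coxeter_group) borel_J_trivial: "finite_J_trivial_monoid B"
proof -
  interpret Bm: monoid B by (rule borel_monoid)
  show ?thesis
    by unfold_locales (use borel_finite borel_R_trivial borel_L_trivial in blast)+
qed

text \<open>The abstract character \<open>e g = e\<close> and the condition \<open>g w = w\<close> agree only on the monoid, so actions
  are compared there.\<close>

lemma isomorphic_right_monoid_modules_cong:
  assumes "isomorphic_right_monoid_modules K M V act V' act'"
    and "\<And>c f. f \<in> carrier M \<Longrightarrow> act' c f = act'' c f"
  shows "isomorphic_right_monoid_modules K M V act V' act''"
  using assms unfolding isomorphic_right_monoid_modules_def by simp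

theorem theorem4p3:
  fixes W :: "('w, 'e) monoid_scheme"
    and I :: "'i set" and s :: "'i \<Rightarrow> 'w" and m :: "'i \<Rightarrow> 'i \<Rightarrow> nat"
    and K :: "('k, 'c) ring_scheme"
  assumes cox: "coxeter_system W I s m"
    and fin: "finite (carrier W)"
    and K: "field K"
  shows "let M\<^sub>1 = borel_submonoid W I s;
             A = monoid_algebra K M\<^sub>1;
             b = (\<lambda>f. monoid_algebra_of K M\<^sub>1 (eventual_power M\<^sub>1 f) \<ominus>\<^bsub>A\<^esub> monoid_algebra_of K M\<^sub>1 f)
         in
           (ideal (jacobson_radical A) A \<and>
            inj_on b (nonidempotents M\<^sub>1) \<and>
            vectorspace.basis K (A\<lparr>carrier := jacobson_radical A\<rparr>) (b ` nonidempotents M\<^sub>1)) \<and>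
           cring (A Quot jacobson_radical A) \<and>
           (\<forall>(V :: ('k, 'v) module) act. simple_right_monoid_module K M\<^sub>1 V act \<longrightarrow>
              vectorspace.fin_dim K V \<and> vectorspace.dim K V = 1) \<and>
           ((\<forall>w\<in>carrier W. simple_right_monoid_module K M\<^sub>1 (line K) (S_act K w)) \<and>
            (\<forall>w\<in>carrier W. \<forall>w'\<in>carrier W.
               isomorphic_right_monoid_modules K M\<^sub>1 (line K) (S_act K w) (line K) (S_act K w')
                 \<longrightarrow> w = w') \<and>
            (\<forall>(V :: ('k, 'v) module) act. simple_right_monoid_module K M\<^sub>1 V act \<longrightarrow>
              (\<exists>w\<in>carrier W.
                 isomorphic_right_monoid_modules K M\<^sub>1 V act (line K) (S_act K w))))"
proof -
  have grp: "group W" using cox unfolding coxeter_system_def presented_by_def by blast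
  interpret W: finite_coxeter_group W I s m
    by (intro finite_coxeter_group.intro coxeter_group.intro grp
        coxeter_group_axioms.intro finite_coxeter_group_axioms.intro cox fin)
  interpret K: field K by (rule K)
  interpret B: finite_J_trivial_monoid W.B by (rule W.borel_J_trivial)
  interpret J: J_trivial_algebra W.B K
    by (intro J_trivial_algebra.intro W.borel_J_trivial K)
  have S_simple: "simple_right_monoid_module K W.B (line K) (S_act K w)" if w: "w \<in> carrier W" for w
    unfolding S_act_eq
  proof (rule K.character_module_simple)
    show "\<one>\<^bsub>W.B\<^esub> w = w" using w by (simp add: W.borel_one)
  next
    fix f g assume f: "f \<in> carrier W.B" and g: "g \<in> carrier W.B"
    have fw: "f w \<in> carrier W" using W.bihecke_closed[OF W.borel_bihecke[OF f] w] .
    show "(f \<otimes>\<^bsub>W.B\<^esub> g) w = w \<longleftrightarrow> f w = w \<and> g w = w"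
    proof
      assume "(f \<otimes>\<^bsub>W.B\<^esub> g) w = w"
      then have gf: "g (f w) = w" using w by (simp add: W.borel_mult_apply)
      then have "W.bruhat w (f w)" using W.borel_regressive[OF g fw] by simp
      then have "f w = w" using W.bruhat_antisym W.borel_regressive[OF f w] by blast
      then show "f w = w \<and> g w = w" using gf by simp
    qed (use w in \<open>simp add: W.borel_mult_apply\<close>)
  qed
  have S_distinct: "w = w'"
    if w: "w \<in> carrier W" "w' \<in> carrier W"
      and iso: "isomorphic_right_monoid_modules K W.B (line K) (S_act K w) (line K) (S_act K w')" for w w'
    by (rule W.fixing_determines[OF w])
      (rule K.isomorphic_character_modules[OF iso[unfolded S_act_eq]])
  have S_complete: "\<exists>w\<in>carrier W. isomorphic_right_monoid_modules K W.B V act (line K) (S_act K w)"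
    if simple: "simple_right_monoid_module K W.B V act" for V :: "('k, 'v) module" and act
  proof -
    obtain e where e: "e \<in> B.idempotents" and
      iso: "isomorphic_right_monoid_modules K W.B V act (line K) (character_act K (\<lambda>g. e \<otimes>\<^bsub>W.B\<^esub> g = e))"
      using B.simple_module_isomorphic_line[OF simple] .
    have eB: "e \<in> carrier W.B" "e \<otimes>\<^bsub>W.B\<^esub> e = e" using e by (simp_all add: B.idempotents_def)
    obtain w where w: "w \<in> carrier W" and
      fix_iff: "\<And>g. g \<in> carrier W.B \<Longrightarrow> e \<otimes>\<^bsub>W.B\<^esub> g = e \<longleftrightarrow> g w = w"
      using W.idempotent_fix[OF eB] by blast
    have "isomorphic_right_monoid_modules K W.B V act (line K) (S_act K w)"
      by (rule isomorphic_right_monoid_modules_cong[OF iso]) (simp add: S_act_eq character_act_def fix_iff)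
    then show ?thesis using w by blast
  qed
  have "ideal (jacobson_radical J.A) J.A"
    unfolding J.jacobson_radical_eq by (rule J.character_kernel_ideal)
  moreover have "vectorspace.basis K (J.A\<lparr>carrier := jacobson_radical J.A\<rparr>) (J.radical_vector ` nonidempotents W.B)"
    unfolding J.jacobson_radical_eq by (rule J.character_kernel_basis)
  moreover have "cring (J.A Quot jacobson_radical J.A)"
    unfolding J.jacobson_radical_eq by (rule J.quotient_character_kernel_cring)
  ultimately show ?thesis
    unfolding Let_def
    by (intro conjI ballI allI impI J.radical_vector_inj S_simple S_distinct S_complete)
      (auto dest: B.simple_module_one_dimensional)
qed

end
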